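(* For every problem instance satisfying the Piecewise Stabilizability assumption (with constants $C_W\ge0$, $\epsilon>0$), the Reference Policy Stationarity assumption (with constants $\delta$, $C_V$) and the bounded-moment assumption (with constants $\alpha$, $M$), the policy \texttt{SoftMW+}, run with parameters $M,\alpha,K,\delta$ (where $\alpha>14$ and $0<\delta\le\frac12$), guarantees $$\frac1T\,\mathbb E\left[\sum_{t=1}^T\lVert\mathbf Q_t\rVert_1\right]\le\frac{2(K+1)M^2+4C_W(KM^2+\epsilon KM)}{\epsilon}+o(1)\qquad(T\to\infty)$$ as long as $\delta\cdot\alpha>7$. In particular, the system is stable.
   Context: Notation: $[K]=\{1,\dots,K\}$; $\Delta^{[K]}$ is the probability simplex over $[K]$; $\Delta^{[K],\beta}=\{\mathbf x\in\Delta^{[K]}:x_i\ge\beta\ \forall i\}$. Queueing model: $K$ job types (queues), time slots $t=1,2,\dots$. Distributions $\mathcal A_1,\mathcal A_2,\dots$ and $\mathcal S_1,\mathcal S_2,\dots$ on $\mathbb R_+^K$ are fixed before the process starts; $\mathbf A_t\sim\mathcal A_t$ (arrivals) and $\mathbf S_t\sim\mathcal S_t$ (maximum services), all $\mathbf A_t,\mathbf S_t$ being independent; $\vec\lambda_t=\mathbb E[\mathbf A_t]$, $\vec\sigma_t=\mathbb E[\mathbf S_t]$. At the beginning of slot $t$ the scheduler, using only the past history (and its own randomization), chooses one queue $a_t\in[K]$; then $S_{t,a_t}$ is observed. Queue lengths: $\mathbf Q_0=\mathbf 0$, $Q_{t,i}=\max\{Q_{t-1,i}+A_{t,i}-S_{t,i}\mathbf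 1[i=a_t],0\}$. $\mathcal F_t=\sigma(a_1,\dots,a_t,\mathbf Q_0,\dots,\mathbf Q_t,\mathbf A_1,\dots,\mathbf A_t,S_{1,a_1},\dots,S_{t,a_t})$. The system is stable under a policy if $\frac1T\sum_{t=0}^{T-1}\sum_{i=1}^K\mathbb E[Q_{t,i}]=O(1)$. Bounded-moment assumption: there are constants $\alpha\ge2$, $M>0$, known to the scheduler, with $\mathbb E[A_{t,i}^\alpha\mid\mathcal F_{t-1}]\le M^\alpha$ and $\mathbb E[S_{t,i}^\alpha\mid\mathcal F_{t-1}]\le M^\alpha$ for all $t\ge1$, $i\in[K]$. Piecewise Stabilizability: there exist $C_W\ge0$, $\epsilon>0$, $\vec\theta_1,\vec\theta_2,\dots\in\Delta^{[K]}$ and a partition of the positive integers into intervals $W_0,W_1,\dots$ such that $\sum_{i:\min W_i<T}(|W_i|-1)^2\le C_WT$ for all $T\ge1$, and for all $i\ge0$, $j\in[K]$: $\frac1{|W_i|}\sum_{t\in W_i}\theta_{t,j}\sigma_{t,j}\ge\epsilon+\frac1{|W_i|}\sum_{t\in W_i}\lambda_{t,j}$. Reference Policy Stationarity: for the same sequence $\{\vec\theta_t\}$ there exist $\delta>0$, $C_V>0$ with $\sum_{t=1}^{T-1}\lVert\vec\theta_{t+1}-\vec\theta_t\rVert_1\le C_VT^{\frac12-\delta}$ for all $T\ge1$. \texttt{EXP3.S+} (a bandit algorithm with $K$ actions and initial point $\mathbf x_1\in\Delta^{[K]}$): let $\Psi(\mathbf x)=\sum_i(x_i\ln x_i-x_i)$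 and $D_\Psi(\mathbf y,\mathbf x)=\Psi(\mathbf y)-\Psi(\mathbf x)-\langle\nabla\Psi(\mathbf x),\mathbf y-\mathbf x\rangle$. At round $t$, given $\beta_t\in[0,1/K]$, $\eta_t>0$, $\mathbf e_t\in\Delta^{[K]}$, $\gamma_t\in[0,1/2]$: set $\mathbf p_t=(1-\gamma_t)\mathbf x_t+\gamma_t\mathbf e_t$; sample and output $a_t\sim\mathbf p_t$; receive feedback $g_{t,a_t}$; let $\tilde{\mathbf g}_t$ have $a_t$-th coordinate $g_{t,a_t}/p_{t,a_t}$ and zeros elsewhere; set $\mathbf x_{t+1}=\arg\min_{\mathbf x'\in\Delta^{[K],\beta_t}}\{\langle-\eta_t\tilde{\mathbf g}_t,\mathbf x'\rangle+D_\Psi(\mathbf x',\mathbf x_t)\}$. \texttt{SoftMW+} (inputs $M>0$, $\alpha>14$, $K$, $0<\delta\le\frac12$): set $L_0=M$ and run one \texttt{EXP3.S+} instance with $\mathbf x_1=\mathbf 1/K$. In slot $t=1,2,\dots$ use $\beta_t=t^{-4}/K$, $\eta_t=\Big(t^{-(\frac14-\frac\delta2)}L_{t-1}\sqrt{86L_{t-1}^2K^6t^{3/2}+\sum_{s=0}^{t-1}\lVert\mathbf Q_s\rVert_2^2}\Big)^{-1}$, $\mathbf e_t=\mathbf Q_{t-1}/\lVert\mathbf Q_{t-1}\rVert_1$ (arbitrary in $\Delta^{[K]}$ if $\mathbf Q_{t-1}=\mathbf 0$), $\gamma_t=Mt^{\frac\delta4}\eta_t\lVert\mathbf Q_{t-1}\rVert_1$;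 serve the queue $a_t$ output by \texttt{EXP3.S+}, observe $S_{t,a_t}$, let $S'_t=S_{t,a_t}$ if $S_{t,a_t}\le Mt^{\frac\delta4}$ and $S'_t=0$ otherwise, feed $g_{t,a_t}=Q_{t-1,a_t}S'_t$ back to \texttt{EXP3.S+}, and set $L_t=\max\{L_{t-1},\lVert\mathbf Q_t-\mathbf Q_{t-1}\rVert_\infty\}$. *)

theory Defs
  imports "HOL-Probability.Probability"
begin

section \<open>Vectors, simplices and the Bregman divergence\<close>

text \<open>
  The job types are the elements of a finite type \<open>'k\<close>, so \<open>K = CARD('k)\<close>, and vectors indexed
  by job types have type \<open>real ^ 'k\<close>.  The Euclidean norm is \<^const>\<open>norm\<close> and the maximum norm is
  \<^const>\<open>infnorm\<close>.
\<close>

definition norm1 :: "real ^ 'k \<Rightarrow> real" where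
  "norm1 v = (\<Sum>i\<in>UNIV. \<bar>v $ i\<bar>)"

definition prob_simplex :: "(real ^ 'k) set" where
  "prob_simplex = {x. (\<forall>i. 0 \<le> x $ i) \<and> (\<Sum>i\<in>UNIV. x $ i) = 1}"

definition trunc_simplex :: "real \<Rightarrow> (real ^ 'k) set" where
  "trunc_simplex b = {x \<in> prob_simplex. \<forall>i. b \<le> x $ i}"

text \<open>Since \<open>ln 0 = 0\<close>, the usual convention \<open>0 ln 0 = 0\<close> is in force.\<close>

definition neg_entropy :: "real ^ 'k \<Rightarrow> real" where
  "neg_entropy x = (\<Sum>i\<in>UNIV. x $ i * ln (x $ i) - x $ i)"

definition gradient :: "('a::real_inner \<Rightarrow> real) \<Rightarrow> 'a \<Rightarrow> 'a" where
  "gradient f x = (THE D. GDERIV f x :> D)"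

definition bregman :: "('a::real_inner \<Rightarrow> real) \<Rightarrow> 'a \<Rightarrow> 'a \<Rightarrow> real" where
  "bregman f y x = f y - f x - gradient f x \<bullet> (y - x)"


section \<open>The queueing model\<close>

text \<open>The natural filtration \<open>\<F>\<^sub>t\<close> of what has happened up to the end of slot \<open>t\<close>.\<close>

definition history ::
  "'w measure \<Rightarrow> (nat \<Rightarrow> 'w \<Rightarrow> real ^ 'k) \<Rightarrow> (nat \<Rightarrow> 'w \<Rightarrow> real ^ 'k) \<Rightarrow> (nat \<Rightarrow> 'w \<Rightarrow> 'k) \<Rightarrow>
    (nat \<Rightarrow> 'w \<Rightarrow> real ^ 'k) \<Rightarrow> nat \<Rightarrow> 'w measure" where
  "history P A S a Q t = sigma (space P)
    ((\<Union>s\<in>{1..t}. sets (vimage_algebra (space P) (a s) (count_space UNIV))) \<union>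
     (\<Union>s\<in>{0..t}. sets (vimage_algebra (space P) (Q s) borel)) \<union>
     (\<Union>s\<in>{1..t}. sets (vimage_algebra (space P) (A s) borel)) \<union>
     (\<Union>s\<in>{1..t}. sets (vimage_algebra (space P) (\<lambda>\<omega>. S s \<omega> $ a s \<omega>) borel)))"

text \<open>
  \<open>\<F>\<^sub>t\<close> enlarged by the arrivals and the (also unobserved) services of all slots, past and future.
  A scheduler that uses only the past and its own randomization draws \<open>a\<^sub>t \<sim> p\<^sub>t\<close> with a private
  coin; that is, the conditional law of \<open>a\<^sub>t\<close> given this enlargement of \<open>\<F>\<^sub>t\<^sub>-\<^sub>1\<close> is still \<open>p\<^sub>t\<close>.
\<close>

definition history_env ::
  "'w measure \<Rightarrow> (nat \<Rightarrow> 'w \<Rightarrow> real ^ 'k) \<Rightarrow> (nat \<Rightarrow> 'w \<Rightarrow> real ^ 'k) \<Rightarrow> (nat \<Rightarrow> 'w \<Rightarrow> 'k) \<Rightarrow>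
    (nat \<Rightarrow> 'w \<Rightarrow> real ^ 'k) \<Rightarrow> nat \<Rightarrow> 'w measure" where
  "history_env P A S a Q t = sigma (space P)
    (sets (history P A S a Q t) \<union>
     (\<Union>s\<in>{1..}. sets (vimage_algebra (space P) (A s) borel)) \<union>
     (\<Union>s\<in>{1..}. sets (vimage_algebra (space P) (S s) borel)))"

text \<open>
  \<open>\<A> t\<close> and \<open>\<S> t\<close> are the deterministic, time-varying laws of the arrivals \<open>A t\<close> and of the
  maximum services \<open>S t\<close>.  The components of one vector may be dependent.
\<close>

locale queueing_system = prob_space P
  for P :: "'w measure" +
  fixes \<A> \<S> :: "nat \<Rightarrow> (real ^ 'k) measure"
    and A S :: "nat \<Rightarrow> 'w \<Rightarrow> real ^ 'k"
    and a :: "nat \<Rightarrow> 'w \<Rightarrow> 'k"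
    and Q :: "nat \<Rightarrow> 'w \<Rightarrow> real ^ 'k"
  assumes arrival_nonneg: "\<And>t. 1 \<le> t \<Longrightarrow> AE v in \<A> t. \<forall>i. 0 \<le> v $ i"
    and service_nonneg: "\<And>t. 1 \<le> t \<Longrightarrow> AE v in \<S> t. \<forall>i. 0 \<le> v $ i"
    and arrival_law: "\<And>t. 1 \<le> t \<Longrightarrow> distr P borel (A t) = \<A> t"
    and service_law: "\<And>t. 1 \<le> t \<Longrightarrow> distr P borel (S t) = \<S> t"
    and independent: "indep_vars (\<lambda>_. borel) (case_sum A S) ({1..} <+> {1..})"
    and action_measurable: "\<And>t. 1 \<le> t \<Longrightarrow> a t \<in> measurable P (count_space UNIV)"
    and queue_0: "\<And>\<omega>. \<omega> \<in> space P \<Longrightarrow> Q 0 \<omega> = 0"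
    and queue_step: "\<And>t \<omega>. 1 \<le> t \<Longrightarrow> \<omega> \<in> space P \<Longrightarrow>
      Q t \<omega> = (\<chi> i. max (Q (t - 1) \<omega> $ i + A t \<omega> $ i
                            - S t \<omega> $ i * (if i = a t \<omega> then 1 else 0)) 0)"

text \<open>
  \<open>O(1)\<close> presupposes finite expectations.  As the Bochner integral of a non-integrable function
  is \<open>0\<close>, integrability is demanded explicitly.
\<close>

definition stable :: "'w measure \<Rightarrow> (nat \<Rightarrow> 'w \<Rightarrow> real ^ 'k) \<Rightarrow> bool" where
  "stable P Q \<longleftrightarrow>
    (\<forall>t i. integrable P (\<lambda>\<omega>. Q t \<omega> $ i)) \<and>
    (\<lambda>T::nat. 1 / real T * (\<Sum>t<T. \<Sum>i\<in>UNIV. (\<integral>\<omega>. Q t \<omega> $ i \<partial>P))) \<in> O(\<lambda>_. 1)"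


section \<open>Assumptions on the problem instance\<close>

definition bounded_moments ::
  "'w measure \<Rightarrow> (nat \<Rightarrow> 'w \<Rightarrow> real ^ 'k) \<Rightarrow> (nat \<Rightarrow> 'w \<Rightarrow> real ^ 'k) \<Rightarrow> (nat \<Rightarrow> 'w \<Rightarrow> 'k) \<Rightarrow>
    (nat \<Rightarrow> 'w \<Rightarrow> real ^ 'k) \<Rightarrow> real \<Rightarrow> real \<Rightarrow> bool" where
  "bounded_moments P A S a Q \<alpha> M \<longleftrightarrow> 2 \<le> \<alpha> \<and> 0 < M \<and>
    (\<forall>t\<ge>1. \<forall>i.
      (AE \<omega> in P. nn_cond_exp P (history P A S a Q (t - 1))
         (\<lambda>\<omega>. ennreal (A t \<omega> $ i powr \<alpha>)) \<omega> \<le> ennreal (M powr \<alpha>)) \<and>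
      (AE \<omega> in P. nn_cond_exp P (history P A S a Q (t - 1))
         (\<lambda>\<omega>. ennreal (S t \<omega> $ i powr \<alpha>)) \<omega> \<le> ennreal (M powr \<alpha>)))"

definition mean_vec :: "(real ^ 'k) measure \<Rightarrow> real ^ 'k" where
  "mean_vec D = (\<chi> i. \<integral>v. v $ i \<partial>D)"

text \<open>
  The intervals \<open>W i\<close> are non-empty and finite, because their lengths enter the conditions below.
\<close>

definition interval_partition :: "(nat \<Rightarrow> nat set) \<Rightarrow> bool" where
  "interval_partition W \<longleftrightarrow>
    (\<forall>i. \<exists>l u. l \<le> u \<and> W i = {l..u}) \<and> disjoint_family W \<and> (\<Union>i. W i) = {1..}"

definition piecewise_stabilizable ::
  "(nat \<Rightarrow> (real ^ 'k) measure) \<Rightarrow> (nat \<Rightarrow> (real ^ 'k) measure) \<Rightarrow>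
    real \<Rightarrow> real \<Rightarrow> (nat \<Rightarrow> real ^ 'k) \<Rightarrow> bool" where
  "piecewise_stabilizable \<A> \<S> C\<^sub>W \<epsilon> \<theta> \<longleftrightarrow> 0 \<le> C\<^sub>W \<and> 0 < \<epsilon> \<and> (\<forall>t\<ge>1. \<theta> t \<in> prob_simplex) \<and>
    (\<exists>W. interval_partition W \<and>
      (\<forall>T\<ge>1. (\<Sum>i\<in>{i. Min (W i) < T}. (real (card (W i)) - 1)\<^sup>2) \<le> C\<^sub>W * real T) \<and>
      (\<forall>i j. 1 / real (card (W i)) * (\<Sum>t\<in>W i. \<theta> t $ j * mean_vec (\<S> t) $ j)
           \<ge> \<epsilon> + 1 / real (card (W i)) * (\<Sum>t\<in>W i. mean_vec (\<A> t) $ j)))"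

definition reference_stationary :: "real \<Rightarrow> real \<Rightarrow> (nat \<Rightarrow> real ^ 'k) \<Rightarrow> bool" where
  "reference_stationary \<delta> C\<^sub>V \<theta> \<longleftrightarrow> 0 < \<delta> \<and> 0 < C\<^sub>V \<and>
    (\<forall>T::nat\<ge>1. (\<Sum>t\<in>{1..<T}. norm1 (\<theta> (t + 1) - \<theta> t)) \<le> C\<^sub>V * real T powr (1 / 2 - \<delta>))"


section \<open>The algorithms\<close>

text \<open>
  A run of EXP3.S+ with initial point \<open>x\<^sub>1\<close>.  Round \<open>t\<close> uses the parameters \<open>\<beta> t\<close>, \<open>\<eta> t\<close>, \<open>\<gamma> t\<close>,
  \<open>e t\<close> and receives the scalar feedback \<open>g t\<close> for the sampled action \<open>a t\<close>; \<open>H t\<close> is the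
  sigma-algebra given which the action of round \<open>t + 1\<close> is sampled.
\<close>

definition exp3sp_run ::
  "'w measure \<Rightarrow> (nat \<Rightarrow> 'w measure) \<Rightarrow> real ^ 'k \<Rightarrow>
    (nat \<Rightarrow> real) \<Rightarrow> (nat \<Rightarrow> 'w \<Rightarrow> real) \<Rightarrow> (nat \<Rightarrow> 'w \<Rightarrow> real) \<Rightarrow> (nat \<Rightarrow> 'w \<Rightarrow> real ^ 'k) \<Rightarrow>
    (nat \<Rightarrow> 'w \<Rightarrow> real ^ 'k) \<Rightarrow> (nat \<Rightarrow> 'w \<Rightarrow> real ^ 'k) \<Rightarrow> (nat \<Rightarrow> 'w \<Rightarrow> 'k) \<Rightarrow> (nat \<Rightarrow> 'w \<Rightarrow> real) \<Rightarrow>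
    bool" where
  "exp3sp_run P H x\<^sub>1 \<beta> \<eta> \<gamma> e x p a g \<longleftrightarrow>
    (\<forall>\<omega>\<in>space P. x 1 \<omega> = x\<^sub>1) \<and>
    (\<forall>t\<ge>1.
      (\<forall>\<omega>\<in>space P. p t \<omega> = (1 - \<gamma> t \<omega>) *\<^sub>R x t \<omega> + \<gamma> t \<omega> *\<^sub>R e t \<omega>) \<and>
      (\<forall>i. AE \<omega> in P. real_cond_exp P (H (t - 1)) (indicator {\<omega> \<in> space P. a t \<omega> = i}) \<omega>
                      = p t \<omega> $ i) \<and>
      (\<forall>\<omega>\<in>space P.
        let g' = (\<chi> j. if j = a t \<omega> then g t \<omega> / p t \<omega> $ j else 0)
        in is_arg_min (\<lambda>x'. (- \<eta> t \<omega> *\<^sub>R g') \<bullet> x' + bregman neg_entropy x' (x t \<omega>))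
             (\<lambda>x'. x' \<in> trunc_simplex (\<beta> t)) (x (t + 1) \<omega>)))"

text \<open>
  In \<open>softmw_\<eta>\<close> and \<open>softmw_\<gamma>\<close>, \<open>q s\<close> and \<open>l s\<close> stand for the values of \<open>Q\<^sub>s\<close> and \<open>L\<^sub>s\<close>
  on one trajectory.
\<close>

definition softmw_\<beta> :: "nat \<Rightarrow> nat \<Rightarrow> real" where
  "softmw_\<beta> K t = real t powr (- 4) / real K"

definition softmw_\<eta> :: "real \<Rightarrow> (nat \<Rightarrow> real ^ 'k) \<Rightarrow> (nat \<Rightarrow> real) \<Rightarrow> nat \<Rightarrow> real" where
  "softmw_\<eta> \<delta> q l t =
    inverse (real t powr (- (1 / 4 - \<delta> / 2)) * l (t - 1) *
      sqrt (86 * (l (t - 1))\<^sup>2 * real CARD('k) ^ 6 * real t powr (3 / 2)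
            + (\<Sum>s\<in>{0..t - 1}. (norm (q s))\<^sup>2)))"

definition softmw_\<gamma> :: "real \<Rightarrow> real \<Rightarrow> (nat \<Rightarrow> real ^ 'k) \<Rightarrow> (nat \<Rightarrow> real) \<Rightarrow> nat \<Rightarrow> real" where
  "softmw_\<gamma> M \<delta> q l t =
    M * real t powr (\<delta> / 4) * softmw_\<eta> \<delta> q l t * norm1 (q (t - 1))"

definition clip :: "real \<Rightarrow> real \<Rightarrow> real" where
  "clip b s = (if s \<le> b then s else 0)"

locale softmw_plus = queueing_system P \<A> \<S> A S a Q
  for P :: "'w measure"
    and \<A> \<S> :: "nat \<Rightarrow> (real ^ 'k) measure"
    and A S :: "nat \<Rightarrow> 'w \<Rightarrow> real ^ 'k"
    and a :: "nat \<Rightarrow> 'w \<Rightarrow> 'k"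
    and Q :: "nat \<Rightarrow> 'w \<Rightarrow> real ^ 'k" +
  fixes M \<delta> :: real
    and x p e :: "nat \<Rightarrow> 'w \<Rightarrow> real ^ 'k"
    and L :: "nat \<Rightarrow> 'w \<Rightarrow> real"
  assumes L_0: "\<And>\<omega>. \<omega> \<in> space P \<Longrightarrow> L 0 \<omega> = M"
    and L_step: "\<And>t \<omega>. 1 \<le> t \<Longrightarrow> \<omega> \<in> space P \<Longrightarrow>
      L t \<omega> = max (L (t - 1) \<omega>) (infnorm (Q t \<omega> - Q (t - 1) \<omega>))"
    and e_simplex: "\<And>t \<omega>. 1 \<le> t \<Longrightarrow> \<omega> \<in> space P \<Longrightarrow> e t \<omega> \<in> prob_simplex"
    and e_eq: "\<And>t \<omega>. 1 \<le> t \<Longrightarrow> \<omega> \<in> space P \<Longrightarrow> Q (t - 1) \<omega> \<noteq> 0 \<Longrightarrow>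
      e t \<omega> = Q (t - 1) \<omega> /\<^sub>R norm1 (Q (t - 1) \<omega>)"
    and exp3sp: "exp3sp_run P (history_env P A S a Q) (\<chi> i. 1 / real CARD('k))
      (softmw_\<beta> CARD('k))
      (\<lambda>t \<omega>. softmw_\<eta> \<delta> (\<lambda>s. Q s \<omega>) (\<lambda>s. L s \<omega>) t)
      (\<lambda>t \<omega>. softmw_\<gamma> M \<delta> (\<lambda>s. Q s \<omega>) (\<lambda>s. L s \<omega>) t)
      e x p a
      (\<lambda>t \<omega>. Q (t - 1) \<omega> $ a t \<omega> * clip (M * real t powr (\<delta> / 4)) (S t \<omega> $ a t \<omega>))"

end

theory Submission
  imports Defs "HOL-Real_Asymp.Real_Asymp"
begin

text \<open>
  Let \<open>X = \<Sum>\<^sub>s\<^sub><\<^sub>n \<parallel>Q\<^sub>s\<parallel>\<^sub>1\<close>.  The Lyapunov drift of \<open>\<parallel>Q\<^sub>t\<parallel>\<^sup>2\<close> bounds the collected reward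
  \<open>\<Sum> Q\<^bsub>t-1,a\<^esub> S\<^bsub>t,a\<^esub>\<close> by \<open>\<Sum> \<langle>Q\<^sub>t\<^sub>-\<^sub>1, A\<^sub>t\<rangle>\<close> plus a second-moment term, and the EXP3.S+ regret
  bounds the reward of \<open>\<theta>\<close> by the collected reward.  Since the queues move by at most
  \<open>L\<close> per slot, \<open>\<Sum> \<parallel>Q\<^sub>s\<parallel>\<^sup>2\<close> is of order \<open>L\<^bsup>1/2\<^esup> X\<^bsup>3/2\<^esup>\<close>, so the regret is \<open>o(n\<^bsup>1/4\<^esup>) X\<^bsup>3/4\<^esup>\<close> up to
  powers of \<open>L\<close>, and Young's inequality absorbs it into \<open>\<rho> X + o(n)\<close> for every \<open>\<rho> > 0\<close>.  On the other
  hand, stabilizability on the windows yields a drift of at least \<open>\<epsilon> E X\<close> minus the cost of freezing the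
  mean queue lengths inside each window; the horizon \<open>n\<close> is taken at the end of the window that
  contains \<open>T + 1\<close>.  Taking \<open>\<rho> = \<epsilon> / 4\<close> leaves a bound that is eventually below the
  stated constant, because the crude estimate \<open>S\<^bsub>t,a\<^esub>\<^sup>2 \<le> \<Sum>\<^sub>i S\<^bsub>t,i\<^esub>\<^sup>2\<close> costs only \<open>K M\<^sup>2\<close> against the
  available \<open>(K + 1) M\<^sup>2\<close>.

  Expectations of products of queue lengths with services are handled through independence of the
  past from the future environment.  This needs \<open>p\<^sub>t\<close> to be a measurable function of the past,
  which holds because the mirror step is a Lipschitz function of its dual argument.
\<close>

section \<open>Sums and windows\<close>

text \<open>The exponent \<kappa> = 1/4 - \<delta>/2 sets the rates: 2 \<kappa> is the allowed
  growth exponent of the path length of \<theta>; weighting that path by 1/\<eta>, which carries the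
  factor t powr -\<kappa>, leaves n powr \<kappa>; and the fourth power created by Young's
  inequality is n powr (1 - 2 \<delta>), sublinear with room for moments of \<open>L\<close>. The
  running maximum \<open>L\<close> is random, unbounded and correlated with the queues. Young's
  inequality is therefore applied on each path, before expectations are taken: \<open>X\<close> then
  occurs linearly, and \<open>L\<close> only through powers up to 5, whose means cost at most a
  factor of order n powr (5/\<alpha>). Rewards are unbounded too. Mixing towards the queue vector
  together with clipping keeps \<eta> times reward over p at most 1, and the summand 86 L^2 K^6
  t^(3/2) in the learning rate keeps \<gamma> at most 1/2. Clipping has a price: its bias is
  multiplied by mean queue lengths that are only known to be of order t, and \<delta> \<alpha> > 7
  makes the product decay.\<close>

lemma square_le_sum_of_slope:
  fixes q :: "nat \<Rightarrow> real"
  assumes "q 0 = 0" and "\<And>s. 0 \<le> q s" and "0 \<le> l"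
    and "\<And>s. s < n \<Longrightarrow> \<bar>q (Suc s) - q s\<bar> \<le> l"
  shows "(q n)\<^sup>2 \<le> 2 * l * (\<Sum>s\<le>n. q s)"
proof -
  \<comment> \<open>A path of slope \<open>l\<close> that reaches height \<open>q m\<close> has a
    triangle of area \<open>(q m)\<^sup>2 / (2 * l)\<close> below it. The extra term
    \<open>l * q m\<close> is the end-point correction of the trapezoidal rule and makes the
    induction close.\<close>
  have "(q m)\<^sup>2 + l * q m \<le> 2 * l * (\<Sum>s\<le>m. q s)" if "m \<le> n" for m
    using that
  proof (induction m)
    case (Suc m)
    have "(q (Suc m))\<^sup>2 - (q m)\<^sup>2 = (q (Suc m) - q m) * (q (Suc m) + q m)"
      by (simp add: algebra_simps power2_eq_square)
    also have "\<dots> \<le> l * (q (Suc m) + q m)"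
      using assms(2)[of m] assms(2)[of "Suc m"] assms(4)[of m] Suc.prems
      by (intro mult_right_mono) auto
    finally show ?case using Suc by (simp add: algebra_simps)
  qed (use assms in simp)
  from this[of n] show ?thesis
    using mult_nonneg_nonneg[OF assms(3) assms(2)[of n]] by simp
qed

text \<open>The same area argument for squares: below a path of slope \<open>l\<close> the squares
  sum to about \<open>q n ^ 3 / (3 * l)\<close>, and \<open>3 / 2 * l * (q m)\<^sup>2\<close> is the
  end-point correction. This controls the exploration rate in \<open>gamma_range\<close>.\<close>

lemma cube_le_sum_of_slope:
  fixes q :: "nat \<Rightarrow> real"
  assumes "q 0 = 0" and "\<And>s. 0 \<le> q s" and "0 \<le> l"
    and "\<And>s. s < n \<Longrightarrow> \<bar>q (Suc s) - q s\<bar> \<le> l"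
  shows "q n ^ 3 \<le> 3 * l * (\<Sum>s\<le>n. (q s)\<^sup>2)"
proof -
  have "q m ^ 3 + 3 / 2 * l * (q m)\<^sup>2 \<le> 3 * l * (\<Sum>s\<le>m. (q s)\<^sup>2)" if "m \<le> n" for m
    using that
  proof (induction m)
    case (Suc m)
    let ?a = "q m" and ?b = "q (Suc m)"
    have ab: "0 \<le> ?a" "0 \<le> ?b" using assms(2) by auto
    have "?b ^ 3 - ?a ^ 3 = (?b - ?a) * (?b\<^sup>2 + ?b * ?a + ?a\<^sup>2)"
      by (simp add: algebra_simps power2_eq_square power3_eq_cube)
    also have "\<dots> \<le> l * (?b\<^sup>2 + ?b * ?a + ?a\<^sup>2)"
      using ab assms(4)[of m] Suc.prems by (intro mult_right_mono) auto
    also have "\<dots> \<le> l * (3 / 2 * (?b\<^sup>2 + ?a\<^sup>2))"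
      using sum_squares_bound[of ?b ?a] assms(3) by (intro mult_left_mono) auto
    finally show ?case using Suc by (simp add: algebra_simps)
  qed (use assms in simp)
  from this[of n] show ?thesis
    using mult_nonneg_nonneg[OF assms(3) zero_le_power2[of "q n"]] by simp
qed

text \<open>Each summand is at most the increment of twice the square root of the partial sum, the
  usual estimate for self-normalised step sizes. A vanishing partial sum contributes 0 because
  \<open>x / 0 = 0\<close>.\<close>

lemma sum_div_sqrt_partial_sums:
  fixes q :: "nat \<Rightarrow> real"
  assumes "\<And>s. 0 \<le> q s"
  shows "(\<Sum>t<n. q t / sqrt (\<Sum>s\<le>t. q s)) \<le> 2 * sqrt (\<Sum>t<n. q t)"
proof (induction n)
  case (Suc n)
  define u where "u = (\<Sum>t<n. q t)"
  have u: "0 \<le> u" unfolding u_def using assms by (intro sum_nonneg) auto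
  have split: "(\<Sum>s\<le>n. q s) = u + q n"
    unfolding u_def by (simp add: lessThan_Suc_atMost[symmetric])
  have "2 * sqrt u + q n / sqrt (u + q n) \<le> 2 * sqrt (u + q n)"
  proof (cases "u + q n = 0")
    case True
    then show ?thesis using u assms[of n] by simp
  next
    case False
    then have pos: "0 < sqrt (u + q n)" using u assms[of n] by simp
    have "2 * sqrt u * sqrt (u + q n) \<le> u + (u + q n)"
      using sum_squares_bound[of "sqrt u" "sqrt (u + q n)"] u assms[of n] by simp
    moreover have "sqrt (u + q n) * sqrt (u + q n) = u + q n"
      using u assms[of n] by simp
    ultimately have "(2 * sqrt u + q n / sqrt (u + q n)) * sqrt (u + q n)
        \<le> (2 * sqrt (u + q n)) * sqrt (u + q n)"
      using pos by (simp only: distrib_right mult.assoc) simp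
    then show ?thesis using pos by (simp only: mult_le_cancel_right_pos)
  qed
  then show ?case using Suc split by (simp add: u_def)
qed simp

text \<open>Summation by parts. The inductive claim keeps the whole prefix sum at the current weight
  and collects the cost of lowering the weight: with a = n powr \<kappa>, b = (n + 1) powr \<kappa>
  and a prefix sum of at most C a^2, the drop from 1/a to 1/b costs at most C (b - a), which
  telescopes.\<close>

lemma sum_weighted_increments:
  fixes d :: "nat \<Rightarrow> real"
  assumes "0 \<le> \<kappa>" and "0 \<le> C"
    and "\<And>t. 0 \<le> d t"
    and V: "\<And>n::nat. 1 \<le> n \<Longrightarrow> (\<Sum>t\<in>{1..<n}. d t) \<le> C * real n powr (2 * \<kappa>)"
    and "1 \<le> n"
  shows "(\<Sum>t\<in>{1..<n}. real (t + 1) powr (- \<kappa>) * d t) \<le> 2 * C * real n powr \<kappa>"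
proof -
  have "(\<Sum>t\<in>{1..<n}. real (t + 1) powr (- \<kappa>) * d t)
      \<le> real n powr (- \<kappa>) * (\<Sum>t\<in>{1..<n}. d t) + C * (real n powr \<kappa> - 1)"
    using \<open>1 \<le> n\<close>
  proof (induction n rule: dec_induct)
    case (step n)
    define a b v where "a = real n powr \<kappa>" and "b = real (Suc n) powr \<kappa>"
      and "v = (\<Sum>t\<in>{1..<n}. d t)"
    have a: "0 < a" and b: "0 < b" using step by (auto simp: a_def b_def)
    have ab: "a \<le> b" using assms(1) by (simp add: a_def b_def powr_mono2)
    have inv: "real n powr (- \<kappa>) = 1 / a" "real (Suc n) powr (- \<kappa>) = 1 / b"
      by (auto simp: a_def b_def powr_minus_divide)
    have "v \<le> C * a\<^sup>2"
      using V[of n] step by (simp add: v_def a_def powr_powr flip: powr_numeral)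
         (simp add: mult.commute)
    then have "(1 / a - 1 / b) * v \<le> (1 / a - 1 / b) * (C * a\<^sup>2)"
      using a b ab by (intro mult_left_mono) (auto simp: field_simps)
    also have "\<dots> = C * (b - a) * (a / b)"
      using a b by (simp add: field_simps power2_eq_square)
    also have "\<dots> \<le> C * (b - a) * 1"
      using a b ab assms(2) by (intro mult_left_mono) auto
    finally have "(1 / a - 1 / b) * v \<le> C * (b - a)" by simp
    moreover have "(\<Sum>t\<in>{1..<n}. real (t + 1) powr (- \<kappa>) * d t) \<le> v / a + C * (a - 1)"
      using step by (simp add: inv v_def a_def powr_minus_divide)
    moreover have "(\<Sum>t\<in>{1..<Suc n}. real (t + 1) powr (- \<kappa>) * d t)
        = (\<Sum>t\<in>{1..<n}. real (t + 1) powr (- \<kappa>) * d t) + d n / b"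
      using step inv(2) by (simp add: add.commute)
    moreover have "(\<Sum>t\<in>{1..<Suc n}. d t) = v + d n" using step by (simp add: v_def)
    ultimately show ?case unfolding inv b_def[symmetric] using step
      by (simp add: algebra_simps diff_divide_distrib add_divide_distrib)
  qed simp
  also have "\<dots> \<le> real n powr (- \<kappa>) * (C * real n powr (2 * \<kappa>)) + C * (real n powr \<kappa> - 1)"
    using V[OF \<open>1 \<le> n\<close>] by (intro add_right_mono mult_left_mono) auto
  also have "real n powr (- \<kappa>) * (C * real n powr (2 * \<kappa>)) = C * real n powr \<kappa>"
    using \<open>1 \<le> n\<close> by (simp add: mult.left_commute powr_add[symmetric])
  finally show ?thesis using assms(2) by (simp add: algebra_simps)
qed

lemma sum_powr_neg_half_le:
  "(\<Sum>t\<in>{1..n::nat}. real t powr (- (1 / 2))) \<le> 2 * sqrt (real n)"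
proof (induction n)
  case (Suc n)
  have s: "sqrt (real (Suc n)) * sqrt (real (Suc n)) = real (Suc n)"
    "sqrt (real n) * sqrt (real n) = real n" by simp_all
  have "2 * sqrt (real n) * sqrt (real (Suc n)) + 1 \<le> 2 * sqrt (real (Suc n)) * sqrt (real (Suc n))"
    using sum_squares_bound[of "sqrt (real n)" "sqrt (real (Suc n))"]
    unfolding power2_eq_square s mult.assoc by simp
  then have "2 * sqrt (real n) + 1 / sqrt (real (Suc n)) \<le> 2 * sqrt (real (Suc n))"
    using s by (simp add: field_simps)
  moreover have "real (Suc n) powr (- (1 / 2)) = 1 / sqrt (real (Suc n))"
    by (simp add: powr_minus_divide powr_half_sqrt)
  ultimately show ?case using Suc by simp
qed simp

lemma powr_neg4: "1 \<le> t \<Longrightarrow> 0 \<le> real t powr (- 4)" "1 \<le> t \<Longrightarrow> real t powr (- 4) \<le> 1"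
  using powr_mono2'[of "-4" 1 "real t"] by auto

text \<open>The difference of the two sides is \<open>(q - 8 c s)\<^sup>2 (q + 4 c s) / (3 c)\<close>.\<close>

lemma quadratic_le_cubic:
  fixes c q s :: real
  assumes "0 < c" "0 \<le> q" "0 \<le> s"
  shows "4 * s * q\<^sup>2 \<le> q ^ 3 / (3 * c) + 256 / 3 * c\<^sup>2 * s ^ 3"
proof -
  have "0 \<le> (q - 8 * c * s)\<^sup>2 * (q + 4 * c * s) / (3 * c)" using assms by simp
  also have "\<dots> = q ^ 3 / (3 * c) + 256 / 3 * c\<^sup>2 * s ^ 3 - 4 * s * q\<^sup>2"
    using assms(1) by (simp add: field_simps power2_eq_square power3_eq_cube)
  finally show ?thesis by simp
qed

text \<open>Summation by parts for non-monotone weights \<open>h\<close> whose upward increments are controlled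
  by those of \<open>Z\<close>.\<close>

lemma weighted_telescope:
  fixes h Z D E d :: "nat \<Rightarrow> real"
  assumes "1 \<le> n"
    and h: "\<And>t. 0 \<le> h t"
    and hZ: "\<And>t. 1 \<le> t \<Longrightarrow> h (Suc t) - h t \<le> Z (Suc t) - Z t" "h 1 \<le> Z 1"
    and Z: "\<And>t. 1 \<le> t \<Longrightarrow> Z t \<le> Z (Suc t)"
    and E: "\<And>t. 1 \<le> t \<Longrightarrow> t \<le> n \<Longrightarrow> 0 \<le> E t \<and> E t \<le> B" and "D 1 \<le> B"
    and step: "\<And>t. 1 \<le> t \<Longrightarrow> t < n \<Longrightarrow> D (Suc t) \<le> E t + d t"
  shows "(\<Sum>t\<in>{1..n}. h t * (D t - E t)) \<le> B * Z n + (\<Sum>t\<in>{1..<n}. h (Suc t) * d t)"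
proof -
  have "(\<Sum>t\<in>{1..m}. h t * (D t - E t)) + h m * E m \<le> B * Z m + (\<Sum>t\<in>{1..<m}. h (Suc t) * d t)"
    if "1 \<le> m" "m \<le> n" for m
    using that
  proof (induction m rule: dec_induct)
    case base
    have "0 \<le> B" using E[of 1] \<open>1 \<le> n\<close> by fastforce
    have "h 1 * D 1 \<le> h 1 * B" using h \<open>D 1 \<le> B\<close> by (intro mult_left_mono) auto
    also have "\<dots> \<le> Z 1 * B" using hZ(2) \<open>0 \<le> B\<close> by (intro mult_right_mono) auto
    finally show ?case by (simp add: algebra_simps)
  next
    case (step m)
    have "h (Suc m) * D (Suc m) \<le> h (Suc m) * (E m + d m)"
      using h assms(8)[of m] step by (intro mult_left_mono) auto
    moreover have "(h (Suc m) - h m) * E m \<le> (Z (Suc m) - Z m) * B"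
    proof -
      have "(h (Suc m) - h m) * E m \<le> (Z (Suc m) - Z m) * E m"
        using hZ(1)[of m] E[of m] step by (intro mult_right_mono) auto
      also have "\<dots> \<le> (Z (Suc m) - Z m) * B"
        using Z[of m] E[of m] step by (intro mult_left_mono) auto
      finally show ?thesis .
    qed
    ultimately show ?case using step by (simp add: algebra_simps)
  qed
  moreover have "0 \<le> h n * E n" using h E \<open>1 \<le> n\<close> by (intro mult_nonneg_nonneg) auto
  ultimately show ?thesis using \<open>1 \<le> n\<close> by (smt (verit) order_refl)
qed

text \<open>The sum of \<open>m (t - 1) * (\<epsilon> - f t)\<close> is split at the value
  \<open>m (l - 1)\<close>. The constant part is nonpositive because \<open>f\<close> averages to at
  least \<epsilon>; the deviation at \<open>t\<close> is at most \<open>(t - l) * M\<close>, and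
  these linear bounds sum to the squared window length.\<close>

lemma window_drift:
  fixes m f :: "nat \<Rightarrow> real"
  assumes "1 \<le> l" "l \<le> u" "0 \<le> M" "0 \<le> \<epsilon>" "0 \<le> m (l - 1)"
    and m: "\<And>t. 1 \<le> t \<Longrightarrow> \<bar>m t - m (t - 1)\<bar> \<le> M"
    and f: "\<And>t. 1 \<le> t \<Longrightarrow> \<bar>f t\<bar> \<le> M"
    and avg: "\<epsilon> * real (card {l..u}) \<le> (\<Sum>t\<in>{l..u}. f t)"
  shows "\<epsilon> * (\<Sum>t\<in>{l..u}. m (t - 1))
    \<le> (\<Sum>t\<in>{l..u}. m (t - 1) * f t) + (M\<^sup>2 + \<epsilon> * M) * (real (card {l..u}) - 1)\<^sup>2"
proof -
  have lip: "\<bar>m (t - 1) - m (l - 1)\<bar> \<le> real (t - l) * M" if "l \<le> t" for t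
    using that
  proof (induction t rule: dec_induct)
    case (step t)
    have "\<bar>m t - m (t - 1)\<bar> \<le> M" using m[of t] step \<open>1 \<le> l\<close> by simp
    moreover have "real (Suc t - l) = real (t - l) + 1" using step by (simp add: Suc_diff_le)
    ultimately show ?case using step by (simp add: algebra_simps)
  qed simp
  have bnd: "(m (t - 1) - m (l - 1)) * (\<epsilon> - f t) \<le> real (t - l) * (M * (M + \<epsilon>))"
    if "t \<in> {l..u}" for t
  proof -
    have "(m (t - 1) - m (l - 1)) * (\<epsilon> - f t) \<le> \<bar>m (t - 1) - m (l - 1)\<bar> * \<bar>\<epsilon> - f t\<bar>"
      by (metis abs_ge_self abs_mult)
    also have "\<dots> \<le> (real (t - l) * M) * (M + \<epsilon>)"
    proof (intro mult_mono)
      have "1 \<le> t" using that assms(1) by simp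
      then show "\<bar>\<epsilon> - f t\<bar> \<le> M + \<epsilon>" using f[of t] assms(4) by linarith
    qed (use lip[of t] that assms in auto)
    finally show ?thesis by (simp add: mult.assoc)
  qed
  have "(\<Sum>t\<in>{l..u}. real (t - l)) = real (u - l) * (real (u - l) + 1) / 2"
  proof -
    have "(\<Sum>t\<in>{l..u}. real (t - l)) = (\<Sum>k\<le>u - l. real k)"
      by (rule sum.reindex_bij_witness[of _ "\<lambda>k. k + l" "\<lambda>t. t - l"]) (use assms in auto)
    also have "\<dots> = real (u - l) * (real (u - l) + 1) / 2"
    proof -
      have "(\<Sum>k\<le>n. real k) = real n * (real n + 1) / 2" for n :: nat
        by (induction n) (simp_all add: field_simps)
      then show ?thesis .
    qed
    finally show ?thesis .
  qed
  \<comment> \<open>For a natural number k, k (k + 1) / 2 is at most k^2; for real k between 0 and 1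
    this would fail, hence the case split.\<close>
  also have "\<dots> \<le> (real (u - l))\<^sup>2"
  proof (cases "u = l")
    case False
    then have "1 \<le> real (u - l)" using assms by simp
    then have "real (u - l) * (real (u - l) + 1) \<le> real (u - l) * (real (u - l) + real (u - l))"
      by (intro mult_left_mono) auto
    then show ?thesis by (simp add: power2_eq_square)
  qed simp
  finally have gauss: "(\<Sum>t\<in>{l..u}. real (t - l)) \<le> (real (u - l))\<^sup>2" .
  have card: "real (card {l..u}) - 1 = real (u - l)" using assms by simp
  have "(\<Sum>t\<in>{l..u}. m (t - 1) * (\<epsilon> - f t))
      = m (l - 1) * (\<epsilon> * real (card {l..u}) - (\<Sum>t\<in>{l..u}. f t))
        + (\<Sum>t\<in>{l..u}. (m (t - 1) - m (l - 1)) * (\<epsilon> - f t))"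
    by (simp add: left_diff_distrib right_diff_distrib sum_subtractf sum_distrib_left
        sum_distrib_right mult_ac)
  also have "\<dots> \<le> 0 + (\<Sum>t\<in>{l..u}. real (t - l) * (M * (M + \<epsilon>)))"
    using bnd avg assms(5) by (intro add_mono sum_mono mult_nonneg_nonpos) auto
  also have "\<dots> \<le> (real (u - l))\<^sup>2 * (M * (M + \<epsilon>))"
    using gauss assms by (simp add: sum_distrib_right[symmetric] mult_right_mono)
  finally show ?thesis
    unfolding card
    by (simp add: right_diff_distrib sum_subtractf sum_distrib_left power2_eq_square algebra_simps)
qed

text \<open>Stopping at the end \<open>hi k\<close> of the window that contains \<open>T\<close>
  makes \<open>{1..n}\<close> an exact union of windows. All of them start at \<open>T\<close> or
  earlier, so their total cost is bounded by \<open>C * (T + 1)\<close> and not merely in terms of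
  \<open>n\<close>. The same budget bounds the last window alone, hence the overshoot
  \<open>n - T\<close>, by a square root.\<close>

lemma windows_drift:
  fixes m f :: "'j \<Rightarrow> nat \<Rightarrow> real"
  assumes W: "interval_partition W"
    and CW: "\<And>T::nat. 1 \<le> T \<Longrightarrow>
      (\<Sum>i\<in>{i. Min (W i) < T}. (real (card (W i)) - 1)\<^sup>2) \<le> C * real T"
    and "0 \<le> M" "0 \<le> \<epsilon>" and m0: "\<And>j t. 0 \<le> m j t"
    and m: "\<And>j t. 1 \<le> t \<Longrightarrow> \<bar>m j t - m j (t - 1)\<bar> \<le> M"
    and f: "\<And>j t. 1 \<le> t \<Longrightarrow> \<bar>f j t\<bar> \<le> M"
    and avg: "\<And>i j. \<epsilon> \<le> 1 / real (card (W i)) * (\<Sum>t\<in>W i. f j t)"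
    and "1 \<le> T"
  obtains n where "T \<le> n" "real n \<le> real T + sqrt (C * real (T + 1))"
    "\<And>j. \<epsilon> * (\<Sum>t\<in>{1..n}. m j (t - 1))
      \<le> (\<Sum>t\<in>{1..n}. m j (t - 1) * f j t) + (M\<^sup>2 + \<epsilon> * M) * (C * real (T + 1))"
proof -
  have UW: "(\<Union>i. W i) = {1..}" and disj: "\<And>i k. i \<noteq> k \<Longrightarrow> W i \<inter> W k = {}"
    and int: "\<And>i. \<exists>l u. l \<le> u \<and> W i = {l..u}"
    using W by (auto simp: interval_partition_def disjoint_family_on_def)
  obtain lo hi where lohi: "\<And>i. lo i \<le> hi i" "\<And>i. W i = {lo i..hi i}"
    using int by metis
  have lo1: "1 \<le> lo i" for i
    using UW lohi[of i] by (metis UN_I UNIV_I atLeastAtMost_iff atLeast_iff order_refl)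
  have Min: "Min (W i) = lo i" for i using lohi by (auto intro: Min_eqI)
  obtain k where k: "T \<in> W k" using UW \<open>1 \<le> T\<close> by auto
  define n where "n = hi k"
  define I where "I = {i. lo i \<le> n}"
  have kT: "lo k \<le> T" "T \<le> n" using k lohi(2)[of k] by (auto simp: n_def)
  have I_eq: "I = {i. Min (W i) < T + 1}"
  proof -
    have "lo i \<le> T" if "lo i \<le> n" for i
    proof (rule ccontr)
      assume "\<not> lo i \<le> T"
      then have "lo i \<in> W k" "lo i \<in> W i" using that lohi kT by (auto simp: n_def)
      then have "i = k" using disj by blast
      then show False using \<open>\<not> lo i \<le> T\<close> kT by simp
    qed
    then show ?thesis using kT by (force simp: I_def Min)
  qed
  have "inj lo"
  proof (rule injI)
    fix i i' assume "lo i = lo i'"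
    then have "lo i \<in> W i \<inter> W i'" using lohi(1)[of i] lohi(1)[of i'] by (simp add: lohi(2))
    then show "i = i'" using disj by blast
  qed
  then have finI: "finite I"
    by (intro finite_imageD[of lo I] finite_subset[of "lo ` I" "{..n}"])
      (auto simp: I_def inj_on_def)
  have "(\<Union>i\<in>I. W i) = {1..n}"
  proof (intro equalityI subsetI)
    fix t assume "t \<in> (\<Union>i\<in>I. W i)"
    then obtain i where i: "lo i \<le> n" "t \<in> W i" by (auto simp: I_def)
    have "t \<le> n"
    proof (rule ccontr)
      assume "\<not> t \<le> n"
      then have "n \<in> W i" "n \<in> W k" using i lohi by (auto simp: n_def)
      then have "i = k" using disj by blast
      then show False using i lohi \<open>\<not> t \<le> n\<close> by (simp add: n_def)
    qed
    then show "t \<in> {1..n}" using i lo1[of i] lohi(2)[of i] by auto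
  next
    fix t assume "t \<in> {1..n}"
    then obtain i where "t \<in> W i" using UW by auto
    then have "lo i \<le> n" using lohi(2)[of i] \<open>t \<in> {1..n}\<close> by simp
    then show "t \<in> (\<Union>i\<in>I. W i)" using \<open>t \<in> W i\<close> by (auto simp: I_def)
  qed
  then have split: "(\<Sum>t\<in>{1..n}. h t) = (\<Sum>i\<in>I. \<Sum>t\<in>W i. h t)" for h :: "nat \<Rightarrow> real"
    using sum.UNION_disjoint[of I W h] finI disj lohi(2) by (metis finite_atLeastAtMost)
  have sumC: "(\<Sum>i\<in>I. (real (card (W i)) - 1)\<^sup>2) \<le> C * real (T + 1)"
    unfolding I_eq using CW[of "T + 1"] by simp
  have "(real (card (W k)) - 1)\<^sup>2 \<le> (\<Sum>i\<in>I. (real (card (W i)) - 1)\<^sup>2)"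
    using finI kT by (intro member_le_sum) (auto simp: I_def)
  then have "(real n - real (lo k))\<^sup>2 \<le> C * real (T + 1)"
    using sumC lohi[of k] by (simp add: n_def of_nat_diff)
  then have "real n - real (lo k) \<le> sqrt (C * real (T + 1))"
    by (simp add: real_le_rsqrt)
  then have "real n \<le> real T + sqrt (C * real (T + 1))" using kT by simp
  moreover have "\<epsilon> * (\<Sum>t\<in>{1..n}. m j (t - 1))
      \<le> (\<Sum>t\<in>{1..n}. m j (t - 1) * f j t) + (M\<^sup>2 + \<epsilon> * M) * (C * real (T + 1))" for j
  proof -
    have win: "\<epsilon> * (\<Sum>t\<in>W i. m j (t - 1))
      \<le> (\<Sum>t\<in>W i. m j (t - 1) * f j t) + (M\<^sup>2 + \<epsilon> * M) * (real (card (W i)) - 1)\<^sup>2" for i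
    proof -
      have "\<epsilon> * real (card (W i)) \<le> (\<Sum>t\<in>W i. f j t)"
        using avg[of i j] lohi[of i] by (simp add: field_simps)
      then show ?thesis
        unfolding lohi(2)[of i]
        by (intro window_drift) (use lo1 lohi assms in auto)
    qed
    have "\<epsilon> * (\<Sum>t\<in>{1..n}. m j (t - 1)) = (\<Sum>i\<in>I. \<epsilon> * (\<Sum>t\<in>W i. m j (t - 1)))"
      by (simp only: split sum_distrib_left)
    also have "\<dots> \<le> (\<Sum>i\<in>I. (\<Sum>t\<in>W i. m j (t - 1) * f j t)
        + (M\<^sup>2 + \<epsilon> * M) * (real (card (W i)) - 1)\<^sup>2)"
      by (intro sum_mono win)
    also have "\<dots> = (\<Sum>t\<in>{1..n}. m j (t - 1) * f j t)
        + (M\<^sup>2 + \<epsilon> * M) * (\<Sum>i\<in>I. (real (card (W i)) - 1)\<^sup>2)"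
      by (simp only: split sum.distrib sum_distrib_left)
    also have "\<dots> \<le> (\<Sum>t\<in>{1..n}. m j (t - 1) * f j t)
        + (M\<^sup>2 + \<epsilon> * M) * (C * real (T + 1))"
      using sumC assms by (intro add_left_mono mult_left_mono) auto
    finally show ?thesis .
  qed
  ultimately show ?thesis using that kT by blast
qed

section \<open>Mirror descent with the entropy on the truncated simplex\<close>

text \<open>The unnormalised Kullback-Leibler divergence. The terms \<open>- y $ i + x $ i\<close>
  make every single summand nonnegative, which is what allows one coordinate to be isolated in
  \<open>mirror_step_regret\<close>.\<close>

definition kl :: "real ^ 'k \<Rightarrow> real ^ 'k \<Rightarrow> real" where
  "kl y x = (\<Sum>i\<in>UNIV. y $ i * ln (y $ i) - y $ i * ln (x $ i) - y $ i + x $ i)"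

lemma GDERIV_neg_entropy:
  fixes x :: "real ^ 'k"
  assumes "\<And>i. 0 < x $ i"
  shows "GDERIV neg_entropy x :> (\<chi> i. ln (x $ i))"
proof -
  have "((\<lambda>v. v $ i * ln (v $ i) - v $ i) has_derivative (\<lambda>h. h $ i * ln (x $ i))) (at x)" for i
  proof -
    have comp: "((\<lambda>v. v $ i) has_derivative (\<lambda>h. h $ i)) (at x)"
      by (rule bounded_linear.has_derivative[OF bounded_linear_vec_nth has_derivative_ident])
    have nz: "x $ i \<noteq> 0" using assms[of i] by simp
    show ?thesis
      by (rule has_derivative_eq_rhs,
          rule has_derivative_diff[OF has_derivative_mult[OF comp has_derivative_ln[OF assms comp]] comp])
        (use nz in \<open>simp add: fun_eq_iff\<close>)
  qed
  then have "((\<lambda>v. \<Sum>i\<in>UNIV. v $ i * ln (v $ i) - v $ i)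
      has_derivative (\<lambda>h. \<Sum>i\<in>UNIV. h $ i * ln (x $ i))) (at x)"
    by (intro has_derivative_sum)
  then show ?thesis
    by (simp add: gderiv_def neg_entropy_def[abs_def] inner_vec_def)
qed

lemma bregman_neg_entropy:
  fixes x y :: "real ^ 'k"
  assumes "\<And>i. 0 < x $ i"
  shows "bregman neg_entropy y x = kl y x"
proof -
  have "gradient neg_entropy x = (\<chi> i. ln (x $ i))"
    unfolding gradient_def
  proof (rule the_equality)
    show "GDERIV neg_entropy x :> (\<chi> i. ln (x $ i))"
      by (rule GDERIV_neg_entropy[OF assms])
    fix D assume "GDERIV neg_entropy x :> D"
    then have "(\<lambda>h. h \<bullet> D) = (\<lambda>h. h \<bullet> (\<chi> i. ln (x $ i)))"
      using GDERIV_neg_entropy[OF assms] unfolding gderiv_def by (rule has_derivative_unique)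
    then show "D = (\<chi> i. ln (x $ i))" by (metis vector_eq_rdot inner_commute)
  qed
  then show ?thesis
    by (simp add: bregman_def neg_entropy_def kl_def inner_vec_def sum_subtractf[symmetric]
        sum.distrib[symmetric] algebra_simps)
qed

text \<open>With \<open>u\<close> = \<open>ln x + \<eta> g\<close> this is, up to an additive
  constant, the objective of the EXP3.S+ update: the previous iterate and the feedback enter only
  through this dual vector.\<close>

definition entropic :: "real ^ 'k \<Rightarrow> real ^ 'k \<Rightarrow> real" where
  "entropic u z = neg_entropy z - u \<bullet> z"

text \<open>The exact first-order expansion at \<open>z\<close>: the gradient there is
  \<open>ln z - u\<close>, and the divergence is the remainder of the tangent plane.\<close>

lemma entropic_diff:
  "entropic u y - entropic u z = kl y z + (\<Sum>i\<in>UNIV. (ln (z $ i) - u $ i) * (y $ i - z $ i))"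
  by (simp add: entropic_def neg_entropy_def kl_def inner_vec_def sum_subtractf[symmetric]
      sum.distrib[symmetric] algebra_simps)

lemma ln_diff_ge:
  fixes y z :: real
  assumes "0 \<le> y" "0 < z"
  shows "0 \<le> y * ln y - y * ln z - y + z"
proof (cases "y = 0")
  case False
  then have "ln (z / y) \<le> z / y - 1" using assms by (intro ln_le_minus_one) auto
  then have "y * ln (z / y) \<le> y * (z / y - 1)" using assms by (intro mult_left_mono)
  then show ?thesis using assms False by (simp add: ln_div algebra_simps)
qed (use assms in simp)

lemma kl_nonneg:
  assumes "\<And>i. 0 \<le> y $ i" "\<And>i. 0 < z $ i"
  shows "0 \<le> kl y z"
  unfolding kl_def using assms by (intro sum_nonneg ln_diff_ge) auto

lemma trunc_simplexD:
  assumes "z \<in> trunc_simplex b"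
  shows "b \<le> z $ i" "0 \<le> z $ i" "(\<Sum>i\<in>UNIV. z $ i) = 1" "z $ i \<le> 1"
proof -
  show z: "b \<le> z $ i" "0 \<le> z $ i" "(\<Sum>i\<in>UNIV. z $ i) = 1"
    using assms by (auto simp: trunc_simplex_def prob_simplex_def)
  have "z $ i \<le> (\<Sum>i\<in>UNIV. z $ i)"
    using assms by (intro member_le_sum) (auto simp: trunc_simplex_def prob_simplex_def)
  then show "z $ i \<le> 1" using z by simp
qed

lemma trunc_simplex_antimono: "b \<le> b' \<Longrightarrow> z \<in> trunc_simplex b' \<Longrightarrow> z \<in> trunc_simplex b"
  by (auto simp: trunc_simplex_def intro: order_trans)

lemma convex_trunc_simplex: "convex (trunc_simplex b)"
proof (rule convexI)
  fix x y :: "real ^ 'k" and u v :: real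
  assume *: "x \<in> trunc_simplex b" "y \<in> trunc_simplex b" "0 \<le> u" "0 \<le> v" "u + v = 1"
  have "b \<le> u * x $ i + v * y $ i" for i
  proof -
    have "u * b + v * b \<le> u * x $ i + v * y $ i"
      using * trunc_simplexD(1)[of x b i] trunc_simplexD(1)[of y b i]
      by (intro add_mono mult_left_mono) auto
    then show ?thesis using * by (simp add: distrib_right[symmetric])
  qed
  moreover have "(\<Sum>i\<in>UNIV. u * x $ i + v * y $ i) = 1"
    using * trunc_simplexD(3)[of x b] trunc_simplexD(3)[of y b]
    by (simp add: sum.distrib sum_distrib_left[symmetric])
  ultimately show "u *\<^sub>R x + v *\<^sub>R y \<in> trunc_simplex b"
    using * trunc_simplexD(2)[of x b] trunc_simplexD(2)[of y b]
    by (auto simp: trunc_simplex_def prob_simplex_def)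
qed

lemma compact_trunc_simplex: "compact (trunc_simplex b :: (real ^ 'k) set)"
proof -
  have "trunc_simplex b = cbox (\<chi> i. max 0 b) (\<chi> i. 1) \<inter> {z :: real ^ 'k. (\<Sum>i\<in>UNIV. z $ i) = 1}"
    (is "_ = ?R")
  proof (intro equalityI subsetI)
    fix z :: "real ^ 'k" assume "z \<in> trunc_simplex b"
    then show "z \<in> ?R" using trunc_simplexD[of z b] by (simp add: mem_box_cart)
  qed (simp add: mem_box_cart trunc_simplex_def prob_simplex_def)
  moreover have "closed {z :: real ^ 'k. (\<Sum>i\<in>UNIV. z $ i) = 1}"
    by (intro closed_Collect_eq continuous_intros)
  ultimately show ?thesis by (metis compact_Int_closed compact_cbox)
qed

text \<open>By \<open>entropic_diff\<close> the claim is that the linear term \<open>c\<close> is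
  nonnegative. It is the derivative of the objective along the segment from \<open>z\<close> to
  \<open>y\<close>, and a negative one would give a better point of the convex domain. Positivity of
  \<open>b\<close> keeps \<open>z\<close> away from the boundary, where the logarithm is not
  differentiable.\<close>

lemma entropic_argmin_gap:
  assumes "0 < b" and z: "is_arg_min (entropic u) (\<lambda>z. z \<in> trunc_simplex b) z"
    and y: "y \<in> trunc_simplex b"
  shows "kl y z \<le> entropic u y - entropic u z"
proof -
  have zS: "z \<in> trunc_simplex b" and min: "\<And>w. w \<in> trunc_simplex b \<Longrightarrow> entropic u z \<le> entropic u w"
    using z by (auto simp: is_arg_min_linorder)
  define \<phi> where "\<phi> s = entropic u (z + s *\<^sub>R (y - z))" for s
  define c where "c = (\<Sum>i\<in>UNIV. (ln (z $ i) - u $ i) * (y $ i - z $ i))"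
  have pos: "0 < z $ i" for i using trunc_simplexD(1)[OF zS, of i] \<open>0 < b\<close> by simp
  have phi: "\<phi> = (\<lambda>s. \<Sum>i\<in>UNIV. (z $ i + s * (y $ i - z $ i)) * ln (z $ i + s * (y $ i - z $ i))
     - (z $ i + s * (y $ i - z $ i)) - u $ i * (z $ i + s * (y $ i - z $ i)))"
    by (simp add: fun_eq_iff \<phi>_def entropic_def neg_entropy_def inner_vec_def sum_subtractf[symmetric])
  have "((\<lambda>s. (z $ i + s * (y $ i - z $ i)) * ln (z $ i + s * (y $ i - z $ i))
     - (z $ i + s * (y $ i - z $ i)) - u $ i * (z $ i + s * (y $ i - z $ i)))
     has_real_derivative (ln (z $ i) - u $ i) * (y $ i - z $ i)) (at 0)" for i
    using pos[of i] by (auto intro!: derivative_eq_intros simp: field_simps)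
  then have "DERIV \<phi> 0 :> c"
    unfolding phi c_def by (intro DERIV_sum)
  have "0 \<le> c"
  proof (rule ccontr)
    assume "\<not> 0 \<le> c"
    then obtain d where d: "0 < d" "\<And>h. 0 < h \<Longrightarrow> h < d \<Longrightarrow> \<phi> (0 + h) < \<phi> 0"
      using DERIV_neg_dec_right[OF \<open>DERIV \<phi> 0 :> c\<close>] by auto
    define h where "h = min (d / 2) 1"
    have h: "0 < h" "h < d" "h \<le> 1" using d(1) by (auto simp: h_def)
    have "z + h *\<^sub>R (y - z) \<in> trunc_simplex b"
      using convexD[OF convex_trunc_simplex zS y, of "1 - h" h] h
      by (simp add: algebra_simps)
    from min[OF this] d(2)[OF h(1,2)] show False by (simp add: \<phi>_def)
  qed
  then show ?thesis by (simp add: entropic_diff c_def)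
qed

text \<open>The iterates of the algorithm are specified only as minimizers. Uniqueness identifies
  them with this function of the dual vector, and its continuity gives their measurability.\<close>

definition entropic_argmin :: "real \<Rightarrow> real ^ 'k \<Rightarrow> real ^ 'k" where
  "entropic_argmin b u = (SOME z. is_arg_min (entropic u) (\<lambda>z. z \<in> trunc_simplex b) z)"

text \<open>The derivative of \<open>ln\<close> is at least 1 on (0, 1]; this is the strong
  convexity of the negative entropy there.\<close>

lemma square_diff_le_ln:
  fixes y z :: real
  assumes "0 < y" "y \<le> 1" "0 < z" "z \<le> 1"
  shows "(y - z)\<^sup>2 \<le> (ln y - ln z) * (y - z)"
  using assms
proof (induction y z rule: linorder_wlog)
  case (le a b)
  have "ln (a / b) \<le> a / b - 1" using le by (intro ln_le_minus_one) auto
  then have "b - a \<le> b * (ln b - ln a)" using le by (simp add: ln_div field_simps)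
  also have "\<dots> \<le> 1 * (ln b - ln a)" using le by (intro mult_right_mono) auto
  finally have "(b - a) * (b - a) \<le> (ln b - ln a) * (b - a)" using le by (intro mult_right_mono) auto
  then show ?case by (simp add: power2_eq_square algebra_simps)
next
  case (sym a b)
  then show ?case by (simp add: power2_commute algebra_simps)
qed

text \<open>Adding the optimality gaps of both minimizers makes the entropy terms cancel.\<close>

lemma entropic_argmin_lipschitz:
  fixes u u' z z' :: "real ^ 'k"
  assumes "0 < b" and z: "is_arg_min (entropic u) (\<lambda>z. z \<in> trunc_simplex b) z"
    and z': "is_arg_min (entropic u') (\<lambda>z. z \<in> trunc_simplex b) z'"
  shows "norm (z - z') \<le> norm (u - u')"
proof -
  have S: "z \<in> trunc_simplex b" "z' \<in> trunc_simplex b"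
    using z z' by (auto simp: is_arg_min_def)
  have pos: "0 < z $ i" "0 < z' $ i" "z $ i \<le> 1" "z' $ i \<le> 1" for i
    using trunc_simplexD(1,2,4)[OF S(1), of i] trunc_simplexD(1,2,4)[OF S(2), of i] \<open>0 < b\<close> by auto
  have "(norm (z - z'))\<^sup>2 = (\<Sum>i\<in>UNIV. (z $ i - z' $ i)\<^sup>2)"
    by (simp add: norm_eq_sqrt_inner inner_vec_def sum_nonneg power2_eq_square)
  also have "\<dots> \<le> (\<Sum>i\<in>UNIV. (ln (z $ i) - ln (z' $ i)) * (z $ i - z' $ i))"
    using pos by (intro sum_mono square_diff_le_ln) auto
  also have "\<dots> = kl z z' + kl z' z"
    by (simp add: kl_def sum.distrib[symmetric] algebra_simps)
  also have "\<dots> \<le> (entropic u' z - entropic u' z') + (entropic u z' - entropic u z)"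
    using entropic_argmin_gap[OF \<open>0 < b\<close> z S(2)] entropic_argmin_gap[OF \<open>0 < b\<close> z' S(1)] by simp
  also have "\<dots> = (u - u') \<bullet> (z - z')"
    by (simp add: entropic_def algebra_simps)
  also have "\<dots> \<le> norm (u - u') * norm (z - z')" by (rule norm_cauchy_schwarz)
  finally have "norm (z - z') * norm (z - z') \<le> norm (u - u') * norm (z - z')"
    by (simp add: power2_eq_square)
  then show ?thesis by (cases "z = z'") (auto simp: mult_le_cancel_right)
qed

lemma is_arg_min_entropic_argmin:
  fixes u :: "real ^ 'k"
  assumes "0 < b" "b \<le> 1 / real CARD('k)"
  shows "is_arg_min (entropic u) (\<lambda>z. z \<in> trunc_simplex b) (entropic_argmin b u)"
proof -
  have "(\<chi> i. 1 / real CARD('k)) \<in> (trunc_simplex b :: (real ^ 'k) set)"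
    using assms by (simp add: trunc_simplex_def prob_simplex_def)
  then have ne: "trunc_simplex b \<noteq> ({} :: (real ^ 'k) set)" by blast
  have "z $ i \<noteq> 0" if "z \<in> trunc_simplex b" for i and z :: "real ^ 'k"
    using trunc_simplexD(1)[OF that, of i] assms by simp
  then have "continuous_on (trunc_simplex b) (entropic u)"
    unfolding entropic_def[abs_def] neg_entropy_def
    by (intro continuous_intros) auto
  from continuous_attains_inf[OF compact_trunc_simplex ne this]
  have "\<exists>z. is_arg_min (entropic u) (\<lambda>z. z \<in> trunc_simplex b) z"
    by (auto simp: is_arg_min_linorder)
  then show ?thesis unfolding entropic_argmin_def by (rule someI_ex)
qed

lemma entropic_argmin_unique:
  fixes u :: "real ^ 'k"
  assumes "0 < b" "b \<le> 1 / real CARD('k)" "is_arg_min (entropic u) (\<lambda>z. z \<in> trunc_simplex b) z"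
  shows "z = entropic_argmin b u"
  using entropic_argmin_lipschitz[OF assms(1,3) is_arg_min_entropic_argmin[OF assms(1,2)], of u] by simp

lemma borel_measurable_entropic_argmin:
  assumes "0 < b" "b \<le> 1 / real CARD('k)"
  shows "(entropic_argmin b :: real ^ 'k \<Rightarrow> real ^ 'k) \<in> borel_measurable borel"
proof (rule borel_measurable_continuous_onI, rule continuous_on_iff[THEN iffD2], intro ballI allI impI)
  fix u :: "real ^ 'k" and r :: real assume "0 < r"
  then show "\<exists>d>0. \<forall>u'\<in>UNIV. dist u' u < d \<longrightarrow> dist (entropic_argmin b u') (entropic_argmin b u) < r"
    using entropic_argmin_lipschitz[OF assms(1) is_arg_min_entropic_argmin[OF assms]
        is_arg_min_entropic_argmin[OF assms]]
    by (intro exI[of _ r]) (auto simp: dist_norm intro: le_less_trans)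
qed

lemma is_arg_min_mirror_step:
  fixes x g :: "real ^ 'k"
  assumes "\<And>i. 0 < x $ i"
  shows "is_arg_min (\<lambda>x'. (- \<eta> *\<^sub>R g) \<bullet> x' + bregman neg_entropy x' x) Q z
    \<longleftrightarrow> is_arg_min (entropic ((\<chi> i. ln (x $ i)) + \<eta> *\<^sub>R g)) Q z"
proof -
  have "(- \<eta> *\<^sub>R g) \<bullet> w + bregman neg_entropy w x
      = entropic ((\<chi> i. ln (x $ i)) + \<eta> *\<^sub>R g) w + (\<Sum>i\<in>UNIV. x $ i)" for w
    unfolding bregman_neg_entropy[OF assms]
    by (simp add: entropic_def kl_def neg_entropy_def inner_vec_def sum_subtractf sum.distrib
        sum_distrib_left sum_negf algebra_simps)
  then show ?thesis by (simp add: is_arg_min_def)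
qed

text \<open>The term \<open>x v\<^sup>2\<close> comes from \<open>v z - (z ln (z / x) - z + x) \<le> x (exp v - 1)\<close> and
  \<open>exp v \<le> 1 + v + v\<^sup>2\<close> on \<open>[0, 1]\<close>.\<close>

lemma mirror_step_regret:
  fixes x y z :: "real ^ 'k"
  assumes "0 < b" and x: "\<And>i. 0 < x $ i" and "0 \<le> v" "v \<le> 1"
    and z: "is_arg_min (entropic ((\<chi> i. ln (x $ i)) + (\<chi> j. if j = a then v else 0)))
      (\<lambda>z. z \<in> trunc_simplex b) z"
    and y: "y \<in> trunc_simplex b"
  shows "v * (y $ a - x $ a) \<le> kl y x - kl y z + x $ a * v\<^sup>2"
proof -
  define u where "u = (\<chi> i. ln (x $ i)) + (\<chi> j. if j = a then v else 0)"
  have zS: "z \<in> trunc_simplex b" using z by (simp add: is_arg_min_def)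
  have ent: "entropic u w = kl w x - v * w $ a - (\<Sum>i\<in>UNIV. x $ i)" for w
    by (simp add: u_def entropic_def kl_def neg_entropy_def inner_vec_def sum_subtractf sum.distrib
        algebra_simps if_distrib[of "\<lambda>c. _ * c"] cong: if_cong)
  have 1: "kl y z \<le> kl y x - v * y $ a - (kl z x - v * z $ a)"
    using entropic_argmin_gap[OF \<open>0 < b\<close> z y] unfolding u_def[symmetric] ent by simp
  have "z $ a * ln (z $ a) - z $ a * ln (x $ a) - z $ a + x $ a \<le> kl z x"
    unfolding kl_def
    by (rule member_le_sum[where f = "\<lambda>i. z $ i * ln (z $ i) - z $ i * ln (x $ i) - z $ i + x $ i"])
      (use x trunc_simplexD(2)[OF zS] ln_diff_ge in auto)
  moreover have "0 \<le> z $ a * ln (z $ a) - z $ a * ln (x $ a * exp v) - z $ a + x $ a * exp v"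
    using x trunc_simplexD(2)[OF zS] by (intro ln_diff_ge) auto
  moreover have "ln (x $ a * exp v) = ln (x $ a) + v" using x[of a] by (simp add: ln_mult)
  ultimately have 2: "v * z $ a - kl z x \<le> x $ a * (exp v - 1)" by (simp add: algebra_simps)
  have "exp v - 1 \<le> v + v\<^sup>2" using exp_bound[OF assms(3,4)] by simp
  then have "x $ a * (exp v - 1) \<le> x $ a * (v + v\<^sup>2)" using x[of a] by (intro mult_left_mono) auto
  with 1 2 show ?thesis by (simp add: algebra_simps)
qed

lemma kl_le_ln:
  assumes y: "y \<in> trunc_simplex b" and x: "x \<in> trunc_simplex b" and "0 < b"
  shows "kl y x \<le> - ln b"
proof -
  have "kl y x = (\<Sum>i\<in>UNIV. y $ i * (ln (y $ i) - ln (x $ i)))"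
    using trunc_simplexD(3)[OF y] trunc_simplexD(3)[OF x]
    by (simp add: kl_def sum.distrib sum_subtractf algebra_simps)
  also have "\<dots> \<le> (\<Sum>i\<in>UNIV. y $ i * (- ln b))"
  proof (intro sum_mono mult_left_mono)
    fix i
    have "0 < y $ i" "y $ i \<le> 1" "b \<le> x $ i" "0 < x $ i"
      using trunc_simplexD(1,2,4)[OF y, of i] trunc_simplexD(1,2,4)[OF x, of i] \<open>0 < b\<close> by auto
    then show "ln (y $ i) - ln (x $ i) \<le> - ln b" "0 \<le> y $ i"
      using \<open>0 < b\<close> ln_le_cancel_iff[of b "x $ i"] ln_le_zero_iff[of "y $ i"] by (linarith, simp)
  qed
  also have "\<dots> = - ln b" using trunc_simplexD(3)[OF y] by (simp add: sum_negf sum_distrib_right[symmetric])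
  finally show ?thesis .
qed

text \<open>The price of moving the comparator. In each coordinate the divergence is convex in its
  first argument p with derivative \<open>ln p - ln r\<close>, so the change from q to p is at most
  \<open>(p - q) * (ln p - ln r)\<close>; both logarithms lie between \<open>ln b\<close> and
  0.\<close>

lemma kl_change_comparator:
  assumes y: "y \<in> trunc_simplex b" and y': "y' \<in> trunc_simplex b"
    and x: "x \<in> trunc_simplex b" and "0 < b"
  shows "kl y' x \<le> kl y x + norm1 (y' - y) * (- ln b)"
proof -
  have "y' $ i * ln (y' $ i) - y' $ i * ln (x $ i) - y' $ i + x $ i
     \<le> (y $ i * ln (y $ i) - y $ i * ln (x $ i) - y $ i + x $ i) + \<bar>(y' - y) $ i\<bar> * (- ln b)" for i
  proof -
    define p q r where "p = y' $ i" and "q = y $ i" and "r = x $ i"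
    have pos: "0 < p" "p \<le> 1" "b \<le> p" "0 < q" "q \<le> 1" "b \<le> q" "0 < r" "r \<le> 1" "b \<le> r"
      using trunc_simplexD(1,2,4)[OF y, of i] trunc_simplexD(1,2,4)[OF y', of i] trunc_simplexD(1,2,4)[OF x, of i] \<open>0 < b\<close>
      by (auto simp: p_def q_def r_def)
    have "0 \<le> q * ln q - q * ln p - q + p" using pos by (intro ln_diff_ge) auto
    then have "p * ln p - p * ln r - p \<le> q * ln q - q * ln r - q + (p - q) * (ln p - ln r)"
      by (simp add: algebra_simps)
    also have "(p - q) * (ln p - ln r) \<le> \<bar>p - q\<bar> * \<bar>ln p - ln r\<bar>"
      by (metis abs_ge_self abs_mult)
    also have "\<dots> \<le> \<bar>p - q\<bar> * (- ln b)"
    proof (intro mult_left_mono)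
      have "ln b \<le> ln p" "ln p \<le> 0" "ln b \<le> ln r" "ln r \<le> 0"
        using pos \<open>0 < b\<close> by auto
      then show "\<bar>ln p - ln r\<bar> \<le> - ln b" by linarith
    qed simp
    finally show ?thesis by (simp add: p_def q_def r_def)
  qed
  then have "kl y' x \<le> (\<Sum>i\<in>UNIV. (y $ i * ln (y $ i) - y $ i * ln (x $ i) - y $ i + x $ i)
      + \<bar>(y' - y) $ i\<bar> * (- ln b))"
    unfolding kl_def by (intro sum_mono)
  also have "\<dots> = kl y x + norm1 (y' - y) * (- ln b)"
    by (simp only: kl_def norm1_def sum.distrib sum_distrib_right)
  finally show ?thesis .
qed

section \<open>Measurability of vector operations, generated sigma-algebras and conditional
  probabilities\<close>

lemma vec_nth_measurable [measurable (raw)]: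
  fixes f :: "'a \<Rightarrow> real ^ 'k"
  assumes "f \<in> borel_measurable N"
  shows "(\<lambda>\<omega>. f \<omega> $ i) \<in> borel_measurable N"
proof -
  have "(\<lambda>\<omega>. f \<omega> \<bullet> axis i 1) \<in> borel_measurable N"
    using assms by (intro borel_measurable_inner) auto
  then show ?thesis by (simp add: inner_axis)
qed

lemma vec_lambda_measurable [measurable (raw)]:
  fixes f :: "'k::finite \<Rightarrow> 'a \<Rightarrow> real"
  assumes "\<And>i. f i \<in> borel_measurable N"
  shows "(\<lambda>\<omega>. \<chi> i. f i \<omega>) \<in> borel_measurable N"
  by (rule borel_measurable_euclidean_space[THEN iffD2])
    (use assms in \<open>auto simp: Basis_vec_def inner_axis\<close>)

lemma infnorm_measurable:
  assumes [measurable]: "f \<in> borel_measurable N"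
  shows "(\<lambda>\<omega>. infnorm (f \<omega> :: real ^ 'k)) \<in> borel_measurable N"
  by (rule measurable_compose[OF assms borel_measurable_continuous_onI]) (intro continuous_intros)

lemma norm1_measurable [measurable (raw)]:
  assumes [measurable]: "f \<in> borel_measurable N"
  shows "(\<lambda>\<omega>. norm1 (f \<omega> :: real ^ 'k)) \<in> borel_measurable N"
  unfolding norm1_def by measurable

lemma clip_measurable [measurable (raw)]:
  assumes [measurable]: "f \<in> borel_measurable N"
  shows "(\<lambda>\<omega>. clip b (f \<omega>)) \<in> borel_measurable N"
  unfolding clip_def by measurable

lemma sets_sigma_subset:
  assumes "G \<subseteq> sets N" "\<Omega> = space N"
  shows "sets (sigma \<Omega> G) \<subseteq> sets N"
proof -
  have "G \<subseteq> Pow \<Omega>" using assms sets.space_closed by blast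
  then show ?thesis using assms by (simp add: sets.sigma_sets_subset)
qed

lemma vimage_algebra_sets_Pow: "sets (vimage_algebra \<Omega> f N) \<subseteq> Pow \<Omega>"
  using sets.space_closed[of "vimage_algebra \<Omega> f N"] by simp

lemma measurable_sigma_generator:
  assumes "sets (vimage_algebra \<Omega> f N) \<subseteq> G" "G \<subseteq> Pow \<Omega>" "f \<in> \<Omega> \<rightarrow> space N"
  shows "f \<in> measurable (sigma \<Omega> G) N"
proof -
  have "G \<subseteq> sets (sigma \<Omega> G)" using assms(2) by auto
  then show ?thesis using assms by (simp add: measurable_iff_sets)
qed

lemma subalgebraI: "space F = space N \<Longrightarrow> sets F \<subseteq> sets N \<Longrightarrow> subalgebra N F"
  by (simp add: subalgebra_def)

lemma (in prob_space) indep_set_integral: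
  fixes X Y :: "'a \<Rightarrow> real"
  assumes F: "subalgebra M F" and G: "subalgebra M G" and ind: "indep_set (sets F) (sets G)"
    and X: "X \<in> borel_measurable F" "integrable M X" and Y: "Y \<in> borel_measurable G" "integrable M Y"
  shows "integrable M (\<lambda>\<omega>. X \<omega> * Y \<omega>)" "(\<integral>\<omega>. X \<omega> * Y \<omega> \<partial>M) = (\<integral>\<omega>. X \<omega> \<partial>M) * (\<integral>\<omega>. Y \<omega> \<partial>M)"
proof -
  have sub: "sigma_sets (space M) {Z -` A \<inter> space M |A. A \<in> sets borel} \<subseteq> sets H"
    if "subalgebra M H" "Z \<in> borel_measurable H" for Z :: "'a \<Rightarrow> real" and H
  proof -
    have "{Z -` A \<inter> space M |A. A \<in> sets borel} \<subseteq> sets H"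
      using that measurable_sets[OF that(2)] by (auto simp: subalgebra_def)
    then show ?thesis using that(1) sets.sigma_sets_subset[of _ H] by (simp add: subalgebra_def)
  qed
  have "indep_var borel X borel Y"
    unfolding indep_var_eq
  proof (intro conjI)
    show "indep_set (sigma_sets (space M) {X -` A \<inter> space M |A. A \<in> sets borel})
      (sigma_sets (space M) {Y -` A \<inter> space M |A. A \<in> sets borel})"
      using ind sub[OF F X(1)] sub[OF G Y(1)] unfolding indep_sets2_eq by blast
  qed (use X Y in auto)
  then show "integrable M (\<lambda>\<omega>. X \<omega> * Y \<omega>)"
    "(\<integral>\<omega>. X \<omega> * Y \<omega> \<partial>M) = (\<integral>\<omega>. X \<omega> \<partial>M) * (\<integral>\<omega>. Y \<omega> \<partial>M)"
    using X Y by (auto intro: indep_var_integrable indep_var_lebesgue_integral)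
qed

lemma (in prob_space) nn_integral_cond_prob:
  fixes r :: "'a \<Rightarrow> real"
  assumes sub: "subalgebra M F" and E: "E \<in> events"
    and r: "AE \<omega> in M. real_cond_exp M F (indicator E) \<omega> = r \<omega>"
    and Y: "Y \<in> borel_measurable F"
  shows "(\<integral>\<^sup>+\<omega>. Y \<omega> * indicator E \<omega> \<partial>M) = (\<integral>\<^sup>+\<omega>. Y \<omega> * ennreal (r \<omega>) \<partial>M)"
proof -
  interpret finite_measure_subalgebra M F by unfold_locales (rule sub)
  have ind: "(\<lambda>\<omega>. ennreal (indicator E \<omega>)) = indicator E"
    by (simp add: fun_eq_iff ennreal_indicator)
  have neg: "(\<lambda>\<omega>. ennreal (- indicator E \<omega>)) = (\<lambda>_. 0)"
    by (auto simp: fun_eq_iff indicator_def ennreal_neg)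
  \<comment> \<open>\<open>real_cond_exp\<close> is a difference of two \<open>enn2real\<close>
    values. The negative part vanishes here, and the bound by 1 excludes the value infinity, which
    \<open>enn2real\<close> would send to 0; so the real conditional probability determines the
    extended one.\<close>
  have "AE \<omega> in M. 0 = nn_cond_exp M F (\<lambda>_. 0) \<omega>"
    using nn_cond_exp_F_meas[of "\<lambda>_. 0"] by simp
  moreover have "AE \<omega> in M. nn_cond_exp M F (indicator E) \<omega> \<le> nn_cond_exp M F (\<lambda>_. 1) \<omega>"
    using E by (intro nn_cond_exp_mono) (auto simp: indicator_def)
  moreover have "AE \<omega> in M. 1 = nn_cond_exp M F (\<lambda>_. 1) \<omega>"
    using nn_cond_exp_F_meas[of "\<lambda>_. 1"] by simp
  ultimately have "AE \<omega> in M. nn_cond_exp M F (indicator E) \<omega> = ennreal (r \<omega>)"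
    using r
  proof eventually_elim
    case (elim \<omega>)
    then have "nn_cond_exp M F (indicator E) \<omega> < \<top>"
      by (metis ennreal_one_less_top order_le_less_trans)
    moreover have "enn2real (nn_cond_exp M F (indicator E) \<omega>) = r \<omega>"
      using elim by (simp add: real_cond_exp_def ind neg)
    ultimately show ?case by (metis ennreal_enn2real)
  qed
  then have "(\<integral>\<^sup>+\<omega>. Y \<omega> * ennreal (r \<omega>) \<partial>M) = (\<integral>\<^sup>+\<omega>. Y \<omega> * nn_cond_exp M F (indicator E) \<omega> \<partial>M)"
    by (intro nn_integral_cong_AE) auto
  also have "\<dots> = (\<integral>\<^sup>+\<omega>. Y \<omega> * indicator E \<omega> \<partial>M)"
    using Y E by (intro nn_cond_exp_intg) auto
  finally show ?thesis by simp
qed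

text \<open>Dividing by the conditional probability \<open>r\<close> cancels it. Working with
  nonnegative integrals first yields integrability of the quotient as well, although
  \<open>1 / r\<close> need not be bounded.\<close>

lemma (in prob_space) importance_weighting:
  fixes r Y :: "'a \<Rightarrow> real"
  assumes sub: "subalgebra M F" and E: "E \<in> events"
    and r: "AE \<omega> in M. real_cond_exp M F (indicator E) \<omega> = r \<omega>"
    and rF: "r \<in> borel_measurable F" "\<And>\<omega>. \<omega> \<in> space M \<Longrightarrow> 0 < r \<omega>"
    and Y: "Y \<in> borel_measurable F" "integrable M Y" "AE \<omega> in M. 0 \<le> Y \<omega>"
  shows "has_bochner_integral M (\<lambda>\<omega>. indicator E \<omega> * (Y \<omega> / r \<omega>)) (\<integral>\<omega>. Y \<omega> \<partial>M)"
proof (rule has_bochner_integral_nn_integral)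
  have m: "Y \<in> borel_measurable M" "r \<in> borel_measurable M"
    using Y rF sub measurable_from_subalg by blast+
  then show "(\<lambda>\<omega>. indicator E \<omega> * (Y \<omega> / r \<omega>)) \<in> borel_measurable M" using E by measurable
  show "AE \<omega> in M. 0 \<le> indicator E \<omega> * (Y \<omega> / r \<omega>)"
    using Y(3) AE_space by eventually_elim (use rF(2) in \<open>auto simp: less_imp_le\<close>)
  show "0 \<le> (\<integral>\<omega>. Y \<omega> \<partial>M)" using Y(3) by (rule integral_nonneg_AE)
  have "(\<integral>\<^sup>+\<omega>. ennreal (indicator E \<omega> * (Y \<omega> / r \<omega>)) \<partial>M)
      = (\<integral>\<^sup>+\<omega>. ennreal (Y \<omega> / r \<omega>) * indicator E \<omega> \<partial>M)"
    by (intro nn_integral_cong) (auto simp: indicator_def)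
  also have "\<dots> = (\<integral>\<^sup>+\<omega>. ennreal (Y \<omega> / r \<omega>) * ennreal (r \<omega>) \<partial>M)"
    using rF(1) Y(1) by (intro nn_integral_cond_prob[OF sub E r]) measurable
  also have "\<dots> = (\<integral>\<^sup>+\<omega>. ennreal (Y \<omega>) \<partial>M)"
  proof (intro nn_integral_cong_AE)
    show "AE \<omega> in M. ennreal (Y \<omega> / r \<omega>) * ennreal (r \<omega>) = ennreal (Y \<omega>)"
      using Y(3) AE_space
    proof eventually_elim
      case (elim \<omega>)
      then show ?case using rF(2)[of \<omega>] by (simp add: ennreal_mult[symmetric])
    qed
  qed
  also have "\<dots> = ennreal (\<integral>\<omega>. Y \<omega> \<partial>M)" using Y by (intro nn_integral_eq_integral) auto
  finally show "(\<integral>\<^sup>+\<omega>. ennreal (indicator E \<omega> * (Y \<omega> / r \<omega>)) \<partial>M) = ennreal (\<integral>\<omega>. Y \<omega> \<partial>M)" .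
qed

section \<open>Measurability and independence\<close>

context queueing_system
begin

lemma A_S_measurable:
  assumes "1 \<le> t"
  shows "A t \<in> borel_measurable P" "S t \<in> borel_measurable P"
proof -
  have "case_sum A S j \<in> borel_measurable P" if "j \<in> {1..} <+> {1..}" for j
    using independent that by (auto simp: indep_vars_def2)
  from this[of "Inl t"] this[of "Inr t"] assms
  show "A t \<in> borel_measurable P" "S t \<in> borel_measurable P" by auto
qed

definition env_gen :: "nat set \<Rightarrow> 'w set set" where
  "env_gen J = (\<Union>s\<in>J. sets (vimage_algebra (space P) (A s) borel) \<union>
     sets (vimage_algebra (space P) (S s) borel))"

definition env :: "nat set \<Rightarrow> 'w measure" where "env J = sigma (space P) (env_gen J)"

definition act_gen :: "nat set \<Rightarrow> 'w set set" where
  "act_gen J = (\<Union>s\<in>J. sets (vimage_algebra (space P) (a s) (count_space UNIV)))"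

text \<open>Unlike \<open>\<F>\<^sub>t\<close>, \<open>past t\<close> also contains the unobserved services of the slots up to \<open>t\<close>.  This
  keeps the generators simple and does not destroy the independence from the later environment.\<close>

definition past :: "nat \<Rightarrow> 'w measure" where
  "past t = sigma (space P) (act_gen {1..t} \<union> env_gen {1..t})"

lemma gen_Pow: "env_gen J \<subseteq> Pow (space P)" "act_gen J \<subseteq> Pow (space P)"
  unfolding env_gen_def act_gen_def using vimage_algebra_sets_Pow by blast+

lemma space_env [simp]: "space (env J) = space P"
  and space_past [simp]: "space (past t) = space P"
  using gen_Pow by (auto simp: env_def past_def space_measure_of_conv)

lemma sets_env: "sets (env J) = sigma_sets (space P) (env_gen J)"
  and sets_past: "sets (past t) = sigma_sets (space P) (act_gen {1..t} \<union> env_gen {1..t})"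
  using gen_Pow by (auto simp: env_def past_def)

lemma gen_events:
  assumes "J \<subseteq> {1..}"
  shows "env_gen J \<subseteq> events" "act_gen J \<subseteq> events"
  using assms A_S_measurable action_measurable
  unfolding env_gen_def act_gen_def measurable_iff_sets
  by (intro UN_least Un_least; blast)+

lemma subalgebra_env: "J \<subseteq> {1..} \<Longrightarrow> subalgebra P (env J)"
  unfolding env_def using gen_events gen_Pow
  by (intro subalgebraI sets_sigma_subset) (auto simp: space_measure_of_conv)

lemma subalgebra_past: "subalgebra P (past t)"
  unfolding past_def using gen_events[of "{1..t}"] gen_Pow
  by (intro subalgebraI sets_sigma_subset) (auto simp: space_measure_of_conv)

lemma env_measurable:
  assumes "s \<in> J"
  shows "A s \<in> borel_measurable (env J)" "S s \<in> borel_measurable (env J)"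
  unfolding env_def using assms gen_Pow
  by (auto intro!: measurable_sigma_generator simp: env_gen_def)

lemma past_mono:
  assumes "s \<le> t"
  shows "f \<in> measurable (past s) N \<Longrightarrow> f \<in> measurable (past t) N"
proof -
  have "act_gen {1..s} \<union> env_gen {1..s} \<subseteq> act_gen {1..t} \<union> env_gen {1..t}"
    using assms by (fastforce simp: act_gen_def env_gen_def)
  then have "sets (past s) \<subseteq> sets (past t)"
    unfolding sets_past by (rule sigma_sets_mono')
  then show "f \<in> measurable (past s) N \<Longrightarrow> f \<in> measurable (past t) N"
    using measurable_from_subalg[OF subalgebraI[of "past s" "past t"]] by simp
qed

lemma past_measurable:
  assumes "1 \<le> s" "s \<le> t"
  shows "a s \<in> measurable (past t) (count_space UNIV)"
    "A s \<in> borel_measurable (past t)" "S s \<in> borel_measurable (past t)"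
proof -
  have Pow: "act_gen {1..t} \<union> env_gen {1..t} \<subseteq> Pow (space P)" using gen_Pow by simp
  have s: "s \<in> {1..t}" using assms by simp
  have gen: "sets (vimage_algebra (space P) (a s) (count_space UNIV)) \<subseteq> act_gen {1..t}"
    "sets (vimage_algebra (space P) (A s) borel) \<subseteq> env_gen {1..t}"
    "sets (vimage_algebra (space P) (S s) borel) \<subseteq> env_gen {1..t}"
    using s unfolding act_gen_def env_gen_def by blast+
  show "a s \<in> measurable (past t) (count_space UNIV)"
    unfolding past_def by (rule measurable_sigma_generator[OF le_supI1[OF gen(1)] Pow]) simp
  show "A s \<in> borel_measurable (past t)"
    unfolding past_def by (rule measurable_sigma_generator[OF le_supI2[OF gen(2)] Pow]) simp
  show "S s \<in> borel_measurable (past t)"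
    unfolding past_def by (rule measurable_sigma_generator[OF le_supI2[OF gen(3)] Pow]) simp
qed

lemma queue_0_measurable: "space N = space P \<Longrightarrow> Q 0 \<in> borel_measurable N"
  by (subst measurable_cong[of _ _ "\<lambda>_. 0"]) (auto simp: queue_0)

lemma queue_past_measurable: "Q t \<in> borel_measurable (past t)"
proof (induction t)
  case (Suc t)
  have [measurable]: "Q t \<in> borel_measurable (past (Suc t))" by (rule past_mono[OF _ Suc]) simp
  have [measurable]: "a (Suc t) \<in> measurable (past (Suc t)) (count_space UNIV)"
    "A (Suc t) \<in> borel_measurable (past (Suc t))" "S (Suc t) \<in> borel_measurable (past (Suc t))"
    by (rule past_measurable; simp)+
  have "(\<lambda>\<omega>. \<chi> i. max (Q t \<omega> $ i + A (Suc t) \<omega> $ i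
      - S (Suc t) \<omega> $ i * (if i = a (Suc t) \<omega> then 1 else 0)) 0) \<in> borel_measurable (past (Suc t))"
    by measurable
  then show ?case
    by (subst measurable_cong[OF queue_step]) simp_all
qed (rule queue_0_measurable, simp)

lemma queue_measurable: "Q t \<in> borel_measurable P"
  using measurable_from_subalg[OF subalgebra_past queue_past_measurable] .

lemma service_action_measurable:
  assumes "1 \<le> s"
  shows "(\<lambda>\<omega>. S s \<omega> $ a s \<omega>) \<in> borel_measurable P"
proof -
  have [measurable]: "S s \<in> borel_measurable P" "a s \<in> measurable P (count_space UNIV)"
    using A_S_measurable[OF assms] action_measurable[OF assms] by auto
  show ?thesis
    by (rule measurable_compose_countable[where f = "\<lambda>i \<omega>. S s \<omega> $ i"]) measurable
qed

lemma subalgebra_history: "subalgebra P (history P A S a Q t)"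
  unfolding history_def
proof (intro subalgebraI sets_sigma_subset)
  show "(\<Union>s\<in>{1..t}. sets (vimage_algebra (space P) (a s) (count_space UNIV))) \<union>
     (\<Union>s\<in>{0..t}. sets (vimage_algebra (space P) (Q s) borel)) \<union>
     (\<Union>s\<in>{1..t}. sets (vimage_algebra (space P) (A s) borel)) \<union>
     (\<Union>s\<in>{1..t}. sets (vimage_algebra (space P) (\<lambda>\<omega>. S s \<omega> $ a s \<omega>) borel)) \<subseteq> events"
    using queue_measurable A_S_measurable service_action_measurable action_measurable
    unfolding measurable_iff_sets by (intro Un_least UN_least) auto
qed (simp_all add: space_measure_of_conv)

lemma history_env_gen_events:
  "sets (history P A S a Q t) \<union>
     (\<Union>s\<in>{1..}. sets (vimage_algebra (space P) (A s) borel)) \<union>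
     (\<Union>s\<in>{1..}. sets (vimage_algebra (space P) (S s) borel)) \<subseteq> events" (is "?G \<subseteq> _")
  using subalgebra_history[of t] A_S_measurable
  unfolding measurable_iff_sets subalgebra_def by (intro Un_least UN_least) auto

lemma subalgebra_history_env: "subalgebra P (history_env P A S a Q t)"
  unfolding history_env_def
  by (intro subalgebraI sets_sigma_subset history_env_gen_events) (simp_all add: space_measure_of_conv)

lemma history_env_measurable:
  assumes "1 \<le> s"
  shows "A s \<in> borel_measurable (history_env P A S a Q t)"
    "S s \<in> borel_measurable (history_env P A S a Q t)"
proof -
  have Pow: "sets (history P A S a Q t) \<union>
     (\<Union>s\<in>{1..}. sets (vimage_algebra (space P) (A s) borel)) \<union>
     (\<Union>s\<in>{1..}. sets (vimage_algebra (space P) (S s) borel)) \<subseteq> Pow (space P)"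
    using history_env_gen_events[of t] sets.space_closed[of P] by (rule order_trans)
  have s: "s \<in> {1..}" using assms by simp
  show "A s \<in> borel_measurable (history_env P A S a Q t)"
    unfolding history_env_def using UN_upper[OF s, of "\<lambda>s. sets (vimage_algebra (space P) (A s) borel)"]
    by (intro measurable_sigma_generator[OF _ Pow]) (simp_all add: le_supI1 le_supI2)
  show "S s \<in> borel_measurable (history_env P A S a Q t)"
    unfolding history_env_def using UN_upper[OF s, of "\<lambda>s. sets (vimage_algebra (space P) (S s) borel)"]
    by (intro measurable_sigma_generator[OF _ Pow]) (simp_all add: le_supI1 le_supI2)
qed

lemma env_sub_history_env:
  assumes "J \<subseteq> {1..}"
  shows "sets (env J) \<subseteq> sets (history_env P A S a Q t)"
proof -
  have sp: "space (history_env P A S a Q t) = space P"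
    using subalgebra_history_env by (simp add: subalgebra_def)
  show ?thesis
    unfolding env_def
  proof (rule sets_sigma_subset)
    show "env_gen J \<subseteq> sets (history_env P A S a Q t)"
      using history_env_measurable[of _ t] assms unfolding env_gen_def measurable_iff_sets sp
      by (intro UN_least Un_least) auto
  qed (simp add: sp)
qed

text \<open>The law of the next action is conditioned on \<open>history_env\<close>. The inclusion
  makes every function of \<open>past t\<close>, in particular the sampling probabilities, usable
  there; the unobserved services in \<open>past t\<close> do no harm because
  \<open>history_env\<close> contains all services.\<close>

lemma past_sub_history_env: "sets (past t) \<subseteq> sets (history_env P A S a Q t)"
proof -
  have sp: "space (history_env P A S a Q t) = space P"
    using subalgebra_history_env by (simp add: subalgebra_def)
  have H: "sets (history P A S a Q t) \<subseteq> sets (history_env P A S a Q t)"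
    unfolding history_env_def
    by (subst sets_measure_of[OF order_trans[OF history_env_gen_events sets.space_closed]],
        rule order_trans[OF _ sigma_sets_superset_generator]) blast
  have act: "a s \<in> measurable (history P A S a Q t) (count_space UNIV)" if "s \<in> {1..t}" for s
    unfolding history_def
  proof (rule measurable_sigma_generator)
    show "(\<Union>s\<in>{1..t}. sets (vimage_algebra (space P) (a s) (count_space UNIV))) \<union>
     (\<Union>s\<in>{0..t}. sets (vimage_algebra (space P) (Q s) borel)) \<union>
     (\<Union>s\<in>{1..t}. sets (vimage_algebra (space P) (A s) borel)) \<union>
     (\<Union>s\<in>{1..t}. sets (vimage_algebra (space P) (\<lambda>\<omega>. S s \<omega> $ a s \<omega>) borel)) \<subseteq> Pow (space P)"
      by (intro Un_least UN_least vimage_algebra_sets_Pow)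
  qed (use that in auto)
  have sph: "space (history P A S a Q t) = space P"
    using subalgebra_history by (simp add: subalgebra_def)
  have "act_gen {1..t} \<subseteq> sets (history_env P A S a Q t)"
    using act H unfolding act_gen_def measurable_iff_sets sph by blast
  moreover have "env_gen {1..t} \<subseteq> sets (history_env P A S a Q t)"
    using env_sub_history_env[of "{1..t}" t] gen_Pow(1)[of "{1..t}"] by (auto simp: sets_env)
  ultimately show ?thesis
    unfolding past_def by (intro sets_sigma_subset) (auto simp: sp)
qed

lemma past_history_env_measurable:
  "f \<in> measurable (past t) N \<Longrightarrow> f \<in> measurable (history_env P A S a Q t) N"
  using measurable_from_subalg[OF subalgebraI[OF _ past_sub_history_env]]
    subalgebra_history_env by (simp add: subalgebra_def)

text \<open>Arrivals and services form one independent family over a sum type, so disjoint slot sets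
  \<open>J\<close> and \<open>J'\<close> select the disjoint index sets \<open>J <+> J\<close> and
  \<open>J' <+> J'\<close>, and grouping preserves independence.\<close>

lemma indep_env:
  assumes "J \<inter> J' = {}" "J \<subseteq> {1..}" "J' \<subseteq> {1..}"
  shows "indep_set (sets (env J)) (sets (env J'))"
proof -
  define E where "E j = {case_sum A S j -` B \<inter> space P |B. B \<in> sets borel}" for j
  define I where "I = case_bool (J <+> J) (J' <+> J')"
  have "indep_sets (\<lambda>b. sigma_sets (space P) (\<Union>i\<in>I b. E i)) UNIV"
  proof (rule indep_sets_collect_sigma)
    have "indep_sets E ({1..} <+> {1..})"
      using independent by (simp add: indep_vars_def2 E_def[abs_def])
    then show "indep_sets E (\<Union>b\<in>UNIV. I b)"
      by (rule indep_sets_mono_index[rotated]) (use assms in \<open>auto simp: I_def UNIV_bool\<close>)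
    show "Int_stable (E i)" for i
    proof (rule Int_stableI)
      fix x y assume "x \<in> E i" "y \<in> E i"
      then obtain B B' where "x = case_sum A S i -` B \<inter> space P" "y = case_sum A S i -` B' \<inter> space P"
        "B \<in> sets borel" "B' \<in> sets borel" by (auto simp: E_def)
      then show "x \<inter> y \<in> E i" by (auto simp: E_def intro!: exI[of _ "B \<inter> B'"])
    qed
    show "disjoint_family_on I UNIV"
      using assms(1) by (auto simp: disjoint_family_on_def I_def split: bool.splits)
  qed
  moreover have gen: "(\<Union>i\<in>J <+> J. E i) = env_gen J" for J
  proof -
    have "(\<Union>i\<in>J <+> J. E i) = (\<Union>s\<in>J. E (Inl s) \<union> E (Inr s))" by (auto simp: Plus_def)
    also have "\<dots> = env_gen J" by (simp add: E_def env_gen_def sets_vimage_algebra2)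
    finally show ?thesis .
  qed
  moreover have "(\<lambda>b. sigma_sets (space P) (\<Union>i\<in>I b. E i))
      = case_bool (sets (env J)) (sets (env J'))"
    by (rule ext) (simp add: I_def sets_env gen split: bool.split)
  ultimately show ?thesis by (simp add: indep_set_def)
qed

end

section \<open>Comparison of the norms and the setting of a SoftMW+ run\<close>

lemma norm_sq_vec: "(norm (v :: real ^ 'k))\<^sup>2 = (\<Sum>i\<in>UNIV. (v $ i)\<^sup>2)"
  by (simp add: norm_eq_sqrt_inner inner_vec_def sum_nonneg power2_eq_square)

lemma norm1_nonneg: "0 \<le> norm1 v"
  by (simp add: norm1_def sum_nonneg)

lemma norm1_sq_le: "(norm1 (v :: real ^ 'k))\<^sup>2 \<le> real CARD('k) * (norm v)\<^sup>2"
proof -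
  have "(\<Sum>i\<in>UNIV. \<bar>v $ i\<bar> * 1)\<^sup>2 \<le> (\<Sum>i\<in>UNIV. \<bar>v $ i\<bar>\<^sup>2) * (\<Sum>i\<in>(UNIV :: 'k set). 1\<^sup>2)"
    by (rule Cauchy_Schwarz_ineq_sum)
  then show ?thesis by (simp add: norm1_def norm_sq_vec mult.commute)
qed

lemma norm1_triangle: "norm1 (v + w) \<le> norm1 v + norm1 w"
  unfolding norm1_def sum.distrib[symmetric] by (intro sum_mono) auto

lemma norm1_scaleR: "norm1 (c *\<^sub>R v) = \<bar>c\<bar> * norm1 v"
  by (simp add: norm1_def abs_mult sum_distrib_left)

lemma norm_sq_le_norm1: "(norm (v :: real ^ 'k))\<^sup>2 \<le> (norm1 v)\<^sup>2"
proof -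
  have "norm v \<le> norm1 v" unfolding norm1_def by (rule norm_le_l1_cart)
  then show ?thesis by (intro power_mono) auto
qed

locale softmw_instance = softmw_plus P \<A> \<S> A S a Q M \<delta> x p e L
  for P :: "'w measure"
    and \<A> \<S> :: "nat \<Rightarrow> (real ^ 'k) measure"
    and A S :: "nat \<Rightarrow> 'w \<Rightarrow> real ^ 'k"
    and a :: "nat \<Rightarrow> 'w \<Rightarrow> 'k"
    and Q :: "nat \<Rightarrow> 'w \<Rightarrow> real ^ 'k"
    and M \<delta> :: real
    and x p e :: "nat \<Rightarrow> 'w \<Rightarrow> real ^ 'k"
    and L :: "nat \<Rightarrow> 'w \<Rightarrow> real" +
  fixes \<alpha> :: real
  assumes moments: "bounded_moments P A S a Q \<alpha> M"
    and alpha: "14 < \<alpha>" and delta: "0 < \<delta>" "\<delta> \<le> 1 / 2" and delta_alpha: "7 < \<delta> * \<alpha>"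
begin

text \<open>Half the exponent 1/2 - \<delta> of the path-length assumption, and the power of
  \<open>t\<close> in the learning rate.\<close>

definition \<kappa> :: real where "\<kappa> = 1 / 4 - \<delta> / 2"

lemma kappa: "0 \<le> \<kappa>" "\<kappa> \<le> 1 / 4" using delta by (auto simp: \<kappa>_def)

lemma M_pos: "0 < M" using moments by (simp add: bounded_moments_def)

lemma K_ge: "1 \<le> real CARD('k)" by (simp add: Suc_leI)

definition \<eta> where "\<eta> t \<omega> = softmw_\<eta> \<delta> (\<lambda>s. Q s \<omega>) (\<lambda>s. L s \<omega>) t"

definition \<gamma> where "\<gamma> t \<omega> = softmw_\<gamma> M \<delta> (\<lambda>s. Q s \<omega>) (\<lambda>s. L s \<omega>) t"

definition \<beta> where "\<beta> t = softmw_\<beta> CARD('k) t"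

text \<open>All coordinates are clipped, not only the one served: \<open>Sc t\<close> is then a
  function of the environment of slot \<open>t\<close> and independent of the past.\<close>

definition Sc where "Sc t \<omega> = (\<chi> i. clip (M * real t powr (\<delta> / 4)) (S t \<omega> $ i))"

definition reward where "reward t \<omega> = Q (t - 1) \<omega> $ a t \<omega> * Sc t \<omega> $ a t \<omega>"

text \<open>The reciprocal of the learning rate without its power of \<open>t\<close>. In contrast
  to the full reciprocal it is monotone in \<open>t\<close>, and it therefore serves as the majorant
  in \<open>weighted_telescope\<close>.\<close>

definition Z where
  "Z t \<omega> = L (t - 1) \<omega> * sqrt (86 * (L (t - 1) \<omega>)\<^sup>2 * real CARD('k) ^ 6 * real t powr (3 / 2)
     + (\<Sum>s\<in>{0..t - 1}. (norm (Q s \<omega>))\<^sup>2))"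

lemma beta: "1 \<le> t \<Longrightarrow> 0 < \<beta> t" "1 \<le> t \<Longrightarrow> \<beta> t \<le> 1 / real CARD('k)"
proof -
  assume "1 \<le> t"
  then show "0 < \<beta> t" by (simp add: \<beta>_def softmw_\<beta>_def)
  have "real t powr (- 4) \<le> 1 powr (- 4)" using \<open>1 \<le> t\<close> by (intro powr_mono2') auto
  then show "\<beta> t \<le> 1 / real CARD('k)" by (simp add: \<beta>_def softmw_\<beta>_def divide_right_mono)
qed

lemma beta_antimono: "1 \<le> s \<Longrightarrow> s \<le> t \<Longrightarrow> \<beta> t \<le> \<beta> s"
  by (simp add: \<beta>_def softmw_\<beta>_def divide_right_mono powr_mono2')

lemma x_1: "\<omega> \<in> space P \<Longrightarrow> x 1 \<omega> = (\<chi> i. 1 / real CARD('k))"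
  and p_eq: "1 \<le> t \<Longrightarrow> \<omega> \<in> space P \<Longrightarrow> p t \<omega> = (1 - \<gamma> t \<omega>) *\<^sub>R x t \<omega> + \<gamma> t \<omega> *\<^sub>R e t \<omega>"
  and action_law: "1 \<le> t \<Longrightarrow> AE \<omega> in P. real_cond_exp P (history_env P A S a Q (t - 1))
     (indicator {\<omega> \<in> space P. a t \<omega> = i}) \<omega> = p t \<omega> $ i"
  using exp3sp by (auto simp: exp3sp_run_def \<gamma>_def)

lemma x_arg_min:
  assumes "1 \<le> t" "\<omega> \<in> space P"
  shows "is_arg_min (\<lambda>x'. (- \<eta> t \<omega> *\<^sub>R (\<chi> j. if j = a t \<omega> then reward t \<omega> / p t \<omega> $ j else 0)) \<bullet> x'
      + bregman neg_entropy x' (x t \<omega>)) (\<lambda>x'. x' \<in> trunc_simplex (\<beta> t)) (x (Suc t) \<omega>)"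
  using exp3sp assms unfolding exp3sp_run_def \<eta>_def \<beta>_def reward_def Sc_def Let_def vec_lambda_beta by simp

lemma x_Suc_trunc: "1 \<le> t \<Longrightarrow> \<omega> \<in> space P \<Longrightarrow> x (Suc t) \<omega> \<in> trunc_simplex (\<beta> t)"
  using x_arg_min by (auto simp: is_arg_min_def)

lemma x_trunc:
  assumes "1 \<le> t" "\<omega> \<in> space P"
  shows "x t \<omega> \<in> trunc_simplex (\<beta> t)"
proof (cases "t = 1")
  case True
  then show ?thesis
    using assms beta[of 1] by (simp add: x_1[simplified] trunc_simplex_def prob_simplex_def)
next
  case False
  then obtain s where s: "t = Suc s" "1 \<le> s" using assms by (cases t) auto
  then have "x t \<omega> \<in> trunc_simplex (\<beta> s)" using x_Suc_trunc assms by simp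
  then show ?thesis
    using beta_antimono[of s t] s by (auto simp: trunc_simplex_def intro: order_trans)
qed

lemma x_pos:
  assumes "1 \<le> t" "\<omega> \<in> space P"
  shows "0 < x t \<omega> $ i"
  using trunc_simplexD(1)[OF x_trunc[OF assms], of i] beta(1)[OF assms(1)] by simp

lemma x_arg_min_entropic:
  assumes "1 \<le> t" "\<omega> \<in> space P"
  shows "is_arg_min (entropic ((\<chi> i. ln (x t \<omega> $ i))
      + (\<chi> j. if j = a t \<omega> then \<eta> t \<omega> * reward t \<omega> / p t \<omega> $ a t \<omega> else 0)))
    (\<lambda>x'. x' \<in> trunc_simplex (\<beta> t)) (x (Suc t) \<omega>)"
proof -
  have eq: "\<eta> t \<omega> *\<^sub>R (\<chi> j. if j = a t \<omega> then reward t \<omega> / p t \<omega> $ j else 0)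
      = (\<chi> j. if j = a t \<omega> then \<eta> t \<omega> * reward t \<omega> / p t \<omega> $ a t \<omega> else 0)"
    by (simp add: vec_eq_iff)
  show ?thesis
    by (rule is_arg_min_mirror_step[OF x_pos[OF assms], THEN iffD1, OF x_arg_min[OF assms],
          unfolded eq])
qed

lemma Q_nonneg: "\<omega> \<in> space P \<Longrightarrow> 0 \<le> Q t \<omega> $ i"
  by (cases t) (simp_all add: queue_0 queue_step[of "Suc _"])

text \<open>The mixing term \<open>\<gamma>\<^sub>t e\<^sub>t\<close> does not depend on the arbitrary choice of \<open>e\<^sub>t\<close> for empty queues.\<close>

lemma p_alt:
  assumes "1 \<le> t" "\<omega> \<in> space P"
  shows "p t \<omega> = (1 - \<gamma> t \<omega>) *\<^sub>R x t \<omega> + (M * real t powr (\<delta> / 4) * \<eta> t \<omega>) *\<^sub>R Q (t - 1) \<omega>"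
proof (cases "Q (t - 1) \<omega> = 0")
  case True
  then show ?thesis
    by (simp add: p_eq[OF assms] \<gamma>_def softmw_\<gamma>_def norm1_def)
next
  case False
  have "norm1 (Q (t - 1) \<omega>) \<noteq> 0"
    using False by (simp add: norm1_def sum_nonneg_eq_0_iff vec_eq_iff)
  then show ?thesis
    by (simp add: p_eq[OF assms] e_eq[OF assms False] \<gamma>_def softmw_\<gamma>_def \<eta>_def)
qed

lemma L_past_measurable: "L t \<in> borel_measurable (past t)"
proof (induction t)
  case 0
  show ?case by (subst measurable_cong[of _ _ "\<lambda>_. M"]) (auto simp: L_0)
next
  case (Suc t)
  have [measurable]: "Q (Suc t) \<in> borel_measurable (past (Suc t))" "L t \<in> borel_measurable (past (Suc t))"
    "Q t \<in> borel_measurable (past (Suc t))"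
    using queue_past_measurable past_mono[OF _ Suc, of "Suc t"]
      past_mono[OF _ queue_past_measurable, of t "Suc t"] by auto
  note [measurable (raw)] = infnorm_measurable
  show ?case by (subst measurable_cong[OF L_step]) simp_all
qed

lemma eta_gamma_past_measurable:
  assumes "1 \<le> t"
  shows "\<eta> t \<in> borel_measurable (past (t - 1))" "\<gamma> t \<in> borel_measurable (past (t - 1))"
proof -
  have [measurable]: "Q s \<in> borel_measurable (past (t - 1))" if "s \<in> {0..t - 1}" for s
    using that past_mono[OF _ queue_past_measurable] by auto
  have [measurable]: "L (t - 1) \<in> borel_measurable (past (t - 1))" by (rule L_past_measurable)
  show [measurable]: "\<eta> t \<in> borel_measurable (past (t - 1))"
    unfolding \<eta>_def[abs_def] softmw_\<eta>_def by measurable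
  show "\<gamma> t \<in> borel_measurable (past (t - 1))"
    unfolding \<gamma>_def[abs_def] softmw_\<gamma>_def \<eta>_def[symmetric] by measurable
qed

text \<open>Only \<open>x\<close> needs an induction, since \<open>p t\<close> follows from
  \<open>x t\<close> by \<open>p_alt\<close>. In the induction step, uniqueness rewrites the iterate
  as the continuous function \<open>entropic_argmin\<close> of a dual vector that is measurable with
  respect to \<open>past t\<close>.\<close>

lemma x_p_past_measurable:
  assumes "1 \<le> t"
  shows "x t \<in> borel_measurable (past (t - 1))" "p t \<in> borel_measurable (past (t - 1))"
proof -
  have p: "p t \<in> borel_measurable (past (t - 1))"
    if [measurable]: "x t \<in> borel_measurable (past (t - 1))" and "1 \<le> t" for t
  proof -
    note [measurable] = eta_gamma_past_measurable[OF \<open>1 \<le> t\<close>] queue_past_measurable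
    have "(\<lambda>\<omega>. (1 - \<gamma> t \<omega>) *\<^sub>R x t \<omega>
        + (M * real t powr (\<delta> / 4) * \<eta> t \<omega>) *\<^sub>R Q (t - 1) \<omega>) \<in> borel_measurable (past (t - 1))"
      by measurable
    then show ?thesis using measurable_cong[of "past (t - 1)" "p t", OF p_alt[OF \<open>1 \<le> t\<close>]] by simp
  qed
  have x: "x t \<in> borel_measurable (past (t - 1))"
    using assms
  proof (induction t rule: dec_induct)
    case base
    show ?case by (subst measurable_cong[of _ _ "\<lambda>_. \<chi> i. 1 / real CARD('k)"]) (auto simp: x_1[simplified])
  next
    case (step t)
    have [measurable]: "x t \<in> borel_measurable (past t)" "p t \<in> borel_measurable (past t)"
      "\<eta> t \<in> borel_measurable (past t)" "Q (t - 1) \<in> borel_measurable (past t)"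
      using step p eta_gamma_past_measurable[of t] queue_past_measurable[of "t - 1"]
        past_mono[of "t - 1" t] by auto
    have [measurable]: "a t \<in> measurable (past t) (count_space UNIV)" "S t \<in> borel_measurable (past t)"
      using past_measurable[of t t] step by auto
    have [measurable]: "(\<lambda>\<omega>. reward t \<omega>) \<in> borel_measurable (past t)"
      unfolding reward_def
      by (rule measurable_compose_countable[where f = "\<lambda>i \<omega>. Q (t - 1) \<omega> $ i * Sc t \<omega> $ i"])
        (unfold Sc_def vec_lambda_beta, measurable)
    have [measurable]: "(\<lambda>\<omega>. p t \<omega> $ a t \<omega>) \<in> borel_measurable (past t)"
      by (rule measurable_compose_countable[where f = "\<lambda>i \<omega>. p t \<omega> $ i"]) simp_all
    note [measurable] = borel_measurable_entropic_argmin[OF beta[OF \<open>1 \<le> t\<close>]]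
    have eq: "x (Suc t) \<omega> = entropic_argmin (\<beta> t) ((\<chi> i. ln (x t \<omega> $ i))
      + (\<chi> j. if j = a t \<omega> then \<eta> t \<omega> * reward t \<omega> / p t \<omega> $ a t \<omega> else 0))"
      if "\<omega> \<in> space (past t)" for \<omega>
      using that step
      by (intro entropic_argmin_unique[OF beta] x_arg_min_entropic) auto
    have "(\<lambda>\<omega>. entropic_argmin (\<beta> t) ((\<chi> i. ln (x t \<omega> $ i))
      + (\<chi> j. if j = a t \<omega> then \<eta> t \<omega> * reward t \<omega> / p t \<omega> $ a t \<omega> else 0)))
      \<in> borel_measurable (past t)"
      by measurable
    then show ?case by (subst measurable_cong[OF eq]) simp_all
  qed
  show "x t \<in> borel_measurable (past (t - 1))" by (rule x)
  show "p t \<in> borel_measurable (past (t - 1))" by (rule p[OF x assms])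
qed

section \<open>Pathwise bounds\<close>

lemma L_mono: "\<omega> \<in> space P \<Longrightarrow> s \<le> t \<Longrightarrow> L s \<omega> \<le> L t \<omega>"
  by (rule lift_Suc_mono_le[of "\<lambda>t. L t \<omega>"]) (simp_all add: L_step[of "Suc _"])

lemma L_ge: "\<omega> \<in> space P \<Longrightarrow> M \<le> L t \<omega>"
  using L_mono[of \<omega> 0 t] L_0[of \<omega>] by simp

lemma L_pos: "\<omega> \<in> space P \<Longrightarrow> 0 < L t \<omega>"
  using L_ge[of \<omega> t] M_pos by simp

lemma Q_slope:
  assumes "\<omega> \<in> space P" "s < t"
  shows "\<bar>Q (Suc s) \<omega> $ i - Q s \<omega> $ i\<bar> \<le> L t \<omega>"
proof -
  have "\<bar>(Q (Suc s) \<omega> - Q s \<omega>) $ i\<bar> \<le> infnorm (Q (Suc s) \<omega> - Q s \<omega>)"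
    by (rule component_le_infnorm_cart)
  also have "\<dots> \<le> L (Suc s) \<omega>" using L_step[of "Suc s" \<omega>] assms by simp
  also have "\<dots> \<le> L t \<omega>" using assms by (intro L_mono) auto
  finally show ?thesis by simp
qed

lemma norm1_Q: "\<omega> \<in> space P \<Longrightarrow> norm1 (Q t \<omega>) = (\<Sum>i\<in>UNIV. Q t \<omega> $ i)"
  by (simp add: norm1_def Q_nonneg)

lemma norm1_Q_slope:
  assumes "\<omega> \<in> space P" "s < t"
  shows "\<bar>norm1 (Q (Suc s) \<omega>) - norm1 (Q s \<omega>)\<bar> \<le> real CARD('k) * L t \<omega>"
proof -
  have "\<bar>\<Sum>i\<in>UNIV. Q (Suc s) \<omega> $ i - Q s \<omega> $ i\<bar> \<le> (\<Sum>i\<in>(UNIV :: 'k set). L t \<omega>)"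
    by (intro order_trans[OF sum_abs] sum_mono Q_slope assms)
  then show ?thesis using assms by (simp add: norm1_Q sum_subtractf)
qed

lemma norm1_Q_0: "\<omega> \<in> space P \<Longrightarrow> norm1 (Q 0 \<omega>) = 0"
  by (simp add: queue_0 norm1_def)

lemma Z_pos: "1 \<le> t \<Longrightarrow> \<omega> \<in> space P \<Longrightarrow> 0 < Z t \<omega>"
proof -
  assume "1 \<le> t" "\<omega> \<in> space P"
  moreover from this have "0 < 86 * (L (t - 1) \<omega>)\<^sup>2 * real CARD('k) ^ 6 * real t powr (3 / 2)
     + (\<Sum>s\<in>{0..t - 1}. (norm (Q s \<omega>))\<^sup>2)"
    using L_pos[of \<omega> "t - 1"] by (intro add_pos_nonneg mult_pos_pos sum_nonneg) auto
  ultimately show ?thesis using L_pos[of \<omega> "t - 1"] by (simp add: Z_def)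
qed

lemma Z_mono:
  assumes "\<omega> \<in> space P" "s \<le> t"
  shows "Z s \<omega> \<le> Z t \<omega>"
proof -
  have L: "L (s - 1) \<omega> \<le> L (t - 1) \<omega>" "0 < L (s - 1) \<omega>" using assms by (auto intro: L_mono L_pos)
  have "86 * (L (s - 1) \<omega>)\<^sup>2 * real CARD('k) ^ 6 \<le> 86 * (L (t - 1) \<omega>)\<^sup>2 * real CARD('k) ^ 6"
    using L by (intro mult_right_mono mult_left_mono power_mono) auto
  moreover have "real s powr (3 / 2) \<le> real t powr (3 / 2)" using assms by (intro powr_mono2) auto
  ultimately have "86 * (L (s - 1) \<omega>)\<^sup>2 * real CARD('k) ^ 6 * real s powr (3 / 2)
      \<le> 86 * (L (t - 1) \<omega>)\<^sup>2 * real CARD('k) ^ 6 * real t powr (3 / 2)"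
    by (rule mult_mono) auto
  moreover have "(\<Sum>r\<in>{0..s - 1}. (norm (Q r \<omega>))\<^sup>2) \<le> (\<Sum>r\<in>{0..t - 1}. (norm (Q r \<omega>))\<^sup>2)"
    using assms by (intro sum_mono2) auto
  ultimately have "sqrt (86 * (L (s - 1) \<omega>)\<^sup>2 * real CARD('k) ^ 6 * real s powr (3 / 2)
        + (\<Sum>r\<in>{0..s - 1}. (norm (Q r \<omega>))\<^sup>2))
      \<le> sqrt (86 * (L (t - 1) \<omega>)\<^sup>2 * real CARD('k) ^ 6 * real t powr (3 / 2)
        + (\<Sum>r\<in>{0..t - 1}. (norm (Q r \<omega>))\<^sup>2))"
    by (intro real_sqrt_le_mono add_mono)
  moreover have "0 \<le> sqrt (86 * (L (s - 1) \<omega>)\<^sup>2 * real CARD('k) ^ 6 * real s powr (3 / 2)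
        + (\<Sum>r\<in>{0..s - 1}. (norm (Q r \<omega>))\<^sup>2))"
    by (intro real_sqrt_ge_zero add_nonneg_nonneg mult_nonneg_nonneg sum_nonneg) simp_all
  ultimately show ?thesis
    unfolding Z_def using L by (intro mult_mono) linarith+
qed

lemma eta_eq: "\<eta> t \<omega> = real t powr \<kappa> / Z t \<omega>"
proof -
  have a: "real t powr (- (1 / 4 - \<delta> / 2)) = inverse (real t powr \<kappa>)"
    unfolding \<kappa>_def by (rule powr_minus)
  show ?thesis
    unfolding \<eta>_def softmw_\<eta>_def Z_def a inverse_mult_distrib inverse_inverse_eq
    by (simp only: divide_inverse[of "real t powr \<kappa>"] inverse_mult_distrib mult.assoc)
qed

lemma eta_pos: "1 \<le> t \<Longrightarrow> \<omega> \<in> space P \<Longrightarrow> 0 < \<eta> t \<omega>"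
  using Z_pos by (simp add: eta_eq)

lemma gamma_eq: "\<gamma> t \<omega> = M * real t powr (\<delta> / 4) * \<eta> t \<omega> * norm1 (Q (t - 1) \<omega>)"
  by (simp add: \<gamma>_def softmw_\<gamma>_def \<eta>_def)

text \<open>As \<delta>/4 + \<kappa> is at most 1/4, the upper bound reduces to
  \<open>4 * r * q\<^sup>2 \<le> R\<close> with \<open>r\<close> the square root of
  \<open>t\<close>. \<open>quadratic_le_cubic\<close> splits the left side: the cubic part is
  covered by the sum of squared queue norms, since queues of bounded slope cannot be large suddenly,
  and the other part by the deterministic summand of the learning rate. The constant 86 is 256/3
  rounded up.\<close>

lemma gamma_range:
  assumes "1 \<le> t" "\<omega> \<in> space P"
  shows "0 \<le> \<gamma> t \<omega>" "\<gamma> t \<omega> \<le> 1 / 2"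
proof -
  show "0 \<le> \<gamma> t \<omega>"
    using eta_pos[OF assms] M_pos by (simp add: gamma_eq norm1_nonneg)
  define l q r where "l = L (t - 1) \<omega>" and "q = norm1 (Q (t - 1) \<omega>)" and "r = sqrt (real t)"
  define R where "R = 86 * l\<^sup>2 * real CARD('k) ^ 6 * real t powr (3 / 2) + (\<Sum>s\<in>{0..t - 1}. (norm (Q s \<omega>))\<^sup>2)"
  have l: "0 < l" "M \<le> l" using L_pos L_ge assms by (auto simp: l_def)
  have q: "0 \<le> q" by (simp add: q_def norm1_nonneg)
  \<comment> \<open>One factor K is the slope of the 1-norm of the queues, the other comes from
    comparing the squared 1-norm with the squared Euclidean norm.\<close>
  define c where "c = real CARD('k) ^ 2 * l"
  have c: "0 < c" using l K_ge by (simp add: c_def)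
  have r3: "real t powr (3 / 2) = r ^ 3"
  proof -
    have "real t powr (3 / 2) = (real t powr (1 / 2)) powr 3" by (simp add: powr_powr)
    then show ?thesis by (simp add: r_def powr_half_sqrt powr_numeral)
  qed
  have "q ^ 3 \<le> 3 * (real CARD('k) * l) * (\<Sum>s\<le>t - 1. (norm1 (Q s \<omega>))\<^sup>2)"
    unfolding q_def l_def
    by (rule cube_le_sum_of_slope)
      (use assms l K_ge in \<open>auto simp: norm1_Q_0 norm1_nonneg l_def intro!: norm1_Q_slope\<close>)
  also have "\<dots> \<le> 3 * (real CARD('k) * l) * (\<Sum>s\<le>t - 1. real CARD('k) * (norm (Q s \<omega>))\<^sup>2)"
    using l by (intro mult_left_mono sum_mono norm1_sq_le) auto
  also have "\<dots> = 3 * c * (\<Sum>s\<le>t - 1. (norm (Q s \<omega>))\<^sup>2)"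
    by (simp add: sum_distrib_left[symmetric] c_def power2_eq_square mult_ac)
  finally have "q ^ 3 / (3 * c) \<le> (\<Sum>s\<in>{0..t - 1}. (norm (Q s \<omega>))\<^sup>2)"
    using c by (simp add: divide_le_eq mult.commute atMost_atLeast0)
  moreover have "256 / 3 * c\<^sup>2 * r ^ 3 \<le> 86 * l\<^sup>2 * real CARD('k) ^ 6 * r ^ 3"
  proof (intro mult_right_mono)
    have "real CARD('k) ^ 4 \<le> real CARD('k) ^ 6" using K_ge by (intro power_increasing) auto
    then have "l\<^sup>2 * real CARD('k) ^ 4 \<le> l\<^sup>2 * real CARD('k) ^ 6" by (intro mult_left_mono) auto
    moreover have "c\<^sup>2 = l\<^sup>2 * real CARD('k) ^ 4" by (simp add: c_def power_mult_distrib flip: power_mult)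
    moreover have "0 \<le> l\<^sup>2 * real CARD('k) ^ 6" by simp
    ultimately show "256 / 3 * c\<^sup>2 \<le> 86 * l\<^sup>2 * real CARD('k) ^ 6" by linarith
  qed (simp add: r_def)
  moreover have "4 * r * q\<^sup>2 \<le> q ^ 3 / (3 * c) + 256 / 3 * c\<^sup>2 * r ^ 3"
    by (rule quadratic_le_cubic) (use c q in \<open>auto simp: r_def\<close>)
  ultimately have R: "4 * r * q\<^sup>2 \<le> R" unfolding R_def r3 by linarith
  have "2 * real t powr (1 / 4) * q = sqrt (4 * r * q\<^sup>2)"
  proof -
    have "sqrt r = (real t powr (1 / 2)) powr (1 / 2)"
      by (simp add: r_def powr_half_sqrt)
    also have "\<dots> = real t powr (1 / 4)" by (simp add: powr_powr)
    finally show ?thesis using q by (simp add: real_sqrt_mult)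
  qed
  also have "\<dots> \<le> sqrt R" using R by simp
  finally have qR: "2 * real t powr (1 / 4) * q \<le> sqrt R" .
  have "2 * (M * real t powr (\<delta> / 4) * real t powr \<kappa> * q) \<le> l * (2 * real t powr (1 / 4) * q)"
  proof -
    have "real t powr (\<delta> / 4) * real t powr \<kappa> \<le> real t powr (1 / 4)"
      using assms delta by (simp add: powr_add[symmetric] \<kappa>_def powr_mono)
    then have "M * (real t powr (\<delta> / 4) * real t powr \<kappa>) * q \<le> l * real t powr (1 / 4) * q"
      using l q M_pos by (intro mult_right_mono mult_mono) auto
    then show ?thesis by (simp add: mult_ac)
  qed
  also have "\<dots> \<le> l * sqrt R" using qR l by (intro mult_left_mono) auto
  also have "\<dots> = Z t \<omega>" by (simp add: Z_def R_def l_def)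
  finally have "2 * (M * real t powr (\<delta> / 4) * real t powr \<kappa> * q) \<le> Z t \<omega>" .
  then show "\<gamma> t \<omega> \<le> 1 / 2"
    using Z_pos[OF assms] by (simp add: gamma_eq eta_eq q_def field_simps)
qed

lemma p_bounds:
  assumes "1 \<le> t" "\<omega> \<in> space P"
  shows "(1 - \<gamma> t \<omega>) * x t \<omega> $ i \<le> p t \<omega> $ i" "x t \<omega> $ i \<le> 2 * p t \<omega> $ i" "0 < p t \<omega> $ i"
    "M * real t powr (\<delta> / 4) * \<eta> t \<omega> * Q (t - 1) \<omega> $ i \<le> p t \<omega> $ i"
    "p t \<omega> $ i \<le> 1"
proof -
  note g = gamma_range[OF assms] and x0 = x_pos[OF assms, of i]
  have q: "0 \<le> M * real t powr (\<delta> / 4) * \<eta> t \<omega> * Q (t - 1) \<omega> $ i"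
    using M_pos eta_pos[OF assms] Q_nonneg[OF assms(2)] by simp
  have p: "p t \<omega> $ i = (1 - \<gamma> t \<omega>) * x t \<omega> $ i + M * real t powr (\<delta> / 4) * \<eta> t \<omega> * Q (t - 1) \<omega> $ i"
    by (simp add: p_alt[OF assms])
  have "1 / 2 * x t \<omega> $ i \<le> (1 - \<gamma> t \<omega>) * x t \<omega> $ i" using g x0 by (intro mult_right_mono) auto
  then show "(1 - \<gamma> t \<omega>) * x t \<omega> $ i \<le> p t \<omega> $ i" "x t \<omega> $ i \<le> 2 * p t \<omega> $ i" "0 < p t \<omega> $ i"
    "M * real t powr (\<delta> / 4) * \<eta> t \<omega> * Q (t - 1) \<omega> $ i \<le> p t \<omega> $ i"
    using p q x0 mult_nonneg_nonneg[of "1 - \<gamma> t \<omega>" "x t \<omega> $ i"] g by linarith+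
  have e: "e t \<omega> $ i \<le> 1"
    using e_simplex[OF assms] trunc_simplexD(4)[of "e t \<omega>" 0 i]
    by (auto simp: trunc_simplex_def prob_simplex_def)
  have "(1 - \<gamma> t \<omega>) * x t \<omega> $ i + \<gamma> t \<omega> * e t \<omega> $ i \<le> (1 - \<gamma> t \<omega>) * 1 + \<gamma> t \<omega> * 1"
    using g e trunc_simplexD(4)[OF x_trunc[OF assms]] by (intro add_mono mult_left_mono) auto
  then show "p t \<omega> $ i \<le> 1" by (simp add: p_eq[OF assms])
qed

lemma Sc_bounds:
  assumes "0 \<le> S t \<omega> $ i"
  shows "0 \<le> Sc t \<omega> $ i" "Sc t \<omega> $ i \<le> S t \<omega> $ i" "Sc t \<omega> $ i \<le> M * real t powr (\<delta> / 4)"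
  using assms M_pos by (auto simp: Sc_def clip_def)

text \<open>\<open>mirror_step_regret\<close> divided by \<open>\<eta> t \<omega>\<close>. Replacing
  \<open>x\<close> by \<open>p\<close> costs the factor \<open>1 + 2 * \<gamma> t \<omega>\<close>
  in the reward, because (1 - g)(1 + 2g) is at least 1 for g in [0, 1/2], and a factor 2 in the
  variance term.\<close>

lemma regret_step:
  assumes t: "1 \<le> t" and \<omega>: "\<omega> \<in> space P" and S0: "\<And>i. 0 \<le> S t \<omega> $ i"
    and y: "y \<in> trunc_simplex (\<beta> t)"
  defines "i \<equiv> a t \<omega>"
  shows "y $ i * (reward t \<omega> / p t \<omega> $ i)
    \<le> reward t \<omega> * (1 + 2 * \<gamma> t \<omega>) + 2 * \<eta> t \<omega> * ((reward t \<omega>)\<^sup>2 / p t \<omega> $ i)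
      + 1 / \<eta> t \<omega> * (kl y (x t \<omega>) - kl y (x (Suc t) \<omega>))"
proof -
  define v where "v = \<eta> t \<omega> * reward t \<omega> / p t \<omega> $ i"
  define G where "G = reward t \<omega> / p t \<omega> $ i"
  note pb = p_bounds[OF t \<omega>, of i] and e0 = eta_pos[OF t \<omega>] and g = gamma_range[OF t \<omega>]
  have r0: "0 \<le> reward t \<omega>"
    unfolding reward_def using Q_nonneg[OF \<omega>] Sc_bounds[OF S0] by simp
  \<comment> \<open>The clipping level times \<eta> times the queue length is exactly the
    exploration part of \<open>p\<close>. This gives \<open>v \<le> 1\<close>, which the quadratic
    bound on the exponential requires.\<close>
  have "\<eta> t \<omega> * reward t \<omega> \<le> \<eta> t \<omega> * (Q (t - 1) \<omega> $ i * (M * real t powr (\<delta> / 4)))"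
    unfolding reward_def i_def using Q_nonneg[OF \<omega>] Sc_bounds[OF S0] e0
    by (intro mult_left_mono) auto
  also have "\<dots> \<le> p t \<omega> $ i" using pb(4) by (simp add: mult_ac)
  finally have v: "0 \<le> v" "v \<le> 1" using pb(3) r0 e0 by (auto simp: v_def)
  have vG: "v = \<eta> t \<omega> * G" by (simp add: v_def G_def)
  have "v * (y $ i - x t \<omega> $ i) \<le> kl y (x t \<omega>) - kl y (x (Suc t) \<omega>) + x t \<omega> $ i * v\<^sup>2"
    by (rule mirror_step_regret[OF beta(1)[OF t] x_pos[OF t \<omega>] v _ y])
      (rule x_arg_min_entropic[OF t \<omega>, folded i_def, folded v_def])
  then have "\<eta> t \<omega> * (G * (y $ i - x t \<omega> $ i))
      \<le> \<eta> t \<omega> * (1 / \<eta> t \<omega> * (kl y (x t \<omega>) - kl y (x (Suc t) \<omega>)) + \<eta> t \<omega> * (x t \<omega> $ i * G\<^sup>2))"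
    using e0 by (simp add: vG algebra_simps power2_eq_square)
  then have "G * (y $ i - x t \<omega> $ i)
      \<le> 1 / \<eta> t \<omega> * (kl y (x t \<omega>) - kl y (x (Suc t) \<omega>)) + \<eta> t \<omega> * (x t \<omega> $ i * G\<^sup>2)"
    using e0 by (simp only: mult_le_cancel_left_pos)
  moreover have "\<eta> t \<omega> * (x t \<omega> $ i * G\<^sup>2) \<le> 2 * \<eta> t \<omega> * ((reward t \<omega>)\<^sup>2 / p t \<omega> $ i)"
  proof -
    have "x t \<omega> $ i * G\<^sup>2 \<le> 2 * p t \<omega> $ i * G\<^sup>2" using pb(2) by (intro mult_right_mono) auto
    also have "\<dots> = 2 * ((reward t \<omega>)\<^sup>2 / p t \<omega> $ i)"
      using pb(3) by (simp add: G_def power2_eq_square)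
    finally have "\<eta> t \<omega> * (x t \<omega> $ i * G\<^sup>2) \<le> \<eta> t \<omega> * (2 * ((reward t \<omega>)\<^sup>2 / p t \<omega> $ i))"
      using e0 by (intro mult_left_mono) auto
    then show ?thesis by (simp add: mult_ac)
  qed
  moreover have "G * x t \<omega> $ i \<le> reward t \<omega> * (1 + 2 * \<gamma> t \<omega>)"
  proof -
    have "x t \<omega> $ i * 1 \<le> x t \<omega> $ i * ((1 - \<gamma> t \<omega>) * (1 + 2 * \<gamma> t \<omega>))"
    proof (rule mult_left_mono)
      have "0 \<le> \<gamma> t \<omega> * (1 - 2 * \<gamma> t \<omega>)" using g by simp
      then show "1 \<le> (1 - \<gamma> t \<omega>) * (1 + 2 * \<gamma> t \<omega>)" by (simp add: algebra_simps)
    qed (use x_pos[OF t \<omega>, of i] in simp)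
    also have "\<dots> = ((1 - \<gamma> t \<omega>) * x t \<omega> $ i) * (1 + 2 * \<gamma> t \<omega>)" by (simp add: mult_ac)
    also have "\<dots> \<le> p t \<omega> $ i * (1 + 2 * \<gamma> t \<omega>)" using pb(1) g by (intro mult_right_mono) auto
    finally have "x t \<omega> $ i / p t \<omega> $ i \<le> 1 + 2 * \<gamma> t \<omega>" using pb(3) by (simp add: divide_le_eq mult.commute)
    then have "reward t \<omega> * (x t \<omega> $ i / p t \<omega> $ i) \<le> reward t \<omega> * (1 + 2 * \<gamma> t \<omega>)"
      using r0 by (intro mult_left_mono)
    then show ?thesis by (simp add: G_def)
  qed
  ultimately show ?thesis by (simp add: G_def[symmetric] right_diff_distrib mult.commute)
qed

section \<open>The past is independent of the future environment\<close>

lemma sets_env_mono: "J \<subseteq> J' \<Longrightarrow> sets (env J) \<subseteq> sets (env J')"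
  unfolding sets_env by (rule sigma_sets_mono') (auto simp: env_gen_def)

lemma action_event: "1 \<le> t \<Longrightarrow> {\<omega> \<in> space P. a t \<omega> = i} \<in> events"
  using measurable_sets[OF action_measurable[of t], of "{i}"]
  by (simp add: vimage_def Int_def conj_commute)

text \<open>The independence is a hypothesis because this lemma serves inside the induction of
  \<open>past_indep_future\<close>. The set \<open>B \<inter> C\<close> is an event of
  \<open>history_env\<close> although \<open>C\<close> lies in the future, so the action can be
  replaced by its probability first; only then is \<open>C\<close> split off by
  independence.\<close>

lemma prob_action:
  assumes indep: "indep_set (sets (past t)) (sets (env {t<..}))"
    and B: "B \<in> sets (past t)" and C: "C \<in> sets (env {t<..})"
  shows "prob (B \<inter> {\<omega> \<in> space P. a (Suc t) \<omega> = i} \<inter> C)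
    = (\<integral>\<omega>. indicator B \<omega> * p (Suc t) \<omega> $ i \<partial>P) * prob C"
proof -
  let ?E = "{\<omega> \<in> space P. a (Suc t) \<omega> = i}"
  have sub: "subalgebra P (env {t<..})" by (rule subalgebra_env) auto
  have BC: "B \<in> events" "C \<in> events" "?E \<in> events"
    using B C subalgebra_past[of t] sub action_event[of "Suc t"] by (auto simp: subalgebra_def)
  have pm: "p (Suc t) \<in> borel_measurable (past t)" using x_p_past_measurable[of "Suc t"] by simp
  have pP [measurable]: "p (Suc t) \<in> borel_measurable P" by (rule measurable_from_subalg[OF subalgebra_past pm])
  have p01: "0 \<le> p (Suc t) \<omega> $ i" "p (Suc t) \<omega> $ i \<le> 1" if "\<omega> \<in> space P" for \<omega>
    using p_bounds[of "Suc t" \<omega> i] that by auto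
  have BCH: "B \<inter> C \<in> sets (history_env P A S a Q t)"
  proof (rule sets.Int)
    show "C \<in> sets (history_env P A S a Q t)"
      using C env_sub_history_env[of "{t<..}" t] by fastforce
  qed (use B past_sub_history_env in blast)
  note [measurable] = BC
  have int: "integrable P (\<lambda>\<omega>. indicator B \<omega> * p (Suc t) \<omega> $ i)"
    using p01 by (intro integrable_const_bound[where B = 1] AE_I2) (auto simp: indicator_def)
  have intC: "integrable P (indicator C :: 'w \<Rightarrow> real)"
    using BC by (intro integrable_real_indicator) (auto simp: emeasure_eq_measure)
  have "emeasure P (B \<inter> ?E \<inter> C) = (\<integral>\<^sup>+\<omega>. indicator (B \<inter> ?E \<inter> C) \<omega> \<partial>P)"
    using BC by (intro nn_integral_indicator[symmetric] sets.Int)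
  also have "\<dots> = (\<integral>\<^sup>+\<omega>. indicator (B \<inter> C) \<omega> * indicator ?E \<omega> \<partial>P)"
    by (intro nn_integral_cong) (auto simp: indicator_def)
  also have "\<dots> = (\<integral>\<^sup>+\<omega>. indicator (B \<inter> C) \<omega> * ennreal (p (Suc t) \<omega> $ i) \<partial>P)"
    using action_law[of "Suc t" i] BCH BC
    by (intro nn_integral_cond_prob[OF subalgebra_history_env]) auto
  also have "\<dots> = (\<integral>\<^sup>+\<omega>. ennreal (indicator B \<omega> * p (Suc t) \<omega> $ i * indicator C \<omega>) \<partial>P)"
    by (intro nn_integral_cong) (auto simp: indicator_def)
  also have "\<dots> = ennreal (\<integral>\<omega>. indicator B \<omega> * p (Suc t) \<omega> $ i * indicator C \<omega> \<partial>P)"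
    using p01 by (intro nn_integral_eq_integral integrable_const_bound[where B = 1] AE_I2)
      (auto simp: indicator_def)
  finally have "prob (B \<inter> ?E \<inter> C) = (\<integral>\<omega>. indicator B \<omega> * p (Suc t) \<omega> $ i * indicator C \<omega> \<partial>P)"
    using p01 by (simp add: measure_def integral_nonneg_AE)
  also have "\<dots> = (\<integral>\<omega>. indicator B \<omega> * p (Suc t) \<omega> $ i \<partial>P) * (\<integral>\<omega>. indicator C \<omega> \<partial>P)"
    using B C pm int intC
    by (intro indep_set_integral(2)[OF subalgebra_past sub indep]) auto
  also have "(\<integral>\<omega>. indicator C \<omega> \<partial>P) = prob C" using BC by simp
  finally show ?thesis .
qed

text \<open>The next past is generated by the sets \<open>B \<inter> {a\<^sub>t\<^sub>+\<^sub>1 = i} \<inter> C\<close> with \<open>B\<close> in the current past and \<open>C\<close>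
  in the environment of slot \<open>t + 1\<close>; conditioning on \<open>a\<^sub>t\<^sub>+\<^sub>1\<close> replaces the middle factor by \<open>p\<^sub>t\<^sub>+\<^sub>1\<close>,
  which is a function of the past.\<close>

lemma past_indep_future: "indep_set (sets (past t)) (sets (env {t<..}))"
proof (induction t)
  case 0
  have "sets (past 0) = {{}, space P}"
    by (simp add: sets_past act_gen_def env_gen_def sigma_sets_empty_eq)
  moreover have "sets (env {0<..}) \<subseteq> events"
    using subalgebra_env[of "{0<..}"] by (force simp: subalgebra_def)
  moreover have "space P \<inter> D = D" if "D \<in> sets (env {0<..})" for D
    using sets.sets_into_space[OF that] by auto
  ultimately show ?case unfolding indep_sets2_eq by (simp add: prob_space)
next
  case (Suc t)
  define Ev where "Ev i = {\<omega> \<in> space P. a (Suc t) \<omega> = i}" for i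
  define PI where "PI = {B \<inter> Ev i \<inter> C |B i C. B \<in> sets (past t) \<and> C \<in> sets (env {Suc t})}"
  have subF: "subalgebra P (env {Suc t<..})" by (rule subalgebra_env) auto
  have sub1: "subalgebra P (env {Suc t})" by (rule subalgebra_env) auto
  have "PI \<subseteq> events"
  proof
    fix X assume "X \<in> PI"
    then obtain B i C where "X = B \<inter> Ev i \<inter> C" "B \<in> sets (past t)" "C \<in> sets (env {Suc t})"
      by (auto simp: PI_def)
    moreover from this have "B \<in> events" "C \<in> events"
      using subalgebra_past[of t] sub1 by (auto simp: subalgebra_def)
    ultimately show "X \<in> events" using action_event[of "Suc t" i] by (auto simp: Ev_def)
  qed
  have "indep_set PI (sets (env {Suc t<..}))"
  proof (rule indep_setI)
    fix X D assume "X \<in> PI" and D: "D \<in> sets (env {Suc t<..})"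
    then obtain B i C where X: "X = B \<inter> Ev i \<inter> C" and B: "B \<in> sets (past t)"
      and C: "C \<in> sets (env {Suc t})" by (auto simp: PI_def)
    have C': "C \<in> sets (env {t<..})" and D': "D \<in> sets (env {t<..})"
      using C D sets_env_mono[of "{Suc t}" "{t<..}"] sets_env_mono[of "{Suc t<..}" "{t<..}"] by auto
    then have "C \<inter> D \<in> sets (env {t<..})" by auto
    from prob_action[OF Suc B this, of i] prob_action[OF Suc B C', of i]
    have "prob (X \<inter> D) = (\<integral>\<omega>. indicator B \<omega> * p (Suc t) \<omega> $ i \<partial>P) * prob (C \<inter> D)"
      "prob X = (\<integral>\<omega>. indicator B \<omega> * p (Suc t) \<omega> $ i \<partial>P) * prob C"
      by (simp_all add: X Ev_def Int_assoc)
    moreover have "prob (C \<inter> D) = prob C * prob D"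
      by (rule indep_setD[OF indep_env C D]) auto
    ultimately show "prob (X \<inter> D) = prob X * prob D" by simp
  qed (use \<open>PI \<subseteq> events\<close> subF in \<open>auto simp: subalgebra_def\<close>)
  then have "indep_set (sigma_sets (space P) PI) (sigma_sets (space P) (sets (env {Suc t<..})))"
  proof (rule indep_set_sigma_sets)
    show "Int_stable PI"
    proof (rule Int_stableI)
      fix X Y assume "X \<in> PI" "Y \<in> PI"
      then obtain B i C B' i' C' where "X = B \<inter> Ev i \<inter> C" "Y = B' \<inter> Ev i' \<inter> C'"
        "B \<in> sets (past t)" "C \<in> sets (env {Suc t})" "B' \<in> sets (past t)" "C' \<in> sets (env {Suc t})"
        unfolding PI_def by blast
      \<comment> \<open>Two different actions in the same slot exclude each other; the empty
        intersection is a member of \<open>PI\<close> as well, with the empty set as its part of the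
        past.\<close>
      then have "X \<inter> Y = (if i = i' then B \<inter> B' else {}) \<inter> Ev i \<inter> (C \<inter> C')"
        "(if i = i' then B \<inter> B' else {}) \<in> sets (past t)" "C \<inter> C' \<in> sets (env {Suc t})"
        by (auto simp: Ev_def)
      then show "X \<inter> Y \<in> PI" unfolding PI_def by blast
    qed
  qed (rule sets.Int_stable)
  moreover have "sets (past (Suc t)) \<subseteq> sigma_sets (space P) PI"
  proof -
    define N where "N = sigma (space P) PI"
    have Pow: "PI \<subseteq> Pow (space P)" using \<open>PI \<subseteq> events\<close> sets.space_closed by blast
    have N: "sets N = sigma_sets (space P) PI" "space N = space P"
      using Pow by (auto simp: N_def space_measure_of_conv)
    have PIN: "B \<inter> Ev i \<inter> C \<in> sets N" if "B \<in> sets (past t)" "C \<in> sets (env {Suc t})" for B i C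
      unfolding N using that by (intro sigma_sets.Basic) (auto simp: PI_def)
    have BC: "B \<inter> C \<in> sets N" if "B \<in> sets (past t)" "C \<in> sets (env {Suc t})" for B C
    proof -
      have "B \<subseteq> space P" using sets.sets_into_space[OF that(1)] by simp
      \<comment> \<open>Uniting over the finitely many actions removes the middle factor.\<close>
      then have "B \<inter> C = (\<Union>i\<in>UNIV. B \<inter> Ev i \<inter> C)" by (auto simp: Ev_def)
      moreover have "(\<Union>i\<in>UNIV. B \<inter> Ev i \<inter> C) \<in> sets N"
        using PIN[OF that] by (intro sets.finite_UN) auto
      ultimately show ?thesis by simp
    qed
    have top: "space P \<in> sets (past t)" "space P \<in> sets (env {Suc t})"
      using sets.top[of "past t"] sets.top[of "env {Suc t}"] by auto
    have past: "sets (past t) \<subseteq> sets N"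
    proof
      fix B assume "B \<in> sets (past t)"
      moreover from this have "B \<inter> space P = B" using sets.sets_into_space by fastforce
      ultimately show "B \<in> sets N" using BC[of B "space P"] top(2) by simp
    qed
    have env1: "sets (env {Suc t}) \<subseteq> sets N"
    proof
      fix C assume "C \<in> sets (env {Suc t})"
      moreover from this have "space P \<inter> C = C" using sets.sets_into_space by fastforce
      ultimately show "C \<in> sets N" using BC[of "space P" C] top(1) by simp
    qed
    have "a (Suc t) \<in> measurable N (count_space UNIV)"
    proof (rule measurable_count_space_eq2[THEN iffD2], simp, intro conjI ballI)
      fix i
      have "a (Suc t) -` {i} \<inter> space N = space P \<inter> Ev i \<inter> space P" by (auto simp: Ev_def N)
      then show "a (Suc t) -` {i} \<inter> space N \<in> sets N" using PIN[OF top] by simp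
    qed simp
    then have act: "sets (vimage_algebra (space P) (a (Suc t)) (count_space UNIV)) \<subseteq> sets N"
      by (simp add: measurable_iff_sets N)
    have "act_gen {1..t} \<subseteq> sets (past t)" "env_gen {1..t} \<subseteq> sets (past t)"
      unfolding sets_past by (auto intro: sigma_sets.Basic)
    moreover have "env_gen {Suc t} \<subseteq> sets (env {Suc t})"
      unfolding sets_env by (auto intro: sigma_sets.Basic)
    moreover have "act_gen {1..Suc t} = act_gen {1..t} \<union> sets (vimage_algebra (space P) (a (Suc t)) (count_space UNIV))"
      "env_gen {1..Suc t} = env_gen {1..t} \<union> env_gen {Suc t}"
      by (simp_all add: act_gen_def env_gen_def atLeastAtMostSuc_conv Un_ac)
    ultimately have "act_gen {1..Suc t} \<union> env_gen {1..Suc t} \<subseteq> sets N"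
      using past env1 act by blast
    then have "sets (past (Suc t)) \<subseteq> sets N"
      unfolding past_def by (rule sets_sigma_subset) (simp add: N)
    then show ?thesis by (simp add: N)
  qed
  moreover have "sigma_sets (space P) (sets (env {Suc t<..})) = sets (env {Suc t<..})"
    using sets.sigma_sets_eq[of "env {Suc t<..}"] by simp
  ultimately show ?case unfolding indep_sets2_eq by blast
qed

end

section \<open>Young's inequality with exponents 3/4 and 1/4\<close>

lemma powr_quarter_power:
  fixes u :: real
  assumes "0 < k"
  shows "(u powr (1 / 4)) ^ k = u powr (real k / 4)"
proof (cases "u = 0")
  case False
  then have "(u powr (1 / 4)) ^ k = (u powr (1 / 4)) powr real k" by (simp add: powr_realpow)
  then show ?thesis by (simp add: powr_powr)
qed (use assms in simp)

lemma power4_powr_quarter: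
  fixes c :: real
  assumes "0 \<le> c"
  shows "(c ^ 4) powr (1 / 4) = c"
proof -
  have "(c ^ 4) powr (1 / 4) = (c powr 4) powr (1 / 4)"
    using assms by (cases "c = 0") simp_all
  also have "\<dots> = c powr (4 * (1 / 4))" by (rule powr_powr)
  finally show ?thesis using assms by simp
qed

text \<open>Written in fourth roots, \<open>a ^ 3 * b\<close> is bounded by one of the two summands
  alone, according to whether \<open>b \<le> \<rho> * a\<close>. The constants are not optimised;
  only the dependence on \<rho> matters.\<close>

lemma young_three_quarters:
  fixes u v \<rho> :: real
  assumes "0 \<le> u" "0 \<le> v" "0 < \<rho>"
  shows "u powr (3 / 4) * v powr (1 / 4) \<le> \<rho> * u + v / \<rho> ^ 3"
proof -
  define a b where "a = u powr (1 / 4)" and "b = v powr (1 / 4)"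
  have ab: "0 \<le> a" "0 \<le> b" by (auto simp: a_def b_def)
  have a3: "u powr (3 / 4) = a ^ 3" and a4: "u = a ^ 4" and b4: "v = b ^ 4"
    using assms by (simp_all add: a_def b_def powr_quarter_power)
  have "a ^ 3 * b \<le> \<rho> * a ^ 4 + b ^ 4 / \<rho> ^ 3"
  proof (cases "b \<le> \<rho> * a")
    case True
    have "a ^ 3 * b \<le> a ^ 3 * (\<rho> * a)" using True ab by (intro mult_left_mono) auto
    also have "\<dots> = \<rho> * a ^ 4" by (simp add: eval_nat_numeral)
    finally show ?thesis using ab assms by (smt (verit) divide_nonneg_pos zero_le_power zero_less_power)
  next
    case False
    then have "a \<le> b / \<rho>" using assms by (simp add: field_simps)
    then have "a ^ 3 * b \<le> (b / \<rho>) ^ 3 * b" using ab by (intro mult_right_mono power_mono) auto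
    also have "\<dots> = b ^ 4 / \<rho> ^ 3" by (simp add: power_divide eval_nat_numeral)
    finally show ?thesis using ab assms by (smt (verit) mult_nonneg_nonneg zero_le_power)
  qed
  then show ?thesis unfolding a3 b_def[symmetric] using a4 b4 by simp
qed

section \<open>The comparator sequence and the pathwise regret bound\<close>

locale softmw_reference = softmw_instance P \<A> \<S> A S a Q M \<delta> x p e L \<alpha>
  for P :: "'w measure"
    and \<A> \<S> :: "nat \<Rightarrow> (real ^ 'k) measure"
    and A S :: "nat \<Rightarrow> 'w \<Rightarrow> real ^ 'k"
    and a :: "nat \<Rightarrow> 'w \<Rightarrow> 'k"
    and Q :: "nat \<Rightarrow> 'w \<Rightarrow> real ^ 'k"
    and M \<delta> :: real
    and x p e :: "nat \<Rightarrow> 'w \<Rightarrow> real ^ 'k"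
    and L :: "nat \<Rightarrow> 'w \<Rightarrow> real"
    and \<alpha> :: real +
  fixes \<theta> :: "nat \<Rightarrow> real ^ 'k" and C\<^sub>V :: real
  assumes reference: "reference_stationary \<delta> C\<^sub>V \<theta>"
    and theta: "\<And>t. 1 \<le> t \<Longrightarrow> \<theta> t \<in> prob_simplex"
begin

lemma CV: "0 < C\<^sub>V" using reference by (simp add: reference_stationary_def)

lemma theta_bounds: "1 \<le> t \<Longrightarrow> 0 \<le> \<theta> t $ i" "1 \<le> t \<Longrightarrow> (\<Sum>i\<in>UNIV. \<theta> t $ i) = 1" "1 \<le> t \<Longrightarrow> \<theta> t $ i \<le> 1"
proof -
  assume "1 \<le> t"
  then have "\<theta> t \<in> trunc_simplex 0" using theta by (auto simp: trunc_simplex_def prob_simplex_def)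
  from trunc_simplexD(2-4)[OF this]
  show "0 \<le> \<theta> t $ i" "(\<Sum>i\<in>UNIV. \<theta> t $ i) = 1" "\<theta> t $ i \<le> 1" by auto
qed

text \<open>The reference policy is pushed into the truncated simplex of round \<open>t\<close>:
  mixing the uniform distribution in with weight \<open>t powr (-4)\<close> gives each coordinate at
  least \<open>\<beta> t\<close>.\<close>

definition y where
  "y t = (1 - real t powr (- 4)) *\<^sub>R \<theta> t + real t powr (- 4) *\<^sub>R (\<chi> i. 1 / real CARD('k))"

lemma y_trunc:
  assumes "1 \<le> t"
  shows "y t \<in> trunc_simplex (\<beta> t)"
proof -
  have "\<beta> t \<le> y t $ i" "0 \<le> y t $ i" for i
    using powr_neg4[OF assms] theta_bounds(1)[OF assms, of i]
    by (auto simp: y_def \<beta>_def softmw_\<beta>_def)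
  moreover have "(\<Sum>i\<in>UNIV. y t $ i) = 1"
    using theta_bounds(2)[OF assms] by (simp add: y_def sum.distrib sum_distrib_left[symmetric])
  ultimately show ?thesis by (simp add: trunc_simplex_def prob_simplex_def)
qed

lemma norm1_y_diff:
  assumes "1 \<le> t"
  shows "norm1 (y (t + 1) - y t)
    \<le> norm1 (\<theta> (t + 1) - \<theta> t) + 2 * (real t powr (- 4) - real (t + 1) powr (- 4))"
proof -
  define b c u where "b = real t powr (- 4)" and "c = real (t + 1) powr (- 4)"
    and "u = (\<chi> i. 1 / real CARD('k) :: real ^ 'k)"
  have bc: "c \<le> b" "0 \<le> c" "c \<le> 1" using assms powr_neg4[of "t + 1"] by (auto simp: b_def c_def powr_mono2')
  have "y (t + 1) - y t = (1 - c) *\<^sub>R (\<theta> (t + 1) - \<theta> t) + (b - c) *\<^sub>R (\<theta> t + (- 1) *\<^sub>R u)"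
    unfolding y_def b_def[symmetric] c_def[symmetric] u_def[symmetric] by (simp add: algebra_simps)
  then have "norm1 (y (t + 1) - y t)
      \<le> (1 - c) * norm1 (\<theta> (t + 1) - \<theta> t) + (b - c) * norm1 (\<theta> t + (- 1) *\<^sub>R u)"
    using norm1_triangle[of "(1 - c) *\<^sub>R (\<theta> (t + 1) - \<theta> t)" "(b - c) *\<^sub>R (\<theta> t + (- 1) *\<^sub>R u)"] bc
    by (simp only: norm1_scaleR abs_of_nonneg diff_ge_0_iff_ge)
  also have "\<dots> \<le> 1 * norm1 (\<theta> (t + 1) - \<theta> t) + (b - c) * 2"
  proof (intro add_mono mult_mono)
    have "norm1 (\<theta> t) = 1" "norm1 u = 1"
      using theta_bounds[OF assms] by (simp_all add: norm1_def u_def)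
    then show "norm1 (\<theta> t + (- 1) *\<^sub>R u) \<le> 2"
      using norm1_triangle[of "\<theta> t" "(- 1) *\<^sub>R u"] unfolding norm1_scaleR by simp
  qed (use bc in \<open>auto simp: norm1_nonneg\<close>)
  finally show ?thesis by (simp add: b_def c_def)
qed

text \<open>The weights are those that \<open>1 / \<eta>\<close> puts on the moves of the
  comparator. They turn the growth rate n powr (2 \<kappa>) of the reference path into n powr
  \<kappa>; the varying mixture with the uniform distribution adds a telescoping sum of at most
  2.\<close>

lemma comparator_path_length:
  assumes "1 \<le> n"
  shows "(\<Sum>t\<in>{1..<n}. real (t + 1) powr (- \<kappa>) * norm1 (y (t + 1) - y t)) \<le> 2 * C\<^sub>V * real n powr \<kappa> + 2"
proof -
  have w: "0 \<le> real (t + 1) powr (- \<kappa>)" "real (t + 1) powr (- \<kappa>) \<le> 1" for t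
    using powr_mono2'[of "- \<kappa>" 1 "real (t + 1)"] kappa by auto
  have "(\<Sum>t\<in>{1..<n}. real (t + 1) powr (- \<kappa>) * norm1 (y (t + 1) - y t))
     \<le> (\<Sum>t\<in>{1..<n}. real (t + 1) powr (- \<kappa>) * norm1 (\<theta> (t + 1) - \<theta> t)
          + 2 * (real t powr (- 4) - real (t + 1) powr (- 4)))"
  proof (intro sum_mono)
    fix t assume "t \<in> {1..<n}"
    then have t: "1 \<le> t" by simp
    have "real (t + 1) powr (- 4) \<le> real t powr (- 4)" using t by (intro powr_mono2') auto
    then have "real (t + 1) powr (- \<kappa>) * (2 * (real t powr (- 4) - real (t + 1) powr (- 4)))
        \<le> 1 * (2 * (real t powr (- 4) - real (t + 1) powr (- 4)))"
      using w(2)[of t] by (intro mult_right_mono) auto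
    moreover have "real (t + 1) powr (- \<kappa>) * norm1 (y (t + 1) - y t) \<le> real (t + 1) powr (- \<kappa>) *
        (norm1 (\<theta> (t + 1) - \<theta> t) + 2 * (real t powr (- 4) - real (t + 1) powr (- 4)))"
      using norm1_y_diff[OF t] w(1)[of t] by (intro mult_left_mono) auto
    ultimately show "real (t + 1) powr (- \<kappa>) * norm1 (y (t + 1) - y t)
      \<le> real (t + 1) powr (- \<kappa>) * norm1 (\<theta> (t + 1) - \<theta> t)
          + 2 * (real t powr (- 4) - real (t + 1) powr (- 4))"
      by (simp only: distrib_left)
  qed
  also have "\<dots> = (\<Sum>t\<in>{1..<n}. real (t + 1) powr (- \<kappa>) * norm1 (\<theta> (t + 1) - \<theta> t))
      + 2 * (\<Sum>t\<in>{1..<n}. real t powr (- 4) - real (t + 1) powr (- 4))"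
    by (simp only: sum.distrib sum_distrib_left)
  also have "(\<Sum>t\<in>{1..<n}. real t powr (- 4) - real (t + 1) powr (- 4)) \<le> 1"
  proof -
    have "(\<Sum>t\<in>{1..<n}. real t powr (- 4) - real (t + 1) powr (- 4)) = 1 - real n powr (- 4)"
      using assms by (induction n rule: dec_induct) simp_all
    then show ?thesis by simp
  qed
  also have "(\<Sum>t\<in>{1..<n}. real (t + 1) powr (- \<kappa>) * norm1 (\<theta> (t + 1) - \<theta> t)) \<le> 2 * C\<^sub>V * real n powr \<kappa>"
  proof (rule sum_weighted_increments)
    fix n :: nat assume "1 \<le> n"
    then show "(\<Sum>t\<in>{1..<n}. norm1 (\<theta> (t + 1) - \<theta> t)) \<le> C\<^sub>V * real n powr (2 * \<kappa>)"
      using reference by (simp add: reference_stationary_def \<kappa>_def)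
  qed (use kappa CV assms in \<open>auto simp: norm1_nonneg\<close>)
  finally show ?thesis by simp
qed

text \<open>\<open>1 / \<eta>\<close> need not be monotone, but its upward increments are bounded by
  those of \<open>Z\<close>, so \<open>weighted_telescope\<close> applies. All points up to round
  \<open>n\<close> lie in the truncated simplex of round \<open>n\<close>, so
  \<open>- ln (\<beta> n)\<close> bounds every divergence. The constant 3 is 1 for the telescoped
  part plus 2 from the comparator path.\<close>

lemma divergence_sum:
  assumes n: "1 \<le> n" and \<omega>: "\<omega> \<in> space P"
  shows "(\<Sum>t\<in>{1..n}. 1 / \<eta> t \<omega> * (kl (y t) (x t \<omega>) - kl (y t) (x (Suc t) \<omega>)))
    \<le> - ln (\<beta> n) * (3 + 2 * C\<^sub>V * real n powr \<kappa>) * Z n \<omega>"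
proof -
  define B where "B = - ln (\<beta> n)"
  have "1 / real CARD('k) \<le> 1" by simp
  then have bn: "0 < \<beta> n" "\<beta> n \<le> 1" using beta[OF n] by linarith+
  then have B: "0 \<le> B" by (simp add: B_def)
  have S: "x t \<omega> \<in> trunc_simplex (\<beta> n)" "x (Suc t) \<omega> \<in> trunc_simplex (\<beta> n)" "y t \<in> trunc_simplex (\<beta> n)"
    if "1 \<le> t" "t \<le> n" for t
    using trunc_simplex_antimono[OF beta_antimono[OF that]] that \<omega>
      x_trunc x_Suc_trunc y_trunc by blast+
  have h: "1 / \<eta> t \<omega> = real t powr (- \<kappa>) * Z t \<omega>" for t
    by (simp add: eta_eq powr_minus divide_inverse)
  have Zpos: "0 < Z t \<omega>" if "1 \<le> t" for t using Z_pos[OF that \<omega>] .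
  have w1: "real t powr (- \<kappa>) \<le> 1" if "1 \<le> t" for t
    using powr_mono2'[of "- \<kappa>" 1 "real t"] kappa that by auto
  have "(\<Sum>t\<in>{1..n}. 1 / \<eta> t \<omega> * (kl (y t) (x t \<omega>) - kl (y t) (x (Suc t) \<omega>)))
      \<le> B * Z n \<omega> + (\<Sum>t\<in>{1..<n}. 1 / \<eta> (Suc t) \<omega> * (norm1 (y (Suc t) - y t) * B))"
  proof (rule weighted_telescope[OF n])
    show "0 \<le> 1 / \<eta> t \<omega>" for t
      using eta_pos[of t \<omega>] \<omega> by (cases "t = 0") (simp_all add: eta_eq[of 0] less_imp_le)
    show "1 / \<eta> (Suc t) \<omega> - 1 / \<eta> t \<omega> \<le> Z (Suc t) \<omega> - Z t \<omega>" if "1 \<le> t" for t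
    proof -
      have "real (Suc t) powr (- \<kappa>) \<le> real t powr (- \<kappa>)"
        using that kappa by (intro powr_mono2') auto
      then have "real (Suc t) powr (- \<kappa>) * Z t \<omega> \<le> real t powr (- \<kappa>) * Z t \<omega>"
        using Zpos[OF that] by (intro mult_right_mono) auto
      moreover have "real (Suc t) powr (- \<kappa>) * (Z (Suc t) \<omega> - Z t \<omega>) \<le> 1 * (Z (Suc t) \<omega> - Z t \<omega>)"
        using w1[of "Suc t"] Z_mono[OF \<omega>, of t "Suc t"] by (intro mult_right_mono) auto
      ultimately show ?thesis unfolding h right_diff_distrib by linarith
    qed
    show "1 / \<eta> 1 \<omega> \<le> Z 1 \<omega>" by (simp add: h)
    show "Z t \<omega> \<le> Z (Suc t) \<omega>" if "1 \<le> t" for t by (rule Z_mono[OF \<omega>]) simp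
    show "0 \<le> kl (y t) (x (Suc t) \<omega>) \<and> kl (y t) (x (Suc t) \<omega>) \<le> B" if "1 \<le> t" "t \<le> n" for t
      using kl_le_ln[OF S(3)[OF that] S(2)[OF that] bn(1)] trunc_simplexD(2)[OF S(3)[OF that]]
        x_pos[of "Suc t" \<omega>] \<omega> by (auto simp: B_def intro!: kl_nonneg)
    show "kl (y 1) (x 1 \<omega>) \<le> B"
      using kl_le_ln[OF S(3) S(1) bn(1), of 1 1] n by (simp add: B_def)
    show "kl (y (Suc t)) (x (Suc t) \<omega>) \<le> kl (y t) (x (Suc t) \<omega>) + norm1 (y (Suc t) - y t) * B"
      if "1 \<le> t" "t < n" for t
      unfolding B_def using that
      by (intro kl_change_comparator[OF _ _ _ bn(1)] S) auto
  qed
  also have "(\<Sum>t\<in>{1..<n}. 1 / \<eta> (Suc t) \<omega> * (norm1 (y (Suc t) - y t) * B))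
      \<le> (\<Sum>t\<in>{1..<n}. (real (t + 1) powr (- \<kappa>) * norm1 (y (t + 1) - y t)) * (B * Z n \<omega>))"
  proof (intro sum_mono)
    fix t assume "t \<in> {1..<n}"
    then have "Z (Suc t) \<omega> \<le> Z n \<omega>" by (intro Z_mono[OF \<omega>]) auto
    then have "(real (Suc t) powr (- \<kappa>) * norm1 (y (Suc t) - y t) * B) * Z (Suc t) \<omega>
        \<le> (real (Suc t) powr (- \<kappa>) * norm1 (y (Suc t) - y t) * B) * Z n \<omega>"
      using B by (intro mult_left_mono) (auto simp: norm1_nonneg)
    then show "1 / \<eta> (Suc t) \<omega> * (norm1 (y (Suc t) - y t) * B)
        \<le> (real (t + 1) powr (- \<kappa>) * norm1 (y (t + 1) - y t)) * (B * Z n \<omega>)"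
      unfolding h by (simp add: mult_ac)
  qed
  also have "\<dots> = (\<Sum>t\<in>{1..<n}. real (t + 1) powr (- \<kappa>) * norm1 (y (t + 1) - y t)) * (B * Z n \<omega>)"
    by (simp only: sum_distrib_right)
  also have "\<dots> \<le> (2 * C\<^sub>V * real n powr \<kappa> + 2) * (B * Z n \<omega>)"
    using comparator_path_length[OF n] B Zpos[OF n] by (intro mult_right_mono) auto
  finally show ?thesis by (simp add: B_def[symmetric] algebra_simps)
qed

lemma regret_sum:
  assumes n: "1 \<le> n" and \<omega>: "\<omega> \<in> space P" and S0: "\<And>t i. 1 \<le> t \<Longrightarrow> 0 \<le> S t \<omega> $ i"
  shows "(\<Sum>t\<in>{1..n}. y t $ a t \<omega> * (reward t \<omega> / p t \<omega> $ a t \<omega>))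
    \<le> (\<Sum>t\<in>{1..n}. reward t \<omega>) + (\<Sum>t\<in>{1..n}. 2 * \<gamma> t \<omega> * reward t \<omega>)
      + (\<Sum>t\<in>{1..n}. 2 * \<eta> t \<omega> * ((reward t \<omega>)\<^sup>2 / p t \<omega> $ a t \<omega>))
      + - ln (\<beta> n) * (3 + 2 * C\<^sub>V * real n powr \<kappa>) * Z n \<omega>"
proof -
  have "(\<Sum>t\<in>{1..n}. y t $ a t \<omega> * (reward t \<omega> / p t \<omega> $ a t \<omega>))
    \<le> (\<Sum>t\<in>{1..n}. reward t \<omega> * (1 + 2 * \<gamma> t \<omega>) + 2 * \<eta> t \<omega> * ((reward t \<omega>)\<^sup>2 / p t \<omega> $ a t \<omega>)
      + 1 / \<eta> t \<omega> * (kl (y t) (x t \<omega>) - kl (y t) (x (Suc t) \<omega>)))"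
    by (intro sum_mono regret_step \<omega> y_trunc S0) auto
  also have "\<dots> = (\<Sum>t\<in>{1..n}. reward t \<omega>) + (\<Sum>t\<in>{1..n}. 2 * \<gamma> t \<omega> * reward t \<omega>)
      + (\<Sum>t\<in>{1..n}. 2 * \<eta> t \<omega> * ((reward t \<omega>)\<^sup>2 / p t \<omega> $ a t \<omega>))
      + (\<Sum>t\<in>{1..n}. 1 / \<eta> t \<omega> * (kl (y t) (x t \<omega>) - kl (y t) (x (Suc t) \<omega>)))"
    unfolding sum.distrib[symmetric] by (intro sum.cong) (auto simp: distrib_left mult_ac)
  finally show ?thesis using divergence_sum[OF n \<omega>] by linarith
qed

end

section \<open>Pathwise drift and the size of the learning-rate terms\<close>

context softmw_instance
begin

text \<open>The queues evolve with the true services while the reward uses clipped ones; clipping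
  only lowers the reward, so the quadratic drift still dominates it.\<close>

lemma reward_drift:
  assumes \<omega>: "\<omega> \<in> space P" and S0: "\<And>t i. 1 \<le> t \<Longrightarrow> 0 \<le> S t \<omega> $ i"
    and A0: "\<And>t i. 1 \<le> t \<Longrightarrow> 0 \<le> A t \<omega> $ i"
  shows "(\<Sum>t\<in>{1..n}. reward t \<omega>) \<le> (\<Sum>t\<in>{1..n}. \<Sum>i\<in>UNIV. Q (t - 1) \<omega> $ i * A t \<omega> $ i)
    + 1 / 2 * (\<Sum>t\<in>{1..n}. \<Sum>i\<in>UNIV. (A t \<omega> $ i)\<^sup>2 + (S t \<omega> $ i)\<^sup>2)"
proof -
  have step: "2 * reward t \<omega> + (norm (Q t \<omega>))\<^sup>2 \<le> (norm (Q (t - 1) \<omega>))\<^sup>2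
      + 2 * (\<Sum>i\<in>UNIV. Q (t - 1) \<omega> $ i * A t \<omega> $ i) + (\<Sum>i\<in>UNIV. (A t \<omega> $ i)\<^sup>2 + (S t \<omega> $ i)\<^sup>2)"
    if t: "1 \<le> t" for t
  proof -
    have coord: "(Q t \<omega> $ i)\<^sup>2 \<le> (Q (t - 1) \<omega> $ i)\<^sup>2 + 2 * (Q (t - 1) \<omega> $ i * A t \<omega> $ i)
        + ((A t \<omega> $ i)\<^sup>2 + (S t \<omega> $ i)\<^sup>2) - 2 * (if i = a t \<omega> then Q (t - 1) \<omega> $ i * S t \<omega> $ i else 0)" for i
    proof -
      define q u s where "q = Q (t - 1) \<omega> $ i" and "u = A t \<omega> $ i"
        and "s = S t \<omega> $ i * (if i = a t \<omega> then 1 else 0)"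
      have "0 \<le> u" "0 \<le> s" using A0 S0 t by (auto simp: u_def s_def)
      then have us: "0 \<le> u * s" by simp
      have "(max (q + u - s) 0)\<^sup>2 \<le> (q + u - s)\<^sup>2" by (cases "q + u - s \<le> 0") auto
      also have "\<dots> = q\<^sup>2 + 2 * (q * u) + (u\<^sup>2 + s\<^sup>2) - 2 * (q * s) - 2 * (u * s)"
        by (simp add: power2_eq_square algebra_simps)
      finally have "(Q t \<omega> $ i)\<^sup>2 \<le> q\<^sup>2 + 2 * (q * u) + (u\<^sup>2 + s\<^sup>2) - 2 * (q * s)"
        using us queue_step[OF t \<omega>] by (simp add: q_def u_def s_def)
      moreover have "s\<^sup>2 \<le> (S t \<omega> $ i)\<^sup>2" by (simp add: s_def)
      moreover have "q * s = (if i = a t \<omega> then q * S t \<omega> $ i else 0)" by (simp add: s_def)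
      ultimately show ?thesis unfolding q_def u_def by linarith
    qed
    have "reward t \<omega> \<le> Q (t - 1) \<omega> $ a t \<omega> * S t \<omega> $ a t \<omega>"
      unfolding reward_def using Q_nonneg[OF \<omega>] Sc_bounds[OF S0[OF t]] by (intro mult_left_mono) auto
    moreover have "(norm (Q t \<omega>))\<^sup>2 \<le> (\<Sum>i\<in>UNIV. (Q (t - 1) \<omega> $ i)\<^sup>2 + 2 * (Q (t - 1) \<omega> $ i * A t \<omega> $ i)
        + ((A t \<omega> $ i)\<^sup>2 + (S t \<omega> $ i)\<^sup>2) - 2 * (if i = a t \<omega> then Q (t - 1) \<omega> $ i * S t \<omega> $ i else 0))"
      unfolding norm_sq_vec by (intro sum_mono coord)
    moreover have "(\<Sum>i\<in>UNIV. (Q (t - 1) \<omega> $ i)\<^sup>2 + 2 * (Q (t - 1) \<omega> $ i * A t \<omega> $ i)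
        + ((A t \<omega> $ i)\<^sup>2 + (S t \<omega> $ i)\<^sup>2) - 2 * (if i = a t \<omega> then Q (t - 1) \<omega> $ i * S t \<omega> $ i else 0))
      = (norm (Q (t - 1) \<omega>))\<^sup>2 + 2 * (\<Sum>i\<in>UNIV. Q (t - 1) \<omega> $ i * A t \<omega> $ i)
        + (\<Sum>i\<in>UNIV. (A t \<omega> $ i)\<^sup>2 + (S t \<omega> $ i)\<^sup>2) - 2 * (Q (t - 1) \<omega> $ a t \<omega> * S t \<omega> $ a t \<omega>)"
      by (simp only: norm_sq_vec sum.distrib sum_subtractf sum_distrib_left[symmetric] sum.delta finite UNIV_I if_True)
    ultimately show ?thesis by linarith
  qed
  have "2 * (\<Sum>t\<in>{1..n}. reward t \<omega>) + (norm (Q n \<omega>))\<^sup>2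
      \<le> 2 * (\<Sum>t\<in>{1..n}. \<Sum>i\<in>UNIV. Q (t - 1) \<omega> $ i * A t \<omega> $ i)
    + (\<Sum>t\<in>{1..n}. \<Sum>i\<in>UNIV. (A t \<omega> $ i)\<^sup>2 + (S t \<omega> $ i)\<^sup>2)"
  proof (induction n)
    case (Suc n)
    then show ?case using step[of "Suc n"] by simp
  qed (simp add: queue_0[OF \<omega>])
  moreover have "0 \<le> (norm (Q n \<omega>))\<^sup>2" by simp
  ultimately show ?thesis by linarith
qed

definition X where "X n \<omega> = (\<Sum>s<n. norm1 (Q s \<omega>))"

definition U where "U n \<omega> = sqrt (\<Sum>s<n. (norm (Q s \<omega>))\<^sup>2)"

lemma X_nonneg: "0 \<le> X n \<omega>" by (simp add: X_def sum_nonneg norm1_nonneg)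

lemma U_nonneg: "0 \<le> U n \<omega>" by (simp add: U_def sum_nonneg)

text \<open>By \<open>square_le_sum_of_slope\<close> every single queue norm is at most the square
  root of \<open>2 * l * X n \<omega>\<close>; the sum of squares is at most this bound times
  \<open>X n \<omega>\<close>.\<close>

lemma U_le:
  assumes \<omega>: "\<omega> \<in> space P"
  shows "U n \<omega> \<le> X n \<omega> powr (3 / 4) * (2 * real CARD('k) * L n \<omega>) powr (1 / 4)"
proof -
  define l where "l = real CARD('k) * L n \<omega>"
  have l: "0 \<le> l" using L_pos[OF \<omega>, of n] by (simp add: l_def)
  have q: "norm1 (Q s \<omega>) \<le> sqrt (2 * l * X n \<omega>)" if "s < n" for s
  proof -
    have "(norm1 (Q s \<omega>))\<^sup>2 \<le> 2 * l * (\<Sum>r\<le>s. norm1 (Q r \<omega>))"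
    proof (rule square_le_sum_of_slope)
      fix r assume "r < s"
      then show "\<bar>norm1 (Q (Suc r) \<omega>) - norm1 (Q r \<omega>)\<bar> \<le> l"
        unfolding l_def using that by (intro norm1_Q_slope[OF \<omega>]) simp
    qed (use l \<omega> in \<open>auto simp: norm1_Q_0 norm1_nonneg\<close>)
    also have "\<dots> \<le> 2 * l * X n \<omega>"
      unfolding X_def using that l by (intro mult_left_mono sum_mono2) (auto simp: norm1_nonneg)
    finally show ?thesis by (rule real_le_rsqrt)
  qed
  have "(\<Sum>s<n. (norm (Q s \<omega>))\<^sup>2) \<le> (\<Sum>s<n. norm1 (Q s \<omega>) * sqrt (2 * l * X n \<omega>))"
  proof (intro sum_mono)
    fix s assume "s \<in> {..<n}"
    then have "norm1 (Q s \<omega>) * norm1 (Q s \<omega>) \<le> norm1 (Q s \<omega>) * sqrt (2 * l * X n \<omega>)"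
      by (intro mult_left_mono q) (auto simp: norm1_nonneg)
    then show "(norm (Q s \<omega>))\<^sup>2 \<le> norm1 (Q s \<omega>) * sqrt (2 * l * X n \<omega>)"
      using norm_sq_le_norm1[of "Q s \<omega>"] by (simp add: power2_eq_square)
  qed
  also have "\<dots> = X n \<omega> * sqrt (2 * l * X n \<omega>)" by (simp add: X_def sum_distrib_right)
  finally have "U n \<omega> \<le> sqrt (X n \<omega> * sqrt (2 * l * X n \<omega>))" unfolding U_def by simp
  also have "\<dots> = X n \<omega> powr (3 / 4) * (2 * l) powr (1 / 4)"
  proof -
    have "X n \<omega> = X n \<omega> powr (1 / 2) * X n \<omega> powr (1 / 2)"
      using X_nonneg[of n \<omega>] by (simp add: powr_add[symmetric])
    moreover have "sqrt (X n \<omega> * sqrt (2 * l * X n \<omega>))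
        = X n \<omega> powr (1 / 2) * ((2 * l) powr (1 / 4) * X n \<omega> powr (1 / 4))"
      using l X_nonneg[of n \<omega>] by (simp add: powr_half_sqrt[symmetric] powr_mult powr_powr)
    ultimately show ?thesis by (simp add: powr_add[symmetric] mult_ac)
  qed
  finally show ?thesis by (simp add: l_def mult.assoc)
qed

lemma Z_le:
  assumes \<omega>: "\<omega> \<in> space P" and n: "1 \<le> n"
  shows "Z n \<omega> \<le> 10 * real CARD('k) ^ 3 * real n powr (3 / 4) * (L n \<omega>)\<^sup>2 + L n \<omega> * U n \<omega>"
proof -
  define l where "l = L (n - 1) \<omega>"
  have l: "0 < l" "l \<le> L n \<omega>" using L_pos[OF \<omega>] L_mono[OF \<omega>] by (auto simp: l_def)
  have set: "{0..n - 1} = {..<n}" using n by auto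
  have "Z n \<omega> = l * sqrt (86 * l\<^sup>2 * real CARD('k) ^ 6 * real n powr (3 / 2) + (\<Sum>s<n. (norm (Q s \<omega>))\<^sup>2))"
    unfolding Z_def set l_def ..
  also have "\<dots> \<le> l * (sqrt (86 * l\<^sup>2 * real CARD('k) ^ 6 * real n powr (3 / 2)) + U n \<omega>)"
    unfolding U_def using l by (intro mult_left_mono sqrt_add_le_add_sqrt sum_nonneg) auto
  also have "sqrt (86 * l\<^sup>2 * real CARD('k) ^ 6 * real n powr (3 / 2))
      = sqrt 86 * l * real CARD('k) ^ 3 * real n powr (3 / 4)"
  proof -
    have "sqrt (real n powr (3 / 2)) = real n powr (3 / 4)"
      using n by (simp add: powr_half_sqrt[symmetric] powr_powr)
    moreover have "sqrt (real CARD('k) ^ 6) = real CARD('k) ^ 3"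
      by (rule real_sqrt_unique) (simp_all flip: power_mult)
    ultimately show ?thesis using l by (simp add: real_sqrt_mult)
  qed
  also have "l * (sqrt 86 * l * real CARD('k) ^ 3 * real n powr (3 / 4) + U n \<omega>)
      \<le> L n \<omega> * (10 * L n \<omega> * real CARD('k) ^ 3 * real n powr (3 / 4) + U n \<omega>)"
  proof (intro mult_mono add_mono mult_right_mono)
    show "sqrt 86 \<le> 10" by (rule real_le_lsqrt) auto
  qed (use l U_nonneg in \<open>auto intro!: add_nonneg_nonneg mult_nonneg_nonneg\<close>)
  finally show ?thesis by (simp add: algebra_simps power2_eq_square)
qed

text \<open>\<open>Z (Suc t)\<close> sums the squared norms up to and including slot
  \<open>t\<close>, so each term is normalised by a partial sum that contains it, as
  \<open>sum_div_sqrt_partial_sums\<close> needs. The factor \<open>L\<close> in \<open>Z\<close> is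
  replaced by its lower bound \<open>M\<close>.\<close>

lemma eta_sum:
  assumes \<omega>: "\<omega> \<in> space P"
  shows "(\<Sum>t\<in>{1..n}. \<eta> t \<omega> * (norm (Q (t - 1) \<omega>))\<^sup>2) \<le> 2 * real n powr \<kappa> / M * U n \<omega>"
proof -
  define q where "q s = (norm (Q s \<omega>))\<^sup>2" for s
  have "(\<Sum>t\<in>{1..n}. \<eta> t \<omega> * (norm (Q (t - 1) \<omega>))\<^sup>2) = (\<Sum>t<n. \<eta> (Suc t) \<omega> * q t)"
    by (rule sum.reindex_bij_witness[of _ Suc "\<lambda>t. t - 1"]) (auto simp: q_def)
  also have "\<dots> \<le> (\<Sum>t<n. real n powr \<kappa> / M * (q t / sqrt (\<Sum>s\<le>t. q s)))"
  proof (intro sum_mono)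
    fix t assume "t \<in> {..<n}"
    define w where "w = sqrt (\<Sum>s\<le>t. q s)"
    have qw: "q t \<le> (\<Sum>s\<le>t. q s)" by (rule member_le_sum) (auto simp: q_def)
    show "\<eta> (Suc t) \<omega> * q t \<le> real n powr \<kappa> / M * (q t / sqrt (\<Sum>s\<le>t. q s))"
    proof (cases "w = 0")
      case True
      then have "q t = 0" using qw by (simp add: w_def q_def)
      then show ?thesis by simp
    next
      case False
      then have w: "0 < w" by (simp add: w_def q_def sum_nonneg less_le)
      have "M * w \<le> Z (Suc t) \<omega>"
        unfolding Z_def w_def q_def atMost_atLeast0 diff_Suc_1 using L_ge[OF \<omega>, of t] L_pos[OF \<omega>, of t] M_pos
        by (intro mult_mono real_sqrt_le_mono) (auto intro!: sum_nonneg)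
      then have "real (Suc t) powr \<kappa> / Z (Suc t) \<omega> \<le> real n powr \<kappa> / (M * w)"
        using \<open>t \<in> {..<n}\<close> w M_pos kappa by (intro frac_le powr_mono2) auto
      then have "real (Suc t) powr \<kappa> / Z (Suc t) \<omega> * q t \<le> real n powr \<kappa> / (M * w) * q t"
        by (intro mult_right_mono) (auto simp: q_def)
      then show ?thesis unfolding eta_eq w_def[symmetric] by simp
    qed
  qed
  also have "\<dots> = real n powr \<kappa> / M * (\<Sum>t<n. q t / sqrt (\<Sum>s\<le>t. q s))"
    by (simp only: sum_distrib_left)
  also have "\<dots> \<le> real n powr \<kappa> / M * (2 * sqrt (\<Sum>t<n. q t))"
    using M_pos by (intro mult_left_mono sum_div_sqrt_partial_sums) (auto simp: q_def)
  finally show ?thesis by (simp add: U_def q_def mult_ac)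
qed

text \<open>The factor \<open>c\<close> may depend on the path: \<open>divergence_bound\<close>
  takes it proportional to \<open>L n \<omega>\<close>, and its fourth power times the remaining
  \<open>L n \<omega>\<close> is the origin of the fifth power.\<close>

lemma scaled_U_le:
  assumes \<omega>: "\<omega> \<in> space P" and "0 \<le> c" "0 < \<rho>"
  shows "c * U n \<omega> \<le> \<rho> * X n \<omega> + 2 * real CARD('k) * c ^ 4 * L n \<omega> / \<rho> ^ 3"
proof -
  have "c * U n \<omega> \<le> c * (X n \<omega> powr (3 / 4) * (2 * real CARD('k) * L n \<omega>) powr (1 / 4))"
    using assms by (intro mult_left_mono U_le)
  also have "c = (c ^ 4) powr (1 / 4)"
    using assms by (simp only: power4_powr_quarter)
  also have "\<dots> * (X n \<omega> powr (3 / 4) * (2 * real CARD('k) * L n \<omega>) powr (1 / 4))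
      = X n \<omega> powr (3 / 4) * (c ^ 4 * (2 * real CARD('k) * L n \<omega>)) powr (1 / 4)"
    using L_pos[OF \<omega>, of n] by (simp add: powr_mult mult_ac)
  also have "\<dots> \<le> \<rho> * X n \<omega> + (c ^ 4 * (2 * real CARD('k) * L n \<omega>)) / \<rho> ^ 3"
    using L_pos[OF \<omega>, of n] assms by (intro young_three_quarters X_nonneg) auto
  finally show ?thesis using power4_powr_quarter[OF assms(2)] by (simp add: mult_ac)
qed

end

section \<open>Moments\<close>

lemma (in prob_space) nn_integral_le_of_nn_cond_exp_le:
  assumes sub: "subalgebra M F" and f: "f \<in> borel_measurable M"
    and le: "AE \<omega> in M. nn_cond_exp M F f \<omega> \<le> c"
  shows "(\<integral>\<^sup>+\<omega>. f \<omega> \<partial>M) \<le> c"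
proof -
  interpret finite_measure_subalgebra M F by unfold_locales (rule sub)
  have "(\<integral>\<^sup>+\<omega>. f \<omega> \<partial>M) = (\<integral>\<^sup>+\<omega>. 1 * f \<omega> \<partial>M)" by simp
  also have "\<dots> = (\<integral>\<^sup>+\<omega>. 1 * nn_cond_exp M F f \<omega> \<partial>M)"
    using f by (intro nn_cond_exp_intg[symmetric]) auto
  also have "\<dots> \<le> (\<integral>\<^sup>+\<omega>. c \<partial>M)" using le by (intro nn_integral_mono_AE) auto
  also have "\<dots> = c" by (simp add: emeasure_space_1)
  finally show ?thesis .
qed

lemma power_le_powr_mean:
  fixes u :: real
  assumes "0 \<le> u" "0 < m" "real m \<le> \<alpha>"
  shows "u ^ m \<le> real m / \<alpha> * u powr \<alpha> + (1 - real m / \<alpha>)"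
proof (cases "u = 0")
  case True
  then show ?thesis using assms by (simp add: zero_power)
next
  case False
  then have "(u powr \<alpha>) powr (real m / \<alpha>) * 1 powr (1 - real m / \<alpha>)
      \<le> real m / \<alpha> * u powr \<alpha> + (1 - real m / \<alpha>) * 1"
    using assms by (intro Youngs_inequality_0) auto
  moreover have "(u powr \<alpha>) powr (real m / \<alpha>) = u ^ m"
    using assms False by (simp add: powr_powr powr_realpow)
  ultimately show ?thesis by simp
qed

text \<open>The weighted arithmetic-geometric mean inequality for \<open>f / c\<close> bounds the
  lower power by an affine function of the power \<alpha>. The bound holds almost everywhere, hence
  gives integrability and the moment estimate at once.\<close>

lemma (in prob_space) lower_moments:
  fixes f :: "'a \<Rightarrow> real"
  assumes f: "f \<in> borel_measurable M" "AE \<omega> in M. 0 \<le> f \<omega>" and "0 < c"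
    and mom: "(\<integral>\<^sup>+\<omega>. ennreal (f \<omega> powr \<alpha>) \<partial>M) \<le> ennreal (c powr \<alpha>)"
    and m: "0 < m" "real m \<le> \<alpha>"
  shows "integrable M (\<lambda>\<omega>. f \<omega> powr \<alpha>)" "(\<integral>\<omega>. f \<omega> powr \<alpha> \<partial>M) \<le> c powr \<alpha>"
    "integrable M (\<lambda>\<omega>. f \<omega> ^ m)" "(\<integral>\<omega>. f \<omega> ^ m \<partial>M) \<le> c ^ m"
proof -
  note [measurable] = f(1)
  show int: "integrable M (\<lambda>\<omega>. f \<omega> powr \<alpha>)"
    using mom by (intro integrableI_nonneg) (auto intro: le_less_trans)
  have "ennreal (\<integral>\<omega>. f \<omega> powr \<alpha> \<partial>M) \<le> ennreal (c powr \<alpha>)"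
    using mom by (subst nn_integral_eq_integral[symmetric, OF int]) auto
  then show le: "(\<integral>\<omega>. f \<omega> powr \<alpha> \<partial>M) \<le> c powr \<alpha>" by (simp add: ennreal_le_iff)
  define g where "g \<omega> = c ^ m * (real m / \<alpha> * (f \<omega> powr \<alpha> / c powr \<alpha>) + (1 - real m / \<alpha>))" for \<omega>
  have fg: "AE \<omega> in M. f \<omega> ^ m \<le> g \<omega>"
    using f(2)
  proof eventually_elim
    case (elim \<omega>)
    have "(f \<omega> / c) ^ m \<le> real m / \<alpha> * (f \<omega> / c) powr \<alpha> + (1 - real m / \<alpha>)"
      using elim \<open>0 < c\<close> m by (intro power_le_powr_mean) auto
    then have "c ^ m * (f \<omega> / c) ^ m \<le> g \<omega>"
      unfolding g_def using elim \<open>0 < c\<close> by (intro mult_left_mono) (auto simp: powr_divide)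
    then show ?case using \<open>0 < c\<close> by (simp add: power_divide)
  qed
  have g: "integrable M g" unfolding g_def using int by auto
  show intm: "integrable M (\<lambda>\<omega>. f \<omega> ^ m)"
  proof (rule Bochner_Integration.integrable_bound[OF g])
    show "AE \<omega> in M. norm (f \<omega> ^ m) \<le> norm (g \<omega>)"
      using fg f(2) by eventually_elim auto
  qed measurable
  have "(\<integral>\<omega>. f \<omega> ^ m \<partial>M) \<le> (\<integral>\<omega>. g \<omega> \<partial>M)" by (rule integral_mono_AE[OF intm g fg])
  also have "\<dots> = c ^ m * (real m / \<alpha> * ((\<integral>\<omega>. f \<omega> powr \<alpha> \<partial>M) / c powr \<alpha>) + (1 - real m / \<alpha>))"
    unfolding g_def using int by (simp add: prob_space)
  also have "\<dots> \<le> c ^ m * (real m / \<alpha> * 1 + (1 - real m / \<alpha>))"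
    using le m \<open>0 < c\<close> by (intro mult_left_mono add_mono) auto
  finally show "(\<integral>\<omega>. f \<omega> ^ m \<partial>M) \<le> c ^ m" by simp
qed

lemma (in queueing_system) env_nonneg: "AE \<omega> in P. \<forall>t\<ge>1. \<forall>i. 0 \<le> A t \<omega> $ i \<and> 0 \<le> S t \<omega> $ i"
proof -
  have "AE \<omega> in P. \<forall>i. 0 \<le> A t \<omega> $ i \<and> 0 \<le> S t \<omega> $ i" if t: "1 \<le> t" for t
  proof -
    note AE_distrD[OF A_S_measurable(1)[OF t], unfolded arrival_law[OF t], OF arrival_nonneg[OF t]]
      AE_distrD[OF A_S_measurable(2)[OF t], unfolded service_law[OF t], OF service_nonneg[OF t]]
    then show ?thesis by eventually_elim auto
  qed
  then show ?thesis by (simp add: AE_all_countable)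
qed

context softmw_instance
begin

lemma moment_bounds:
  assumes t: "1 \<le> t" and m: "0 < m" "m \<le> 5"
  shows "integrable P (\<lambda>\<omega>. A t \<omega> $ i powr \<alpha>)" "(\<integral>\<omega>. A t \<omega> $ i powr \<alpha> \<partial>P) \<le> M powr \<alpha>"
    "integrable P (\<lambda>\<omega>. (A t \<omega> $ i) ^ m)" "(\<integral>\<omega>. (A t \<omega> $ i) ^ m \<partial>P) \<le> M ^ m"
    "integrable P (\<lambda>\<omega>. S t \<omega> $ i powr \<alpha>)" "(\<integral>\<omega>. S t \<omega> $ i powr \<alpha> \<partial>P) \<le> M powr \<alpha>"
    "integrable P (\<lambda>\<omega>. (S t \<omega> $ i) ^ m)" "(\<integral>\<omega>. (S t \<omega> $ i) ^ m \<partial>P) \<le> M ^ m"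
proof -
  have [measurable]: "A t \<in> borel_measurable P" "S t \<in> borel_measurable P"
    using A_S_measurable[OF t] by auto
  have "AE \<omega> in P. nn_cond_exp P (history P A S a Q (t - 1)) (\<lambda>\<omega>. ennreal (A t \<omega> $ i powr \<alpha>)) \<omega>
      \<le> ennreal (M powr \<alpha>)"
    and "AE \<omega> in P. nn_cond_exp P (history P A S a Q (t - 1)) (\<lambda>\<omega>. ennreal (S t \<omega> $ i powr \<alpha>)) \<omega>
      \<le> ennreal (M powr \<alpha>)"
    using moments t by (auto simp: bounded_moments_def)
  then have "(\<integral>\<^sup>+\<omega>. ennreal (A t \<omega> $ i powr \<alpha>) \<partial>P) \<le> ennreal (M powr \<alpha>)"
    and "(\<integral>\<^sup>+\<omega>. ennreal (S t \<omega> $ i powr \<alpha>) \<partial>P) \<le> ennreal (M powr \<alpha>)"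
    by (auto intro!: nn_integral_le_of_nn_cond_exp_le[OF subalgebra_history])
  moreover have "AE \<omega> in P. 0 \<le> A t \<omega> $ i" "AE \<omega> in P. 0 \<le> S t \<omega> $ i"
    using env_nonneg t by auto
  moreover have "real m \<le> \<alpha>" using m alpha by simp
  ultimately show "integrable P (\<lambda>\<omega>. A t \<omega> $ i powr \<alpha>)" "(\<integral>\<omega>. A t \<omega> $ i powr \<alpha> \<partial>P) \<le> M powr \<alpha>"
    "integrable P (\<lambda>\<omega>. (A t \<omega> $ i) ^ m)" "(\<integral>\<omega>. (A t \<omega> $ i) ^ m \<partial>P) \<le> M ^ m"
    "integrable P (\<lambda>\<omega>. S t \<omega> $ i powr \<alpha>)" "(\<integral>\<omega>. S t \<omega> $ i powr \<alpha> \<partial>P) \<le> M powr \<alpha>"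
    "integrable P (\<lambda>\<omega>. (S t \<omega> $ i) ^ m)" "(\<integral>\<omega>. (S t \<omega> $ i) ^ m \<partial>P) \<le> M ^ m"
    using lower_moments[of "\<lambda>\<omega>. A t \<omega> $ i" M \<alpha> m] lower_moments[of "\<lambda>\<omega>. S t \<omega> $ i" M \<alpha> m] M_pos m(1)
    by auto
qed

lemma queue_increment:
  assumes t: "1 \<le> t" and \<omega>: "\<omega> \<in> space P" and "0 \<le> A t \<omega> $ i" "0 \<le> S t \<omega> $ i"
  shows "Q t \<omega> $ i - Q (t - 1) \<omega> $ i \<le> A t \<omega> $ i" "- S t \<omega> $ i \<le> Q t \<omega> $ i - Q (t - 1) \<omega> $ i"
  using assms Q_nonneg[OF \<omega>, of "t - 1" i] queue_step[OF t \<omega>] by auto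

lemma infnorm_powr_le:
  assumes "\<And>i. \<bar>v $ i\<bar> \<le> max (f i) (g i)" "\<And>i. 0 \<le> f i" "\<And>i. 0 \<le> g i"
  shows "infnorm (v :: real ^ 'k) powr \<alpha> \<le> (\<Sum>i\<in>UNIV. f i powr \<alpha> + g i powr \<alpha>)"
proof -
  define b where "b = (\<Sum>i\<in>UNIV. f i powr \<alpha> + g i powr \<alpha>)"
  have b: "0 \<le> b" unfolding b_def by (intro sum_nonneg) auto
  have le: "u \<le> b powr (1 / \<alpha>)" if "u powr \<alpha> \<le> b" "0 \<le> u" for u
  proof -
    have "u = (u powr \<alpha>) powr (1 / \<alpha>)" using that alpha by (simp add: powr_powr)
    also have "\<dots> \<le> b powr (1 / \<alpha>)" using that alpha by (intro powr_mono2) auto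
    finally show ?thesis .
  qed
  have mem: "f i powr \<alpha> + g i powr \<alpha> \<le> b" for i
    unfolding b_def by (rule member_le_sum) auto
  have fgb: "f i powr \<alpha> \<le> b" "g i powr \<alpha> \<le> b" for i
    using mem[of i] powr_ge_zero[of "f i" \<alpha>] powr_ge_zero[of "g i" \<alpha>] by linarith+
  have "\<bar>v $ i\<bar> \<le> b powr (1 / \<alpha>)" for i
    using assms(1)[of i] le[OF fgb(1)[of i] assms(2)] le[OF fgb(2)[of i] assms(3)] by linarith
  then have "infnorm v \<le> b powr (1 / \<alpha>)"
    unfolding infnorm_cart by (intro cSup_least) auto
  then have "infnorm v powr \<alpha> \<le> (b powr (1 / \<alpha>)) powr \<alpha>"
    using alpha by (intro powr_mono2) (auto simp: infnorm_pos_le)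
  then show ?thesis using b alpha by (simp add: powr_powr b_def)
qed

text \<open>Every queue increment lies between minus the service and the arrival, and the power of a
  maximum is at most the sum of the powers. The mean of this bound grows linearly in
  \<open>n\<close>.\<close>

lemma L_powr_le:
  assumes \<omega>: "\<omega> \<in> space P" and nn: "\<And>t i. 1 \<le> t \<Longrightarrow> 0 \<le> A t \<omega> $ i" "\<And>t i. 1 \<le> t \<Longrightarrow> 0 \<le> S t \<omega> $ i"
  shows "L n \<omega> powr \<alpha> \<le> M powr \<alpha> + (\<Sum>t\<in>{1..n}. \<Sum>i\<in>UNIV. A t \<omega> $ i powr \<alpha> + S t \<omega> $ i powr \<alpha>)"
proof (induction n)
  case (Suc n)
  define b where "b = (\<Sum>i\<in>UNIV. A (Suc n) \<omega> $ i powr \<alpha> + S (Suc n) \<omega> $ i powr \<alpha>)"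
  have "infnorm (Q (Suc n) \<omega> - Q n \<omega>) powr \<alpha> \<le> b"
    unfolding b_def
  proof (rule infnorm_powr_le)
    fix i
    show "\<bar>(Q (Suc n) \<omega> - Q n \<omega>) $ i\<bar> \<le> max (A (Suc n) \<omega> $ i) (S (Suc n) \<omega> $ i)"
      using queue_increment[OF _ \<omega> nn, of "Suc n" i] by simp
  qed (use nn in auto)
  moreover have "L (Suc n) \<omega> = max (L n \<omega>) (infnorm (Q (Suc n) \<omega> - Q n \<omega>))"
    using L_step[of "Suc n" \<omega>] \<omega> by simp
  moreover have "max u v powr \<alpha> \<le> u powr \<alpha> + v powr \<alpha>" for u v :: real by (simp add: max_def)
  ultimately have "L (Suc n) \<omega> powr \<alpha> \<le> L n \<omega> powr \<alpha> + b" by (metis add_left_mono order_trans)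
  then show ?case using Suc by (simp add: b_def)
qed (simp add: L_0[OF \<omega>])

lemma L_measurable: "L n \<in> borel_measurable P"
  by (rule measurable_from_subalg[OF subalgebra_past L_past_measurable])

lemma L_powr_moment:
  shows "integrable P (\<lambda>\<omega>. L n \<omega> powr \<alpha>)"
    "(\<integral>\<omega>. L n \<omega> powr \<alpha> \<partial>P) \<le> M powr \<alpha> * (1 + 2 * real CARD('k) * real n)"
proof -
  define g where "g \<omega> = M powr \<alpha> + (\<Sum>t\<in>{1..n}. \<Sum>i\<in>UNIV. A t \<omega> $ i powr \<alpha> + S t \<omega> $ i powr \<alpha>)" for \<omega>
  note mb = moment_bounds[where m = 1, simplified]
  have g: "integrable P g"
    unfolding g_def using mb by (intro Bochner_Integration.integrable_add Bochner_Integration.integrable_sum) auto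
  have le: "AE \<omega> in P. L n \<omega> powr \<alpha> \<le> g \<omega>"
    using env_nonneg AE_space unfolding g_def by eventually_elim (rule L_powr_le, auto)
  show int: "integrable P (\<lambda>\<omega>. L n \<omega> powr \<alpha>)"
  proof (rule Bochner_Integration.integrable_bound[OF g])
    show "AE \<omega> in P. norm (L n \<omega> powr \<alpha>) \<le> norm (g \<omega>)" using le by eventually_elim auto
  qed (use L_measurable in measurable)
  have "(\<integral>\<omega>. L n \<omega> powr \<alpha> \<partial>P) \<le> (\<integral>\<omega>. g \<omega> \<partial>P)" by (rule integral_mono_AE[OF int g le])
  also have "\<dots> = M powr \<alpha> + (\<Sum>t\<in>{1..n}. \<Sum>i\<in>UNIV.
      (\<integral>\<omega>. A t \<omega> $ i powr \<alpha> \<partial>P) + (\<integral>\<omega>. S t \<omega> $ i powr \<alpha> \<partial>P))"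
  proof -
    have "has_bochner_integral P (\<lambda>_. M powr \<alpha>) (M powr \<alpha>)"
      by (simp add: has_bochner_integral_iff prob_space)
    then have "has_bochner_integral P g (M powr \<alpha> + (\<Sum>t\<in>{1..n}. \<Sum>i\<in>UNIV.
        (\<integral>\<omega>. A t \<omega> $ i powr \<alpha> \<partial>P) + (\<integral>\<omega>. S t \<omega> $ i powr \<alpha> \<partial>P)))"
      unfolding g_def using mb
      by (intro has_bochner_integral_add has_bochner_integral_sum has_bochner_integral_integrable) auto
    then show ?thesis by (simp add: has_bochner_integral_iff)
  qed
  also have "\<dots> \<le> M powr \<alpha> + (\<Sum>t\<in>{1..n}. \<Sum>i\<in>(UNIV :: 'k set). M powr \<alpha> + M powr \<alpha>)"
    using mb by (intro add_left_mono sum_mono add_mono) auto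
  finally show "(\<integral>\<omega>. L n \<omega> powr \<alpha> \<partial>P) \<le> M powr \<alpha> * (1 + 2 * real CARD('k) * real n)"
    by (simp add: algebra_simps)
qed

definition C\<^sub>L :: real where "C\<^sub>L = 1 + M powr \<alpha> * (1 + 2 * real CARD('k))"

text \<open>Comparing \<open>L\<close> with the threshold n powr (1/\<alpha>) bounds its power
  \<open>m\<close> by an affine function of \<open>L n \<omega> powr \<alpha> / n\<close>, whose
  mean is bounded uniformly in \<open>n\<close> by \<open>L_powr_moment\<close>. The largest
  \<open>m\<close> that the regret bound uses is 5.\<close>

lemma L_power_moment:
  assumes n: "1 \<le> n" and m: "m \<le> 5"
  shows "integrable P (\<lambda>\<omega>. L n \<omega> ^ m)" "(\<integral>\<omega>. L n \<omega> ^ m \<partial>P) \<le> C\<^sub>L * real n powr (real m / \<alpha>)"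
proof -
  define g where "g \<omega> = real n powr (real m / \<alpha>) * (1 + L n \<omega> powr \<alpha> / real n)" for \<omega>
  have m\<alpha>: "real m \<le> \<alpha>" using m alpha by simp
  have le: "L n \<omega> ^ m \<le> g \<omega>" if "\<omega> \<in> space P" for \<omega>
  proof -
    define l where "l = L n \<omega>"
    have l: "0 < l" using L_pos[OF that] by (simp add: l_def)
    have nn: "0 \<le> l powr \<alpha> / real n" by simp
    have lm: "l ^ m = l powr real m" using l by (simp add: powr_realpow)
    show ?thesis
    proof (cases "l \<le> real n powr (1 / \<alpha>)")
      case True
      then have "l powr real m \<le> (real n powr (1 / \<alpha>)) powr real m"
        using l by (intro powr_mono2) auto
      also have "\<dots> = real n powr (real m / \<alpha>) * 1" by (simp add: powr_powr)
      also have "\<dots> \<le> g \<omega>" unfolding g_def l_def[symmetric] using nn by (intro mult_left_mono) auto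
      finally show ?thesis using lm by (simp add: l_def)
    next
      case False
      have "l powr real m = l powr \<alpha> * l powr (real m - \<alpha>)" by (simp add: powr_add[symmetric])
      also have "\<dots> \<le> l powr \<alpha> * (real n powr (1 / \<alpha>)) powr (real m - \<alpha>)"
        using False m\<alpha> n by (intro mult_left_mono powr_mono2') auto
      also have "\<dots> = l powr \<alpha> * (real n powr (real m / \<alpha>) / real n)"
        using n alpha by (simp add: powr_powr powr_diff diff_divide_distrib)
      also have "\<dots> = real n powr (real m / \<alpha>) * (l powr \<alpha> / real n)" by simp
      also have "\<dots> \<le> g \<omega>" unfolding g_def l_def[symmetric] by (intro mult_left_mono) auto
      finally show ?thesis using lm by (simp add: l_def)
    qed
  qed
  have g: "integrable P g" unfolding g_def using L_powr_moment(1)[of n] by auto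
  show int: "integrable P (\<lambda>\<omega>. L n \<omega> ^ m)"
  proof (rule Bochner_Integration.integrable_bound[OF g])
    show "AE \<omega> in P. norm (L n \<omega> ^ m) \<le> norm (g \<omega>)"
      using le L_pos[of _ n] by (intro AE_I2) (auto simp: less_imp_le intro: order_trans[OF _ abs_ge_self])
  qed (use L_measurable in measurable)
  have "(\<integral>\<omega>. L n \<omega> ^ m \<partial>P) \<le> (\<integral>\<omega>. g \<omega> \<partial>P)" by (rule integral_mono[OF int g le])
  also have "\<dots> = real n powr (real m / \<alpha>) * (1 + (\<integral>\<omega>. L n \<omega> powr \<alpha> \<partial>P) / real n)"
    unfolding g_def using L_powr_moment(1)[of n] by (simp add: prob_space)
  also have "\<dots> \<le> real n powr (real m / \<alpha>) * C\<^sub>L"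
  proof (intro mult_left_mono)
    have "(\<integral>\<omega>. L n \<omega> powr \<alpha> \<partial>P) \<le> M powr \<alpha> * (1 + 2 * real CARD('k) * real n)"
      by (rule L_powr_moment)
    also have "\<dots> \<le> M powr \<alpha> * (real n * (1 + 2 * real CARD('k)))"
      using n by (intro mult_left_mono) (auto simp: distrib_left mult.commute)
    finally show "1 + (\<integral>\<omega>. L n \<omega> powr \<alpha> \<partial>P) / real n \<le> C\<^sub>L"
      using n by (simp add: C\<^sub>L_def divide_le_eq mult_ac)
  qed auto
  finally show "(\<integral>\<omega>. L n \<omega> ^ m \<partial>P) \<le> C\<^sub>L * real n powr (real m / \<alpha>)" by (simp add: mult.commute)
qed

lemma Q_le_L:
  assumes \<omega>: "\<omega> \<in> space P"
  shows "Q t \<omega> $ i \<le> real t * L t \<omega>"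
proof -
  have "Q s \<omega> $ i \<le> real s * L t \<omega>" if "s \<le> t" for s
    using that
  proof (induction s)
    case (Suc s)
    then show ?case using Q_slope[OF \<omega>, of s t i] by (simp add: algebra_simps)
  qed (simp add: queue_0[OF \<omega>])
  then show ?thesis by simp
qed

lemma Q_integrable:
  assumes "0 < m" "m \<le> 5"
  shows "integrable P (\<lambda>\<omega>. (Q t \<omega> $ i) ^ m)"
proof (cases "t = 0")
  case True
  then show ?thesis
    using assms by (subst Bochner_Integration.integrable_cong[where g = "\<lambda>_. 0"]) (auto simp: queue_0)
next
  case False
  have "integrable P (\<lambda>\<omega>. real t ^ m * L t \<omega> ^ m)"
    using L_power_moment(1)[of t m] assms False by auto
  then show ?thesis
  proof (rule Bochner_Integration.integrable_bound)
    show "(\<lambda>\<omega>. (Q t \<omega> $ i) ^ m) \<in> borel_measurable P" using queue_measurable[of t] by measurable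
    show "AE \<omega> in P. norm ((Q t \<omega> $ i) ^ m) \<le> norm (real t ^ m * L t \<omega> ^ m)"
    proof (rule AE_I2)
      fix \<omega> assume \<omega>: "\<omega> \<in> space P"
      have "(Q t \<omega> $ i) ^ m \<le> (real t * L t \<omega>) ^ m"
        using Q_nonneg[OF \<omega>] Q_le_L[OF \<omega>] by (intro power_mono)
      then show "norm ((Q t \<omega> $ i) ^ m) \<le> norm (real t ^ m * L t \<omega> ^ m)"
        using Q_nonneg[OF \<omega>, of t i] L_pos[OF \<omega>, of t] by (simp add: power_mult_distrib)
    qed
  qed
qed

lemmas Q_integrable1 = Q_integrable[where m = 1, simplified]

section \<open>Mean queue lengths and the bias of clipping\<close>

definition mQ where "mQ t i = (\<integral>\<omega>. Q t \<omega> $ i \<partial>P)"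

definition mA where "mA t i = (\<integral>\<omega>. A t \<omega> $ i \<partial>P)"

definition mS where "mS t i = (\<integral>\<omega>. S t \<omega> $ i \<partial>P)"

definition mSc where "mSc t i = (\<integral>\<omega>. Sc t \<omega> $ i \<partial>P)"

lemma AS_integrable: "1 \<le> t \<Longrightarrow> integrable P (\<lambda>\<omega>. A t \<omega> $ i)" "1 \<le> t \<Longrightarrow> integrable P (\<lambda>\<omega>. S t \<omega> $ i)"
  using moment_bounds(3,7)[where m = 1] by auto

lemma mean_vec_eq:
  assumes "1 \<le> t"
  shows "mean_vec (\<A> t) $ i = mA t i" "mean_vec (\<S> t) $ i = mS t i"
  using A_S_measurable[OF assms]
  by (auto simp: mean_vec_def mA_def mS_def arrival_law[OF assms, symmetric]
      service_law[OF assms, symmetric] integral_distr)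

lemma mA_mS_bounds:
  assumes "1 \<le> t"
  shows "0 \<le> mA t i" "mA t i \<le> M" "0 \<le> mS t i" "mS t i \<le> M"
proof -
  have "AE \<omega> in P. 0 \<le> A t \<omega> $ i" "AE \<omega> in P. 0 \<le> S t \<omega> $ i" using env_nonneg assms by auto
  then show "0 \<le> mA t i" "0 \<le> mS t i" by (auto simp: mA_def mS_def intro: integral_nonneg_AE)
  show "mA t i \<le> M" "mS t i \<le> M"
    using moment_bounds(4,8)[OF assms, where m = 1] by (auto simp: mA_def mS_def)
qed

lemma mQ_nonneg: "0 \<le> mQ t i"
  unfolding mQ_def using Q_nonneg by (intro integral_nonneg_AE AE_I2) auto

text \<open>Single increments are unbounded, but their means lie between minus the mean service and
  the mean arrival. Hence the windows are treated with mean queue lengths and not path by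
  path.\<close>

lemma mQ_increment:
  assumes "1 \<le> t"
  shows "\<bar>mQ t i - mQ (t - 1) i\<bar> \<le> M"
proof -
  have eq: "mQ t i - mQ (t - 1) i = (\<integral>\<omega>. Q t \<omega> $ i - Q (t - 1) \<omega> $ i \<partial>P)"
    unfolding mQ_def by (intro Bochner_Integration.integral_diff[symmetric] Q_integrable1)
  have AE: "AE \<omega> in P. Q t \<omega> $ i - Q (t - 1) \<omega> $ i \<le> A t \<omega> $ i \<and> - S t \<omega> $ i \<le> Q t \<omega> $ i - Q (t - 1) \<omega> $ i"
    using env_nonneg AE_space by eventually_elim (use queue_increment assms in blast)
  have int: "integrable P (\<lambda>\<omega>. Q t \<omega> $ i - Q (t - 1) \<omega> $ i)"
    by (intro Bochner_Integration.integrable_diff Q_integrable1)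
  have "mQ t i - mQ (t - 1) i \<le> mA t i"
    unfolding eq mA_def using AE AS_integrable[OF assms] int by (intro integral_mono_AE) auto
  moreover have "(\<integral>\<omega>. - S t \<omega> $ i \<partial>P) \<le> mQ t i - mQ (t - 1) i"
    unfolding eq using AE AS_integrable[OF assms] int by (intro integral_mono_AE) auto
  ultimately show ?thesis using mA_mS_bounds[OF assms, of i] by (simp add: mS_def)
qed

lemma mQ_le: "mQ t i \<le> real t * M"
proof (induction t)
  case 0
  have "mQ 0 i = (\<integral>\<omega>. 0 \<partial>P)" unfolding mQ_def by (intro Bochner_Integration.integral_cong) (auto simp: queue_0)
  then show ?case by simp
next
  case (Suc t)
  then show ?case using mQ_increment[of "Suc t" i] by (simp add: algebra_simps)
qed

lemma Sc_measurable: "1 \<le> t \<Longrightarrow> Sc t \<in> borel_measurable (env {t - 1<..})"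
proof -
  assume "1 \<le> t"
  then have [measurable]: "S t \<in> borel_measurable (env {t - 1<..})" by (intro env_measurable) auto
  show ?thesis unfolding Sc_def[abs_def] by measurable
qed

lemma Sc_square_moment:
  assumes t: "1 \<le> t"
  shows "integrable P (\<lambda>\<omega>. (Sc t \<omega> $ i)\<^sup>2)" "(\<integral>\<omega>. (Sc t \<omega> $ i)\<^sup>2 \<partial>P) \<le> M\<^sup>2"
    "integrable P (\<lambda>\<omega>. Sc t \<omega> $ i)"
proof -
  have [measurable]: "Sc t \<in> borel_measurable P"
    by (rule measurable_from_subalg[OF subalgebra_env Sc_measurable[OF t]]) auto
  have AE: "AE \<omega> in P. 0 \<le> Sc t \<omega> $ i \<and> Sc t \<omega> $ i \<le> S t \<omega> $ i"
    using env_nonneg by eventually_elim (use t Sc_bounds in auto)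
  have S2: "integrable P (\<lambda>\<omega>. (S t \<omega> $ i)\<^sup>2)" "(\<integral>\<omega>. (S t \<omega> $ i)\<^sup>2 \<partial>P) \<le> M\<^sup>2"
    using moment_bounds(7,8)[OF t, of 2] by auto
  have le: "AE \<omega> in P. (Sc t \<omega> $ i)\<^sup>2 \<le> (S t \<omega> $ i)\<^sup>2"
    using AE by eventually_elim (auto intro: power_mono)
  show int: "integrable P (\<lambda>\<omega>. (Sc t \<omega> $ i)\<^sup>2)"
    by (rule Bochner_Integration.integrable_bound[OF S2(1)]) (use le in auto)
  show "(\<integral>\<omega>. (Sc t \<omega> $ i)\<^sup>2 \<partial>P) \<le> M\<^sup>2"
    using integral_mono_AE[OF int S2(1) le] S2(2) by simp
  show "integrable P (\<lambda>\<omega>. Sc t \<omega> $ i)"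
  proof (rule Bochner_Integration.integrable_bound[OF AS_integrable(2)[OF t]])
    show "AE \<omega> in P. norm (Sc t \<omega> $ i) \<le> norm (S t \<omega> $ i)" using AE by eventually_elim auto
  qed measurable
qed

text \<open>Above the level \<open>b\<close>, s is at most b powr (1 - \<alpha>) times s powr
  \<alpha>, so the moment assumption bounds the mean of what clipping removes. The rate -3/2 is
  chosen because the bias is later multiplied by a mean queue length of up to t M.\<close>

lemma mSc_ge:
  assumes t: "1 \<le> t"
  shows "mS t i - M * real t powr (- (3 / 2)) \<le> mSc t i" "0 \<le> mSc t i"
proof -
  define b where "b = M * real t powr (\<delta> / 4)"
  have b: "0 < b" using M_pos t by (simp add: b_def)
  have AE: "AE \<omega> in P. S t \<omega> $ i - b powr (1 - \<alpha>) * S t \<omega> $ i powr \<alpha> \<le> Sc t \<omega> $ i"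
    using env_nonneg
  proof eventually_elim
    case (elim \<omega>)
    define s where "s = S t \<omega> $ i"
    have s: "0 \<le> s" using elim t by (simp add: s_def)
    have "s - b powr (1 - \<alpha>) * s powr \<alpha> \<le> clip b s"
    proof (cases "s \<le> b")
      case False
      then have "0 < s" using b by simp
      then have "s = s powr (1 - \<alpha>) * s powr \<alpha>" by (simp add: powr_add[symmetric])
      also have "\<dots> \<le> b powr (1 - \<alpha>) * s powr \<alpha>"
        using False alpha b by (intro mult_right_mono powr_mono2') auto
      finally show ?thesis using False by (simp add: clip_def)
    qed (simp add: clip_def)
    then show ?case by (simp add: Sc_def s_def b_def)
  qed
  note mb = moment_bounds[OF t, of 1, simplified]
  have int: "integrable P (\<lambda>\<omega>. S t \<omega> $ i - b powr (1 - \<alpha>) * S t \<omega> $ i powr \<alpha>)"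
    using mb by auto
  have "(\<integral>\<omega>. S t \<omega> $ i - b powr (1 - \<alpha>) * S t \<omega> $ i powr \<alpha> \<partial>P) \<le> mSc t i"
    unfolding mSc_def by (rule integral_mono_AE[OF int Sc_square_moment(3)[OF t] AE])
  moreover have "(\<integral>\<omega>. S t \<omega> $ i - b powr (1 - \<alpha>) * S t \<omega> $ i powr \<alpha> \<partial>P)
      = mS t i - b powr (1 - \<alpha>) * (\<integral>\<omega>. S t \<omega> $ i powr \<alpha> \<partial>P)"
    using mb by (simp add: mS_def)
  moreover have "b powr (1 - \<alpha>) * (\<integral>\<omega>. S t \<omega> $ i powr \<alpha> \<partial>P) \<le> M * real t powr (- (3 / 2))"
  proof -
    have "b powr (1 - \<alpha>) * (\<integral>\<omega>. S t \<omega> $ i powr \<alpha> \<partial>P) \<le> b powr (1 - \<alpha>) * M powr \<alpha>"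
      using mb by (intro mult_left_mono) auto
    also have "\<dots> = (M powr (1 - \<alpha>) * M powr \<alpha>) * real t powr (\<delta> / 4 * (1 - \<alpha>))"
      using M_pos by (simp add: b_def powr_mult powr_powr)
    also have "M powr (1 - \<alpha>) * M powr \<alpha> = M" using M_pos by (simp add: powr_add[symmetric])
    \<comment> \<open>\<delta> at most 1/2 and \<delta> \<alpha> > 7 give \<delta>/4 (1 - \<alpha>)
      < 1/8 - 7/4 = -13/8.\<close>
    also have "M * real t powr (\<delta> / 4 * (1 - \<alpha>)) \<le> M * real t powr (- (3 / 2))"
      using M_pos t delta delta_alpha
      by (intro mult_left_mono powr_mono) (auto simp: algebra_simps)
    finally show ?thesis .
  qed
  ultimately show "mS t i - M * real t powr (- (3 / 2)) \<le> mSc t i" by linarith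
  have "AE \<omega> in P. 0 \<le> Sc t \<omega> $ i"
    using env_nonneg by eventually_elim (use t Sc_bounds in auto)
  then show "0 \<le> mSc t i" unfolding mSc_def by (rule integral_nonneg_AE)
qed

section \<open>Expectations of the terms of the regret bound\<close>

lemma past_env_integral:
  fixes F G :: "'w \<Rightarrow> real"
  assumes t: "1 \<le> t" and F: "F \<in> borel_measurable (past (t - 1))" "integrable P F"
    and G: "G \<in> borel_measurable (env {t - 1<..})" "integrable P G"
  shows "integrable P (\<lambda>\<omega>. F \<omega> * G \<omega>)" "(\<integral>\<omega>. F \<omega> * G \<omega> \<partial>P) = (\<integral>\<omega>. F \<omega> \<partial>P) * (\<integral>\<omega>. G \<omega> \<partial>P)"
proof -
  have "subalgebra P (env {t - 1<..})" by (rule subalgebra_env) auto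
  from indep_set_integral[OF subalgebra_past this past_indep_future[of "t - 1"] F G]
  show "integrable P (\<lambda>\<omega>. F \<omega> * G \<omega>)"
    "(\<integral>\<omega>. F \<omega> * G \<omega> \<partial>P) = (\<integral>\<omega>. F \<omega> \<partial>P) * (\<integral>\<omega>. G \<omega> \<partial>P)" .
qed

text \<open>The random index is resolved by the indicators of the events \<open>a t = i\<close>.
  \<open>Y\<close> may involve the services of slot \<open>t\<close> itself, since
  \<open>history_env\<close> contains the whole environment.\<close>

lemma importance_weighted_sum:
  fixes Y :: "'k \<Rightarrow> 'w \<Rightarrow> real"
  assumes t: "1 \<le> t" and Y: "\<And>i. Y i \<in> borel_measurable (history_env P A S a Q (t - 1))"
    "\<And>i. integrable P (Y i)" "\<And>i. AE \<omega> in P. 0 \<le> Y i \<omega>"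
  shows "has_bochner_integral P (\<lambda>\<omega>. c (a t \<omega>) * (Y (a t \<omega>) \<omega> / p t \<omega> $ a t \<omega>))
    (\<Sum>i\<in>UNIV. c i * (\<integral>\<omega>. Y i \<omega> \<partial>P))"
proof -
  have "has_bochner_integral P (\<lambda>\<omega>. indicator {\<omega> \<in> space P. a t \<omega> = i} \<omega> * (Y i \<omega> / p t \<omega> $ i))
      (\<integral>\<omega>. Y i \<omega> \<partial>P)" for i
  proof (rule importance_weighting[OF subalgebra_history_env action_event[OF t] action_law[OF t]])
    have "p t \<in> borel_measurable (history_env P A S a Q (t - 1))"
      by (rule past_history_env_measurable[OF x_p_past_measurable(2)[OF t]])
    then show "(\<lambda>\<omega>. p t \<omega> $ i) \<in> borel_measurable (history_env P A S a Q (t - 1))" by measurable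
    show "0 < p t \<omega> $ i" if "\<omega> \<in> space P" for \<omega> using p_bounds(3)[OF t that] .
  qed (use Y in auto)
  then have "has_bochner_integral P (\<lambda>\<omega>. \<Sum>i\<in>UNIV. c i * (indicator {\<omega> \<in> space P. a t \<omega> = i} \<omega>
      * (Y i \<omega> / p t \<omega> $ i))) (\<Sum>i\<in>UNIV. c i * (\<integral>\<omega>. Y i \<omega> \<partial>P))"
    by (intro has_bochner_integral_sum has_bochner_integral_mult_right) auto
  moreover have "(\<Sum>i\<in>UNIV. c i * (indicator {\<omega> \<in> space P. a t \<omega> = i} \<omega> * (Y i \<omega> / p t \<omega> $ i)))
      = c (a t \<omega>) * (Y (a t \<omega>) \<omega> / p t \<omega> $ a t \<omega>)" if "\<omega> \<in> space P" for \<omega>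
  proof -
    have "(\<Sum>i\<in>UNIV. c i * (indicator {\<omega> \<in> space P. a t \<omega> = i} \<omega> * (Y i \<omega> / p t \<omega> $ i)))
      = (\<Sum>i\<in>UNIV. if i = a t \<omega> then c i * (Y i \<omega> / p t \<omega> $ i) else 0)"
      using that by (intro sum.cong) (auto simp: indicator_def)
    then show ?thesis by simp
  qed
  ultimately show ?thesis
    by (subst has_bochner_integral_cong[OF refl _ refl, rotated]) auto
qed

lemma Q_past: "1 \<le> t \<Longrightarrow> (\<lambda>\<omega>. Q (t - 1) \<omega> $ i) \<in> borel_measurable (past (t - 1))"
  using queue_past_measurable[of "t - 1"] by measurable

lemma A_S_env:
  assumes "1 \<le> t"
  shows "(\<lambda>\<omega>. A t \<omega> $ i) \<in> borel_measurable (env {t - 1<..})"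
    "(\<lambda>\<omega>. S t \<omega> $ i) \<in> borel_measurable (env {t - 1<..})"
    "(\<lambda>\<omega>. Sc t \<omega> $ i) \<in> borel_measurable (env {t - 1<..})"
  using env_measurable[of t "{t - 1<..}"] Sc_measurable[OF assms] assms by auto

lemma history_env_subs:
  "F \<in> borel_measurable (past (t - 1)) \<Longrightarrow> F \<in> borel_measurable (history_env P A S a Q (t - 1))"
  "G \<in> borel_measurable (env {t - 1<..}) \<Longrightarrow> G \<in> borel_measurable (history_env P A S a Q (t - 1))"
proof -
  show "F \<in> borel_measurable (past (t - 1)) \<Longrightarrow> F \<in> borel_measurable (history_env P A S a Q (t - 1))"
    by (rule past_history_env_measurable)
  have "{t - 1<..} \<subseteq> {1..}" by auto
  then have "subalgebra (history_env P A S a Q (t - 1)) (env {t - 1<..})"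
    using subalgebra_history_env[of "t - 1"] env_sub_history_env
    by (intro subalgebraI) (auto simp: subalgebra_def)
  then show "G \<in> borel_measurable (env {t - 1<..}) \<Longrightarrow> G \<in> borel_measurable (history_env P A S a Q (t - 1))"
    by (rule measurable_from_subalg)
qed

lemma comparator_expectation:
  assumes t: "1 \<le> t"
  shows "has_bochner_integral P (\<lambda>\<omega>. c (a t \<omega>) * (reward t \<omega> / p t \<omega> $ a t \<omega>))
    (\<Sum>i\<in>UNIV. c i * (mQ (t - 1) i * mSc t i))"
proof -
  note i = past_env_integral[OF t Q_past[OF t] Q_integrable1 A_S_env(3)[OF t] Sc_square_moment(3)[OF t]]
  have "has_bochner_integral P
    (\<lambda>\<omega>. c (a t \<omega>) * ((\<lambda>i \<omega>. Q (t - 1) \<omega> $ i * Sc t \<omega> $ i) (a t \<omega>) \<omega> / p t \<omega> $ a t \<omega>))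
    (\<Sum>i\<in>UNIV. c i * (\<integral>\<omega>. (\<lambda>i \<omega>. Q (t - 1) \<omega> $ i * Sc t \<omega> $ i) i \<omega> \<partial>P))"
  proof (rule importance_weighted_sum[OF t])
    fix i
    show "(\<lambda>\<omega>. Q (t - 1) \<omega> $ i * Sc t \<omega> $ i) \<in> borel_measurable (history_env P A S a Q (t - 1))"
      using history_env_subs(1)[OF Q_past[OF t, of i]] history_env_subs(2)[OF A_S_env(3)[OF t, of i]]
      by measurable
    show "AE \<omega> in P. 0 \<le> Q (t - 1) \<omega> $ i * Sc t \<omega> $ i"
      using env_nonneg AE_space
      by eventually_elim (use t Sc_bounds Q_nonneg in \<open>auto intro!: mult_nonneg_nonneg\<close>)
  qed (rule i)
  then show ?thesis by (simp only: i(2) reward_def mQ_def mSc_def)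
qed

definition qe where "qe t \<omega> = \<eta> t \<omega> * (norm (Q (t - 1) \<omega>))\<^sup>2"

lemma eta_le:
  assumes t: "1 \<le> t" and \<omega>: "\<omega> \<in> space P"
  shows "\<eta> t \<omega> \<le> real t powr \<kappa> / M\<^sup>2"
proof -
  have "M * M \<le> Z t \<omega>"
    unfolding Z_def
  proof (intro mult_mono)
    define l where "l = L (t - 1) \<omega>"
    have l: "M \<le> l" "0 < l" using L_ge[OF \<omega>] L_pos[OF \<omega>] by (auto simp: l_def)
    have "1 * 1 * 1 * l\<^sup>2 \<le> 86 * real CARD('k) ^ 6 * real t powr (3 / 2) * l\<^sup>2"
      using t K_ge by (intro mult_right_mono mult_mono) (auto simp: ge_one_powr_ge_zero)
    moreover have "0 \<le> (\<Sum>s\<in>{0..t - 1}. (norm (Q s \<omega>))\<^sup>2)" by (simp add: sum_nonneg)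
    ultimately have "l\<^sup>2 \<le> 86 * l\<^sup>2 * real CARD('k) ^ 6 * real t powr (3 / 2) + (\<Sum>s\<in>{0..t - 1}. (norm (Q s \<omega>))\<^sup>2)"
      by (simp add: mult_ac)
    then have "l \<le> sqrt (86 * l\<^sup>2 * real CARD('k) ^ 6 * real t powr (3 / 2) + (\<Sum>s\<in>{0..t - 1}. (norm (Q s \<omega>))\<^sup>2))"
      by (rule real_le_rsqrt)
    then show "M \<le> sqrt (86 * (L (t - 1) \<omega>)\<^sup>2 * real CARD('k) ^ 6 * real t powr (3 / 2)
      + (\<Sum>s\<in>{0..t - 1}. (norm (Q s \<omega>))\<^sup>2))" using l by (simp only: l_def)
  qed (use L_ge[OF \<omega>] L_pos[OF \<omega>, of "t - 1"] M_pos in auto)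
  then show ?thesis
    unfolding eta_eq power2_eq_square using M_pos by (intro frac_le) auto
qed

lemma eta_Q_integrable:
  assumes t: "1 \<le> t"
  shows "(\<lambda>\<omega>. \<eta> t \<omega> * (Q (t - 1) \<omega> $ i)\<^sup>2) \<in> borel_measurable (past (t - 1))"
    "integrable P (\<lambda>\<omega>. \<eta> t \<omega> * (Q (t - 1) \<omega> $ i)\<^sup>2)"
proof -
  note [measurable] = eta_gamma_past_measurable(1)[OF t] Q_past[OF t]
  show m: "(\<lambda>\<omega>. \<eta> t \<omega> * (Q (t - 1) \<omega> $ i)\<^sup>2) \<in> borel_measurable (past (t - 1))" by measurable
  have "integrable P (\<lambda>\<omega>. real t powr \<kappa> / M\<^sup>2 * (Q (t - 1) \<omega> $ i)\<^sup>2)"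
    by (intro integrable_mult_right Q_integrable) auto
  then show "integrable P (\<lambda>\<omega>. \<eta> t \<omega> * (Q (t - 1) \<omega> $ i)\<^sup>2)"
  proof (rule Bochner_Integration.integrable_bound)
    show "AE \<omega> in P. norm (\<eta> t \<omega> * (Q (t - 1) \<omega> $ i)\<^sup>2) \<le> norm (real t powr \<kappa> / M\<^sup>2 * (Q (t - 1) \<omega> $ i)\<^sup>2)"
    proof (rule AE_I2)
      fix \<omega> assume \<omega>: "\<omega> \<in> space P"
      show "norm (\<eta> t \<omega> * (Q (t - 1) \<omega> $ i)\<^sup>2) \<le> norm (real t powr \<kappa> / M\<^sup>2 * (Q (t - 1) \<omega> $ i)\<^sup>2)"
        using eta_le[OF t \<omega>] eta_pos[OF t \<omega>] unfolding real_norm_def abs_mult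
        by (intro mult_right_mono) auto
    qed
  qed (rule measurable_from_subalg[OF subalgebra_past m])
qed

lemma qe_integrable:
  assumes t: "1 \<le> t"
  shows "integrable P (qe t)"
    "(\<integral>\<omega>. qe t \<omega> \<partial>P) = (\<Sum>i\<in>UNIV. (\<integral>\<omega>. \<eta> t \<omega> * (Q (t - 1) \<omega> $ i)\<^sup>2 \<partial>P))"
proof -
  have eq: "qe t = (\<lambda>\<omega>. \<Sum>i\<in>UNIV. \<eta> t \<omega> * (Q (t - 1) \<omega> $ i)\<^sup>2)"
    by (simp add: fun_eq_iff qe_def norm_sq_vec sum_distrib_left)
  show "integrable P (qe t)"
    "(\<integral>\<omega>. qe t \<omega> \<partial>P) = (\<Sum>i\<in>UNIV. (\<integral>\<omega>. \<eta> t \<omega> * (Q (t - 1) \<omega> $ i)\<^sup>2 \<partial>P))"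
    unfolding eq using eta_Q_integrable(2)[OF t]
    by (auto intro!: Bochner_Integration.integrable_sum Bochner_Integration.integral_sum)
qed

text \<open>The importance weight cancels and leaves a sum over all queues, in which independence
  separates the squared clipped service, of mean at most \<open>M\<^sup>2\<close>, from
  \<open>\<eta> t\<close> times the squared queue length.\<close>

lemma variance_expectation:
  assumes t: "1 \<le> t"
  shows "integrable P (\<lambda>\<omega>. 2 * \<eta> t \<omega> * ((reward t \<omega>)\<^sup>2 / p t \<omega> $ a t \<omega>))"
    "(\<integral>\<omega>. 2 * \<eta> t \<omega> * ((reward t \<omega>)\<^sup>2 / p t \<omega> $ a t \<omega>) \<partial>P) \<le> 2 * M\<^sup>2 * (\<integral>\<omega>. qe t \<omega> \<partial>P)"
proof -
  define Y where "Y i \<omega> = \<eta> t \<omega> * (Q (t - 1) \<omega> $ i)\<^sup>2 * (Sc t \<omega> $ i)\<^sup>2" for i \<omega>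
  have Sc2: "(\<lambda>\<omega>. (Sc t \<omega> $ i)\<^sup>2) \<in> borel_measurable (env {t - 1<..})" for i
    using A_S_env(3)[OF t, of i] by measurable
  note i = past_env_integral[OF t eta_Q_integrable[OF t] Sc2 Sc_square_moment(1)[OF t]]
  have "has_bochner_integral P (\<lambda>\<omega>. 2 * (Y (a t \<omega>) \<omega> / p t \<omega> $ a t \<omega>)) (\<Sum>i\<in>UNIV. 2 * (\<integral>\<omega>. Y i \<omega> \<partial>P))"
  proof (rule importance_weighted_sum[OF t])
    fix i
    show "Y i \<in> borel_measurable (history_env P A S a Q (t - 1))"
      unfolding Y_def[abs_def]
      using history_env_subs(1)[OF eta_Q_integrable(1)[OF t, of i]] history_env_subs(2)[OF Sc2[of i]]
      by measurable
    show "AE \<omega> in P. 0 \<le> Y i \<omega>"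
      unfolding Y_def using eta_pos[OF t] by (intro AE_I2) (auto simp: less_imp_le)
    show "integrable P (Y i)" unfolding Y_def[abs_def] by (rule i)
  qed
  moreover have "(\<lambda>\<omega>. 2 * (Y (a t \<omega>) \<omega> / p t \<omega> $ a t \<omega>)) = (\<lambda>\<omega>. 2 * \<eta> t \<omega> * ((reward t \<omega>)\<^sup>2 / p t \<omega> $ a t \<omega>))"
    by (simp add: Y_def reward_def power_mult_distrib mult_ac fun_eq_iff)
  ultimately have h: "has_bochner_integral P (\<lambda>\<omega>. 2 * \<eta> t \<omega> * ((reward t \<omega>)\<^sup>2 / p t \<omega> $ a t \<omega>))
      (\<Sum>i\<in>UNIV. 2 * (\<integral>\<omega>. Y i \<omega> \<partial>P))" by simp
  then show "integrable P (\<lambda>\<omega>. 2 * \<eta> t \<omega> * ((reward t \<omega>)\<^sup>2 / p t \<omega> $ a t \<omega>))"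
    by (simp add: has_bochner_integral_iff)
  have "(\<integral>\<omega>. 2 * \<eta> t \<omega> * ((reward t \<omega>)\<^sup>2 / p t \<omega> $ a t \<omega>) \<partial>P) = (\<Sum>i\<in>UNIV. 2 * (\<integral>\<omega>. Y i \<omega> \<partial>P))"
    using h by (simp add: has_bochner_integral_iff)
  also have "\<dots> \<le> (\<Sum>i\<in>UNIV. 2 * ((\<integral>\<omega>. \<eta> t \<omega> * (Q (t - 1) \<omega> $ i)\<^sup>2 \<partial>P) * M\<^sup>2))"
  proof (intro sum_mono mult_left_mono)
    fix i
    have "0 \<le> (\<integral>\<omega>. \<eta> t \<omega> * (Q (t - 1) \<omega> $ i)\<^sup>2 \<partial>P)"
      using eta_pos[OF t] by (intro integral_nonneg_AE AE_I2) (auto simp: less_imp_le)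
    then show "(\<integral>\<omega>. Y i \<omega> \<partial>P) \<le> (\<integral>\<omega>. \<eta> t \<omega> * (Q (t - 1) \<omega> $ i)\<^sup>2 \<partial>P) * M\<^sup>2"
      unfolding Y_def i(2) using Sc_square_moment(2)[OF t] by (intro mult_left_mono)
  qed simp
  also have "\<dots> = 2 * M\<^sup>2 * (\<integral>\<omega>. qe t \<omega> \<partial>P)"
    by (simp add: qe_integrable(2)[OF t] sum_distrib_left mult_ac)
  finally show "(\<integral>\<omega>. 2 * \<eta> t \<omega> * ((reward t \<omega>)\<^sup>2 / p t \<omega> $ a t \<omega>) \<partial>P) \<le> 2 * M\<^sup>2 * (\<integral>\<omega>. qe t \<omega> \<partial>P)" .
qed

text \<open>The served queue is replaced by a sum over all queues, so that every summand is a
  product of a function of the past and a service, without the action.\<close>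

definition expl where "expl t \<omega> = (\<Sum>i\<in>UNIV. 2 * (\<gamma> t \<omega> * Q (t - 1) \<omega> $ i * S t \<omega> $ i))"

lemma exploration_le:
  assumes t: "1 \<le> t" and \<omega>: "\<omega> \<in> space P" and S0: "\<And>i. 0 \<le> S t \<omega> $ i"
  shows "2 * \<gamma> t \<omega> * reward t \<omega> \<le> expl t \<omega>"
proof -
  have "2 * \<gamma> t \<omega> * reward t \<omega> \<le> 2 * (\<gamma> t \<omega> * Q (t - 1) \<omega> $ a t \<omega> * S t \<omega> $ a t \<omega>)"
    unfolding reward_def using Sc_bounds[OF S0] gamma_range[OF t \<omega>] Q_nonneg[OF \<omega>]
    by (simp add: mult.assoc mult_left_mono)
  also have "\<dots> \<le> expl t \<omega>"
    unfolding expl_def using S0 gamma_range[OF t \<omega>] Q_nonneg[OF \<omega>]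
    by (intro member_le_sum[where f = "\<lambda>i. 2 * (\<gamma> t \<omega> * Q (t - 1) \<omega> $ i * S t \<omega> $ i)"])
      (auto intro!: mult_nonneg_nonneg)
  finally show ?thesis .
qed

lemma exploration_expectation:
  assumes t: "1 \<le> t"
  shows "integrable P (expl t)"
    "(\<integral>\<omega>. expl t \<omega> \<partial>P) \<le> 2 * M\<^sup>2 * real CARD('k) * real t powr (\<delta> / 4) * (\<integral>\<omega>. qe t \<omega> \<partial>P)"
proof -
  note [measurable] = eta_gamma_past_measurable(2)[OF t] Q_past[OF t]
  have m: "(\<lambda>\<omega>. \<gamma> t \<omega> * Q (t - 1) \<omega> $ i) \<in> borel_measurable (past (t - 1))" for i by measurable
  have int: "integrable P (\<lambda>\<omega>. \<gamma> t \<omega> * Q (t - 1) \<omega> $ i)" for i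
  proof (rule Bochner_Integration.integrable_bound[OF Q_integrable1[of "t - 1" i]])
    show "AE \<omega> in P. norm (\<gamma> t \<omega> * Q (t - 1) \<omega> $ i) \<le> norm (Q (t - 1) \<omega> $ i)"
    proof (rule AE_I2)
      fix \<omega> assume "\<omega> \<in> space P"
      then have "\<bar>\<gamma> t \<omega>\<bar> * \<bar>Q (t - 1) \<omega> $ i\<bar> \<le> 1 * \<bar>Q (t - 1) \<omega> $ i\<bar>"
        using gamma_range[OF t \<open>\<omega> \<in> space P\<close>] by (intro mult_right_mono) auto
      then show "norm (\<gamma> t \<omega> * Q (t - 1) \<omega> $ i) \<le> norm (Q (t - 1) \<omega> $ i)" by (simp add: abs_mult)
    qed
  qed (rule measurable_from_subalg[OF subalgebra_past m])
  note i = past_env_integral[OF t m int A_S_env(2)[OF t] AS_integrable(2)[OF t]]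
  show inte: "integrable P (expl t)"
    unfolding expl_def[abs_def] using i(1) by (intro Bochner_Integration.integrable_sum integrable_mult_right) auto
  have g0: "0 \<le> (\<integral>\<omega>. \<gamma> t \<omega> * Q (t - 1) \<omega> $ i \<partial>P)" for i
    using gamma_range[OF t] Q_nonneg by (intro integral_nonneg_AE AE_I2) auto
  have "(\<integral>\<omega>. expl t \<omega> \<partial>P) = (\<Sum>i\<in>UNIV. 2 * ((\<integral>\<omega>. \<gamma> t \<omega> * Q (t - 1) \<omega> $ i \<partial>P) * mS t i))"
    unfolding expl_def mS_def i(2)[symmetric] using i(1)
    by (subst Bochner_Integration.integral_sum) auto
  also have "\<dots> \<le> (\<Sum>i\<in>UNIV. 2 * ((\<integral>\<omega>. \<gamma> t \<omega> * Q (t - 1) \<omega> $ i \<partial>P) * M))"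
    using g0 mA_mS_bounds(4)[OF t] by (intro sum_mono mult_left_mono) auto
  also have "\<dots> = 2 * M * (\<integral>\<omega>. (\<Sum>i\<in>UNIV. \<gamma> t \<omega> * Q (t - 1) \<omega> $ i) \<partial>P)"
    using int by (subst Bochner_Integration.integral_sum) (auto simp: sum_distrib_left mult_ac)
  also have "\<dots> \<le> 2 * M * (\<integral>\<omega>. M * real CARD('k) * real t powr (\<delta> / 4) * qe t \<omega> \<partial>P)"
  proof (intro mult_left_mono integral_mono)
    show "integrable P (\<lambda>\<omega>. \<Sum>i\<in>UNIV. \<gamma> t \<omega> * Q (t - 1) \<omega> $ i)" using int by auto
    show "integrable P (\<lambda>\<omega>. M * real CARD('k) * real t powr (\<delta> / 4) * qe t \<omega>)"
      using qe_integrable(1)[OF t] by auto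
    fix \<omega> assume \<omega>: "\<omega> \<in> space P"
    have "(\<Sum>i\<in>UNIV. \<gamma> t \<omega> * Q (t - 1) \<omega> $ i) = M * real t powr (\<delta> / 4) * \<eta> t \<omega> * (norm1 (Q (t - 1) \<omega>))\<^sup>2"
      by (simp add: sum_distrib_left[symmetric] norm1_Q[OF \<omega>, symmetric] gamma_eq power2_eq_square)
    also have "\<dots> \<le> M * real t powr (\<delta> / 4) * \<eta> t \<omega> * (real CARD('k) * (norm (Q (t - 1) \<omega>))\<^sup>2)"
      using M_pos eta_pos[OF t \<omega>] by (intro mult_left_mono norm1_sq_le) auto
    finally show "(\<Sum>i\<in>UNIV. \<gamma> t \<omega> * Q (t - 1) \<omega> $ i) \<le> M * real CARD('k) * real t powr (\<delta> / 4) * qe t \<omega>"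
      by (simp add: qe_def mult_ac)
  qed (use M_pos in simp)
  also have "\<dots> = 2 * M\<^sup>2 * real CARD('k) * real t powr (\<delta> / 4) * (\<integral>\<omega>. qe t \<omega> \<partial>P)"
    using qe_integrable(1)[OF t] by (simp add: power2_eq_square)
  finally show "(\<integral>\<omega>. expl t \<omega> \<partial>P) \<le> 2 * M\<^sup>2 * real CARD('k) * real t powr (\<delta> / 4) * (\<integral>\<omega>. qe t \<omega> \<partial>P)" .
qed

end

section \<open>The drift inequality in expectation\<close>

text \<open>The negative power is distributed over the \<open>k\<close> factors: each logarithm is
  beaten by \<open>n powr (- (c / k))\<close>.\<close>

lemma ln_power_times_powr_tendsto_0:
  assumes "0 < c"
  shows "(\<lambda>n::nat. (a + b * ln (real n)) ^ k * real n powr (- c)) \<longlonglongrightarrow> 0"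
proof (cases "k = 0")
  case True
  then show ?thesis using assms by simp real_asymp
next
  case False
  define d where "d = c / real k"
  have d: "0 < d" using assms False by (simp add: d_def)
  have "(\<lambda>n::nat. a * real n powr (- d) + b * (ln (real n) * real n powr (- d))) \<longlonglongrightarrow> a * 0 + b * 0"
    using d by (intro tendsto_intros) real_asymp+
  then have "(\<lambda>n::nat. (a * real n powr (- d) + b * (ln (real n) * real n powr (- d))) ^ k) \<longlonglongrightarrow> 0 ^ k"
    using tendsto_power by force
  moreover have "\<forall>\<^sub>F n in sequentially. (a * real n powr (- d) + b * (ln (real n) * real n powr (- d))) ^ k
      = (a + b * ln (real n)) ^ k * real n powr (- c)"
    using eventually_gt_at_top[of 0]
  proof eventually_elim
    case (elim n)
    have "(real n powr (- d)) ^ k = real n powr (- c)"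
      using elim False by (simp add: d_def powr_realpow[symmetric] powr_powr)
    moreover have "a * real n powr (- d) + b * (ln (real n) * real n powr (- d))
        = (a + b * ln (real n)) * real n powr (- d)" by (simp add: algebra_simps)
    ultimately show ?case by (simp only: power_mult_distrib)
  qed
  ultimately show ?thesis using False by (simp add: tendsto_cong zero_power)
qed

context softmw_reference
begin

definition XE where "XE n = (\<Sum>t\<in>{1..n}. \<Sum>i\<in>UNIV. mQ (t - 1) i)"

lemma X_expectation: "has_bochner_integral P (X n) (XE n)"
proof -
  have "has_bochner_integral P (\<lambda>\<omega>. \<Sum>s<n. \<Sum>i\<in>UNIV. Q s \<omega> $ i) (\<Sum>s<n. \<Sum>i\<in>UNIV. mQ s i)"
    unfolding mQ_def by (intro has_bochner_integral_sum has_bochner_integral_integrable Q_integrable1)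
  moreover have "(\<Sum>s<n. \<Sum>i\<in>UNIV. mQ s i) = XE n"
    unfolding XE_def by (rule sum.reindex_bij_witness[of _ "\<lambda>t. t - 1" Suc]) auto
  moreover have "X n \<omega> = (\<Sum>s<n. \<Sum>i\<in>UNIV. Q s \<omega> $ i)" if "\<omega> \<in> space P" for \<omega>
    by (simp add: X_def norm1_Q[OF that])
  ultimately show ?thesis
    by (subst has_bochner_integral_cong[OF refl _ refl, rotated]) auto
qed

definition lg where "lg n = (ln (real CARD('k)) + 4 * ln (real n)) * (3 + 2 * C\<^sub>V)"

lemma lg_nonneg: "1 \<le> n \<Longrightarrow> 0 \<le> lg n"
  using CV K_ge by (auto simp: lg_def intro!: mult_nonneg_nonneg add_nonneg_nonneg)

lemma divergence_factor_le:
  assumes n: "1 \<le> n"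
  shows "- ln (\<beta> n) * (3 + 2 * C\<^sub>V * real n powr \<kappa>) \<le> lg n * real n powr \<kappa>"
proof -
  have ln: "- ln (\<beta> n) = ln (real CARD('k)) + 4 * ln (real n)"
    using n by (simp add: \<beta>_def softmw_\<beta>_def ln_div ln_powr)
  have "3 + 2 * C\<^sub>V * real n powr \<kappa> \<le> (3 + 2 * C\<^sub>V) * real n powr \<kappa>"
    using n kappa by (simp add: distrib_right ge_one_powr_ge_zero)
  then have "- ln (\<beta> n) * (3 + 2 * C\<^sub>V * real n powr \<kappa>) \<le> - ln (\<beta> n) * ((3 + 2 * C\<^sub>V) * real n powr \<kappa>)"
    using n K_ge unfolding ln by (intro mult_left_mono) auto
  then show ?thesis by (simp only: ln lg_def mult.assoc)
qed

lemma divergence_bound: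
  assumes n: "1 \<le> n" and \<omega>: "\<omega> \<in> space P" and "0 < \<rho>"
  shows "- ln (\<beta> n) * (3 + 2 * C\<^sub>V * real n powr \<kappa>) * Z n \<omega>
    \<le> \<rho> * X n \<omega> + 2 * real CARD('k) / \<rho> ^ 3 * (lg n * real n powr \<kappa>) ^ 4 * L n \<omega> ^ 5
      + lg n * real n powr \<kappa> * (10 * real CARD('k) ^ 3 * real n powr (3 / 4)) * (L n \<omega>)\<^sup>2"
proof -
  define c where "c = lg n * real n powr \<kappa>"
  have c: "0 \<le> c" using lg_nonneg[OF n] by (simp add: c_def)
  have "- ln (\<beta> n) * (3 + 2 * C\<^sub>V * real n powr \<kappa>) * Z n \<omega> \<le> c * Z n \<omega>"
    unfolding c_def using divergence_factor_le[OF n] Z_pos[OF n \<omega>] by (intro mult_right_mono) auto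
  also have "\<dots> \<le> c * (10 * real CARD('k) ^ 3 * real n powr (3 / 4) * (L n \<omega>)\<^sup>2 + L n \<omega> * U n \<omega>)"
    using c Z_le[OF \<omega> n] by (intro mult_left_mono)
  also have "\<dots> = c * (10 * real CARD('k) ^ 3 * real n powr (3 / 4)) * (L n \<omega>)\<^sup>2 + (c * L n \<omega>) * U n \<omega>"
    by (simp add: algebra_simps)
  also have "(c * L n \<omega>) * U n \<omega> \<le> \<rho> * X n \<omega> + 2 * real CARD('k) * (c * L n \<omega>) ^ 4 * L n \<omega> / \<rho> ^ 3"
    using c L_pos[OF \<omega>, of n] assms(3) by (intro scaled_U_le[OF \<omega>]) auto
  also have "2 * real CARD('k) * (c * L n \<omega>) ^ 4 * L n \<omega> / \<rho> ^ 3 = 2 * real CARD('k) / \<rho> ^ 3 * c ^ 4 * L n \<omega> ^ 5"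
    by (simp add: power_mult_distrib eval_nat_numeral)
  finally show ?thesis by (simp add: c_def)
qed

definition exploration_rem where
  "exploration_rem \<rho> n = 2 * real CARD('k) / \<rho> ^ 3 * (8 * M * real CARD('k) * real n powr (\<delta> / 4 + \<kappa>)) ^ 4"

lemma exploration_total:
  assumes n: "1 \<le> n" and "0 < \<rho>"
  shows "(\<Sum>t\<in>{1..n}. (\<integral>\<omega>. expl t \<omega> \<partial>P)) + (\<Sum>t\<in>{1..n}. (\<integral>\<omega>. 2 * \<eta> t \<omega> * ((reward t \<omega>)\<^sup>2 / p t \<omega> $ a t \<omega>) \<partial>P))
    \<le> \<rho> * XE n + exploration_rem \<rho> n * (C\<^sub>L * real n powr (1 / \<alpha>))"
proof -
  \<comment> \<open>Exploration and variance are both multiples of the mean of \<open>qe\<close>,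
    and each takes at most half of \<open>c\<close>.\<close>
  define c where "c = 4 * M\<^sup>2 * real CARD('k) * real n powr (\<delta> / 4)"
  have qe0: "0 \<le> (\<integral>\<omega>. qe t \<omega> \<partial>P)" if "1 \<le> t" for t
    using eta_pos[OF that] by (intro integral_nonneg_AE AE_I2) (auto simp: qe_def less_imp_le)
  have "(\<Sum>t\<in>{1..n}. (\<integral>\<omega>. expl t \<omega> \<partial>P)) + (\<Sum>t\<in>{1..n}. (\<integral>\<omega>. 2 * \<eta> t \<omega> * ((reward t \<omega>)\<^sup>2 / p t \<omega> $ a t \<omega>) \<partial>P))
      \<le> (\<Sum>t\<in>{1..n}. c * (\<integral>\<omega>. qe t \<omega> \<partial>P))"
    unfolding sum.distrib[symmetric]
  proof (rule sum_mono)
    fix t assume "t \<in> {1..n}"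
    then have t: "1 \<le> t" "t \<le> n" by auto
    have tn: "real t powr (\<delta> / 4) \<le> real n powr (\<delta> / 4)" using t delta by (intro powr_mono2) auto
    have n1: "1 \<le> real n powr (\<delta> / 4)" using n delta by (simp add: ge_one_powr_ge_zero)
    have "2 * M\<^sup>2 * real CARD('k) * real t powr (\<delta> / 4) \<le> 2 * M\<^sup>2 * real CARD('k) * real n powr (\<delta> / 4)"
      using tn by (intro mult_left_mono) auto
    moreover have "2 * M\<^sup>2 * (1 * 1) \<le> 2 * M\<^sup>2 * (real CARD('k) * real n powr (\<delta> / 4))"
      using n1 K_ge by (intro mult_left_mono mult_mono) auto
    ultimately have "2 * M\<^sup>2 * real CARD('k) * real t powr (\<delta> / 4) + 2 * M\<^sup>2 \<le> c"
      by (simp add: c_def mult.assoc)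
    then have "(2 * M\<^sup>2 * real CARD('k) * real t powr (\<delta> / 4) + 2 * M\<^sup>2) * (\<integral>\<omega>. qe t \<omega> \<partial>P) \<le> c * (\<integral>\<omega>. qe t \<omega> \<partial>P)"
      using qe0[OF t(1)] by (rule mult_right_mono)
    then show "(\<integral>\<omega>. expl t \<omega> \<partial>P) + (\<integral>\<omega>. 2 * \<eta> t \<omega> * ((reward t \<omega>)\<^sup>2 / p t \<omega> $ a t \<omega>) \<partial>P)
        \<le> c * (\<integral>\<omega>. qe t \<omega> \<partial>P)"
      using exploration_expectation(2)[OF t(1)] variance_expectation(2)[OF t(1)]
      unfolding distrib_right by linarith
  qed
  also have "\<dots> = (\<integral>\<omega>. c * (\<Sum>t\<in>{1..n}. qe t \<omega>) \<partial>P)"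
    using qe_integrable(1) by (simp add: Bochner_Integration.integral_sum sum_distrib_left)
  also have "\<dots> \<le> (\<integral>\<omega>. \<rho> * X n \<omega> + exploration_rem \<rho> n * L n \<omega> ^ 1 \<partial>P)"
  proof (rule integral_mono)
    show "integrable P (\<lambda>\<omega>. c * (\<Sum>t\<in>{1..n}. qe t \<omega>))"
      using qe_integrable(1) by (intro integrable_mult_right Bochner_Integration.integrable_sum) auto
    show "integrable P (\<lambda>\<omega>. \<rho> * X n \<omega> + exploration_rem \<rho> n * L n \<omega> ^ 1)"
      using X_expectation L_power_moment(1)[OF n, of 1] by (auto simp: has_bochner_integral_iff)
    fix \<omega> assume \<omega>: "\<omega> \<in> space P"
    have "c * (\<Sum>t\<in>{1..n}. qe t \<omega>) \<le> c * (2 * real n powr \<kappa> / M * U n \<omega>)"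
      unfolding qe_def using eta_sum[OF \<omega>] by (intro mult_left_mono) (auto simp: c_def)
    also have "\<dots> = (8 * M * real CARD('k) * real n powr (\<delta> / 4 + \<kappa>)) * U n \<omega>"
      using M_pos by (simp add: c_def powr_add power2_eq_square)
    also have "\<dots> \<le> \<rho> * X n \<omega> + 2 * real CARD('k) * (8 * M * real CARD('k) * real n powr (\<delta> / 4 + \<kappa>)) ^ 4 * L n \<omega> / \<rho> ^ 3"
      using M_pos assms(2) by (intro scaled_U_le[OF \<omega>]) auto
    finally show "c * (\<Sum>t\<in>{1..n}. qe t \<omega>) \<le> \<rho> * X n \<omega> + exploration_rem \<rho> n * L n \<omega> ^ 1"
      by (simp add: exploration_rem_def)
  qed
  also have "\<dots> = \<rho> * XE n + exploration_rem \<rho> n * (\<integral>\<omega>. L n \<omega> ^ 1 \<partial>P)"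
    using X_expectation[of n] L_power_moment(1)[OF n, of 1] by (simp add: has_bochner_integral_iff)
  also have "\<dots> \<le> \<rho> * XE n + exploration_rem \<rho> n * (C\<^sub>L * real n powr (1 / \<alpha>))"
    using L_power_moment(2)[OF n, of 1] assms(2)
    by (intro add_left_mono mult_left_mono) (auto simp: exploration_rem_def)
  finally show ?thesis .
qed

definition k5 where "k5 \<rho> n = 2 * real CARD('k) / \<rho> ^ 3 * (lg n * real n powr \<kappa>) ^ 4"

definition k2 where "k2 n = lg n * real n powr \<kappa> * (10 * real CARD('k) ^ 3 * real n powr (3 / 4))"

text \<open>The means of \<open>regret_sum\<close> and \<open>reward_drift\<close> combined. One
  share \<open>\<rho> * XE n\<close> comes from \<open>exploration_total\<close>, the other from
  \<open>divergence_bound\<close>; \<open>K * M\<^sup>2 * n\<close> is half the second moments of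
  arrivals and services.\<close>

lemma comparator_upper:
  assumes n: "1 \<le> n" and \<rho>: "0 < \<rho>"
  shows "(\<Sum>t\<in>{1..n}. \<Sum>i\<in>UNIV. y t $ i * (mQ (t - 1) i * mSc t i))
    \<le> (\<Sum>t\<in>{1..n}. \<Sum>i\<in>UNIV. mQ (t - 1) i * mA t i) + real CARD('k) * M\<^sup>2 * real n + 2 * \<rho> * XE n
      + exploration_rem \<rho> n * (C\<^sub>L * real n powr (1 / \<alpha>))
      + k5 \<rho> n * (C\<^sub>L * real n powr (5 / \<alpha>)) + k2 n * (C\<^sub>L * real n powr (2 / \<alpha>))"
proof -
  define f where "f \<omega> = (\<Sum>t\<in>{1..n}. y t $ a t \<omega> * (reward t \<omega> / p t \<omega> $ a t \<omega>))" for \<omega>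
  define g1 where "g1 \<omega> = (\<Sum>t\<in>{1..n}. \<Sum>i\<in>UNIV. Q (t - 1) \<omega> $ i * A t \<omega> $ i)" for \<omega>
  define g2 where "g2 \<omega> = (\<Sum>t\<in>{1..n}. \<Sum>i\<in>UNIV. (A t \<omega> $ i)\<^sup>2 + (S t \<omega> $ i)\<^sup>2)" for \<omega>
  define g3 where "g3 \<omega> = (\<Sum>t\<in>{1..n}. expl t \<omega>)" for \<omega>
  define g4 where "g4 \<omega> = (\<Sum>t\<in>{1..n}. 2 * \<eta> t \<omega> * ((reward t \<omega>)\<^sup>2 / p t \<omega> $ a t \<omega>))" for \<omega>
  define g5 where "g5 \<omega> = \<rho> * X n \<omega> + k5 \<rho> n * L n \<omega> ^ 5 + k2 n * (L n \<omega>)\<^sup>2" for \<omega>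
  have f: "has_bochner_integral P f (\<Sum>t\<in>{1..n}. \<Sum>i\<in>UNIV. y t $ i * (mQ (t - 1) i * mSc t i))"
    unfolding f_def
    by (rule has_bochner_integral_sum) (use comparator_expectation in auto)
  have g1: "has_bochner_integral P g1 (\<Sum>t\<in>{1..n}. \<Sum>i\<in>UNIV. mQ (t - 1) i * mA t i)"
    unfolding g1_def
  proof (intro has_bochner_integral_sum)
    fix t :: nat and i :: 'k assume "t \<in> {1..n}"
    then have t: "1 \<le> t" by simp
    from past_env_integral[OF t Q_past[OF t] Q_integrable1 A_S_env(1)[OF t] AS_integrable(1)[OF t]]
    show "has_bochner_integral P (\<lambda>\<omega>. Q (t - 1) \<omega> $ i * A t \<omega> $ i) (mQ (t - 1) i * mA t i)"
      unfolding has_bochner_integral_iff mQ_def mA_def by blast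
  qed
  define v where "v = (\<Sum>t\<in>{1..n}. \<Sum>i\<in>UNIV. (\<integral>\<omega>. (A t \<omega> $ i)\<^sup>2 \<partial>P) + (\<integral>\<omega>. (S t \<omega> $ i)\<^sup>2 \<partial>P))"
  note sq = moment_bounds[of _ 2, simplified]
  have g2: "has_bochner_integral P g2 v"
    unfolding g2_def v_def using sq
    by (intro has_bochner_integral_sum has_bochner_integral_add has_bochner_integral_integrable) auto
  have v: "v \<le> 2 * (real CARD('k) * M\<^sup>2 * real n)"
  proof -
    have "v \<le> (\<Sum>t\<in>{1..n}. \<Sum>i\<in>(UNIV :: 'k set). M\<^sup>2 + M\<^sup>2)"
      unfolding v_def using sq by (intro sum_mono add_mono) auto
    then show ?thesis by (simp add: mult_ac)
  qed
  have g3: "has_bochner_integral P g3 (\<Sum>t\<in>{1..n}. (\<integral>\<omega>. expl t \<omega> \<partial>P))"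
    unfolding g3_def using exploration_expectation(1)
    by (intro has_bochner_integral_sum has_bochner_integral_integrable) auto
  have g4: "has_bochner_integral P g4
      (\<Sum>t\<in>{1..n}. (\<integral>\<omega>. 2 * \<eta> t \<omega> * ((reward t \<omega>)\<^sup>2 / p t \<omega> $ a t \<omega>) \<partial>P))"
    unfolding g4_def using variance_expectation(1)
    by (intro has_bochner_integral_sum has_bochner_integral_integrable) auto
  have g5: "has_bochner_integral P g5 (\<rho> * XE n + k5 \<rho> n * (\<integral>\<omega>. L n \<omega> ^ 5 \<partial>P) + k2 n * (\<integral>\<omega>. (L n \<omega>)\<^sup>2 \<partial>P))"
    unfolding g5_def using L_power_moment(1)[OF n]
    by (intro has_bochner_integral_add has_bochner_integral_mult_right has_bochner_integral_integrable
        X_expectation) auto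
  have g: "has_bochner_integral P (\<lambda>\<omega>. g1 \<omega> + 1 / 2 * g2 \<omega> + g3 \<omega> + g4 \<omega> + g5 \<omega>)
      ((\<Sum>t\<in>{1..n}. \<Sum>i\<in>UNIV. mQ (t - 1) i * mA t i) + 1 / 2 * v + (\<Sum>t\<in>{1..n}. (\<integral>\<omega>. expl t \<omega> \<partial>P))
       + (\<Sum>t\<in>{1..n}. (\<integral>\<omega>. 2 * \<eta> t \<omega> * ((reward t \<omega>)\<^sup>2 / p t \<omega> $ a t \<omega>) \<partial>P))
       + (\<rho> * XE n + k5 \<rho> n * (\<integral>\<omega>. L n \<omega> ^ 5 \<partial>P) + k2 n * (\<integral>\<omega>. (L n \<omega>)\<^sup>2 \<partial>P)))"
    by (intro has_bochner_integral_add has_bochner_integral_mult_right g1 g2 g3 g4 g5)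
  have "AE \<omega> in P. f \<omega> \<le> g1 \<omega> + 1 / 2 * g2 \<omega> + g3 \<omega> + g4 \<omega> + g5 \<omega>"
    using env_nonneg AE_space
  proof eventually_elim
    case (elim \<omega>)
    then have A0: "\<And>t i. 1 \<le> t \<Longrightarrow> 0 \<le> A t \<omega> $ i" and S0: "\<And>t i. 1 \<le> t \<Longrightarrow> 0 \<le> S t \<omega> $ i"
      and \<omega>: "\<omega> \<in> space P" by auto
    have "(\<Sum>t\<in>{1..n}. 2 * \<gamma> t \<omega> * reward t \<omega>) \<le> g3 \<omega>"
      unfolding g3_def by (intro sum_mono exploration_le \<omega> S0) auto
    moreover have "- ln (\<beta> n) * (3 + 2 * C\<^sub>V * real n powr \<kappa>) * Z n \<omega> \<le> g5 \<omega>"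
      unfolding g5_def k5_def k2_def by (rule divergence_bound[OF n \<omega> \<rho>])
    ultimately show ?case
      using regret_sum[OF n \<omega> S0] reward_drift[OF \<omega> S0 A0, of n]
      unfolding f_def g1_def g2_def g4_def by linarith
  qed
  then have "(\<integral>\<omega>. f \<omega> \<partial>P) \<le> (\<integral>\<omega>. g1 \<omega> + 1 / 2 * g2 \<omega> + g3 \<omega> + g4 \<omega> + g5 \<omega> \<partial>P)"
    using f g by (intro integral_mono_AE) (auto simp: has_bochner_integral_iff)
  then have "(\<Sum>t\<in>{1..n}. \<Sum>i\<in>UNIV. y t $ i * (mQ (t - 1) i * mSc t i))
    \<le> (\<Sum>t\<in>{1..n}. \<Sum>i\<in>UNIV. mQ (t - 1) i * mA t i) + 1 / 2 * v + (\<Sum>t\<in>{1..n}. (\<integral>\<omega>. expl t \<omega> \<partial>P))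
       + (\<Sum>t\<in>{1..n}. (\<integral>\<omega>. 2 * \<eta> t \<omega> * ((reward t \<omega>)\<^sup>2 / p t \<omega> $ a t \<omega>) \<partial>P))
       + (\<rho> * XE n + k5 \<rho> n * (\<integral>\<omega>. L n \<omega> ^ 5 \<partial>P) + k2 n * (\<integral>\<omega>. (L n \<omega>)\<^sup>2 \<partial>P))"
    unfolding has_bochner_integral_integral_eq[OF f] has_bochner_integral_integral_eq[OF g] .
  moreover have "k5 \<rho> n * (\<integral>\<omega>. L n \<omega> ^ 5 \<partial>P) \<le> k5 \<rho> n * (C\<^sub>L * real n powr (5 / \<alpha>))"
    using L_power_moment(2)[OF n, of 5] \<rho> by (intro mult_left_mono) (auto simp: k5_def)
  moreover have "k2 n * (\<integral>\<omega>. (L n \<omega>)\<^sup>2 \<partial>P) \<le> k2 n * (C\<^sub>L * real n powr (2 / \<alpha>))"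
    using L_power_moment(2)[OF n, of 2] lg_nonneg[OF n] by (intro mult_left_mono) (auto simp: k2_def)
  ultimately show ?thesis using v exploration_total[OF n \<rho>] by linarith
qed

text \<open>Clipping loses at most \<open>M * c\<close> of the mean service and mixing at most
  \<open>b * M\<close>, where \<open>b \<le> c\<close>. Multiplying by the crude bound t M for the
  mean queue length turns c = t powr (-3/2) into t powr (-1/2), whose sum is of order sqrt
  n.\<close>

lemma comparator_lower:
  assumes t: "1 \<le> t"
  shows "(\<Sum>i\<in>UNIV. mQ (t - 1) i * (\<theta> t $ i * mS t i)) - 2 * M\<^sup>2 * real t powr (- (1 / 2))
    \<le> (\<Sum>i\<in>UNIV. y t $ i * (mQ (t - 1) i * mSc t i))"
proof -
  define b c where "b = real t powr (- 4)" and "c = real t powr (- (3 / 2))"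
  have bc: "0 \<le> b" "b \<le> 1" "b \<le> c" "0 \<le> c"
    using powr_neg4[OF t] t by (auto simp: b_def c_def powr_mono)
  have tc: "real t * c = real t powr (- (1 / 2))"
    using t by (simp add: c_def powr_mult_base)
  have coord: "mQ (t - 1) i * (\<theta> t $ i * mS t i) - \<theta> t $ i * (2 * M\<^sup>2 * (real t * c))
      \<le> y t $ i * (mQ (t - 1) i * mSc t i)" for i
  proof -
    define q s th where "q = mQ (t - 1) i" and "s = mS t i" and "th = \<theta> t $ i"
    have th: "0 \<le> th" using theta_bounds(1)[OF t] by (simp add: th_def)
    have s: "0 \<le> s" "s \<le> M" using mA_mS_bounds[OF t] by (auto simp: s_def)
    have q: "0 \<le> q" "q \<le> real t * M"
    proof -
      have "q \<le> real (t - 1) * M" by (simp add: q_def mQ_le)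
      also have "\<dots> \<le> real t * M" using M_pos by (intro mult_right_mono) auto
      finally show "q \<le> real t * M" .
    qed (simp add: q_def mQ_nonneg)
    have "s - 2 * M * c \<le> (1 - b) * mSc t i"
    proof -
      have "(1 - b) * (s - M * c) \<le> (1 - b) * mSc t i"
        using mSc_ge(1)[OF t, of i] bc unfolding s_def c_def by (intro mult_left_mono) auto
      moreover have "b * s \<le> c * M" using bc s by (intro mult_mono) auto
      moreover have "0 \<le> b * (M * c)" using bc M_pos by simp
      ultimately show ?thesis by (simp add: algebra_simps)
    qed
    then have "th * q * (s - 2 * M * c) \<le> th * q * ((1 - b) * mSc t i)"
      using th q by (intro mult_left_mono) auto
    also have "\<dots> = ((1 - b) * th) * (q * mSc t i)" by (simp add: mult_ac)
    also have "\<dots> \<le> y t $ i * (q * mSc t i)"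
      using bc q mSc_ge(2)[OF t] by (intro mult_right_mono) (auto simp: y_def th_def b_def)
    finally have 1: "th * q * s - th * (q * (2 * M * c)) \<le> y t $ i * (q * mSc t i)"
      by (simp add: right_diff_distrib mult_ac)
    have "th * (q * (2 * M * c)) \<le> th * ((real t * M) * (2 * M * c))"
      using th q bc M_pos by (intro mult_left_mono mult_right_mono) auto
    then have "th * (q * (2 * M * c)) \<le> th * (2 * M\<^sup>2 * (real t * c))"
      by (simp add: power2_eq_square mult_ac)
    with 1 show ?thesis by (simp add: q_def s_def th_def mult_ac)
  qed
  have "(\<Sum>i\<in>UNIV. mQ (t - 1) i * (\<theta> t $ i * mS t i)) - 2 * M\<^sup>2 * real t powr (- (1 / 2))
      = (\<Sum>i\<in>UNIV. mQ (t - 1) i * (\<theta> t $ i * mS t i) - \<theta> t $ i * (2 * M\<^sup>2 * (real t * c)))"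
    unfolding tc sum_subtractf sum_distrib_right[symmetric] theta_bounds(2)[OF t] by simp
  also have "\<dots> \<le> (\<Sum>i\<in>UNIV. y t $ i * (mQ (t - 1) i * mSc t i))" by (intro sum_mono coord)
  finally show ?thesis .
qed

definition remainder where
  "remainder \<rho> n = 4 * M\<^sup>2 * sqrt (real n) + exploration_rem \<rho> n * (C\<^sub>L * real n powr (1 / \<alpha>))
      + k5 \<rho> n * (C\<^sub>L * real n powr (5 / \<alpha>)) + k2 n * (C\<^sub>L * real n powr (2 / \<alpha>))"

lemma drift_inequality:
  assumes n: "1 \<le> n" and \<rho>: "0 < \<rho>"
  shows "(\<Sum>t\<in>{1..n}. \<Sum>i\<in>UNIV. mQ (t - 1) i * (\<theta> t $ i * mS t i - mA t i))
    \<le> real CARD('k) * M\<^sup>2 * real n + 2 * \<rho> * XE n + remainder \<rho> n"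
proof -
  have "(\<Sum>t\<in>{1..n}. (\<Sum>i\<in>UNIV. mQ (t - 1) i * (\<theta> t $ i * mS t i)) - 2 * M\<^sup>2 * real t powr (- (1 / 2)))
      \<le> (\<Sum>t\<in>{1..n}. \<Sum>i\<in>UNIV. y t $ i * (mQ (t - 1) i * mSc t i))"
    by (intro sum_mono comparator_lower) auto
  then have "(\<Sum>t\<in>{1..n}. \<Sum>i\<in>UNIV. mQ (t - 1) i * (\<theta> t $ i * mS t i))
      - 2 * M\<^sup>2 * (\<Sum>t\<in>{1..n}. real t powr (- (1 / 2)))
      \<le> (\<Sum>t\<in>{1..n}. \<Sum>i\<in>UNIV. y t $ i * (mQ (t - 1) i * mSc t i))"
    by (simp only: sum_subtractf sum_distrib_left)
  moreover have "2 * M\<^sup>2 * (\<Sum>t\<in>{1..n}. real t powr (- (1 / 2))) \<le> 2 * M\<^sup>2 * (2 * sqrt (real n))"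
    by (intro mult_left_mono sum_powr_neg_half_le) auto
  moreover have "(\<Sum>t\<in>{1..n}. \<Sum>i\<in>UNIV. mQ (t - 1) i * (\<theta> t $ i * mS t i - mA t i))
      = (\<Sum>t\<in>{1..n}. \<Sum>i\<in>UNIV. mQ (t - 1) i * (\<theta> t $ i * mS t i))
        - (\<Sum>t\<in>{1..n}. \<Sum>i\<in>UNIV. mQ (t - 1) i * mA t i)"
    by (simp only: right_diff_distrib sum_subtractf)
  ultimately show ?thesis using comparator_upper[OF n \<rho>] unfolding remainder_def by linarith
qed

text \<open>Since 4 \<kappa> = 1 - 2 \<delta>, the three coefficients grow, up to logarithms, like n
  to the powers 1 - \<delta>, 1 - 2 \<delta> and 1 - \<delta>/2, and the moments of \<open>L\<close>
  add 1/\<alpha>, 5/\<alpha> and 2/\<alpha> respectively. All totals are below 1 because 1/\<alpha>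
  < \<delta>/7.\<close>

lemma remainder_sublinear:
  assumes "0 < \<rho>"
  shows "(\<lambda>n. remainder \<rho> n / real n) \<longlonglongrightarrow> 0"
proof -
  have a0: "0 < \<alpha>" using alpha by simp
  have "1 / \<alpha> < \<delta> / 7" using delta_alpha a0 by (simp add: field_simps)
  then have e: "0 < \<delta> - 1 / \<alpha>" "0 < 2 * \<delta> - 5 / \<alpha>" "0 < \<delta> / 2 - 2 / \<alpha>"
    using delta by linarith+
  define c5 c2 c1 where "c5 = 2 * real CARD('k) / \<rho> ^ 3 * (3 + 2 * C\<^sub>V) ^ 4 * C\<^sub>L"
    and "c2 = 10 * real CARD('k) ^ 3 * (3 + 2 * C\<^sub>V) * C\<^sub>L"
    and "c1 = 2 * real CARD('k) / \<rho> ^ 3 * (8 * M * real CARD('k)) ^ 4 * C\<^sub>L"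
  define lk where "lk = ln (real CARD('k))"
  have "(\<lambda>n::nat. 4 * M\<^sup>2 * real n powr (- (1 / 2)) + c1 * real n powr (- (\<delta> - 1 / \<alpha>))
      + c5 * ((lk + 4 * ln (real n)) ^ 4 * real n powr (- (2 * \<delta> - 5 / \<alpha>)))
      + c2 * ((lk + 4 * ln (real n)) ^ 1 * real n powr (- (\<delta> / 2 - 2 / \<alpha>))))
      \<longlonglongrightarrow> 4 * M\<^sup>2 * 0 + c1 * 0 + c5 * 0 + c2 * 0"
  proof (intro tendsto_intros ln_power_times_powr_tendsto_0 e)
    show "(\<lambda>n::nat. real n powr (- (1 / 2))) \<longlonglongrightarrow> 0" by real_asymp
    show "(\<lambda>n::nat. real n powr (- (\<delta> - 1 / \<alpha>))) \<longlonglongrightarrow> 0"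
      using ln_power_times_powr_tendsto_0[OF e(1), of 1 0 0] by simp
  qed
  moreover have "\<forall>\<^sub>F n in sequentially. 4 * M\<^sup>2 * real n powr (- (1 / 2)) + c1 * real n powr (- (\<delta> - 1 / \<alpha>))
      + c5 * ((lk + 4 * ln (real n)) ^ 4 * real n powr (- (2 * \<delta> - 5 / \<alpha>)))
      + c2 * ((lk + 4 * ln (real n)) ^ 1 * real n powr (- (\<delta> / 2 - 2 / \<alpha>)))
      = remainder \<rho> n / real n"
    using eventually_gt_at_top[of 0]
  proof eventually_elim
    case (elim n)
    define N where "N = real n"
    have N: "0 < N" using elim by (simp add: N_def)
    have pw: "(N powr r) ^ 4 = N powr (4 * r)" for r
      using N by (simp add: powr_realpow[symmetric] powr_powr mult.commute)
    have "sqrt N / N = N powr (- (1 / 2))"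
      using N by (simp add: powr_half_sqrt[symmetric] powr_minus_divide real_div_sqrt[symmetric] field_simps)
        (simp add: powr_half_sqrt)
    moreover have "(N powr (\<delta> / 4 + \<kappa>)) ^ 4 * N powr (1 / \<alpha>) / N = N powr (- (\<delta> - 1 / \<alpha>))"
    proof -
      have "4 * (\<delta> / 4 + \<kappa>) + 1 / \<alpha> - 1 = - (\<delta> - 1 / \<alpha>)" by (simp add: \<kappa>_def field_simps)
      then show ?thesis using N by (metis powr_add powr_diff powr_one less_imp_le pw)
    qed
    moreover have "(N powr \<kappa>) ^ 4 * N powr (5 / \<alpha>) / N = N powr (- (2 * \<delta> - 5 / \<alpha>))"
    proof -
      have "4 * \<kappa> + 5 / \<alpha> - 1 = - (2 * \<delta> - 5 / \<alpha>)" by (simp add: \<kappa>_def field_simps)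
      then show ?thesis using N by (metis powr_add powr_diff powr_one less_imp_le pw)
    qed
    moreover have "N powr \<kappa> * N powr (3 / 4) * N powr (2 / \<alpha>) / N = N powr (- (\<delta> / 2 - 2 / \<alpha>))"
    proof -
      have "\<kappa> + 3 / 4 + 2 / \<alpha> - 1 = - (\<delta> / 2 - 2 / \<alpha>)" by (simp add: \<kappa>_def field_simps)
      then show ?thesis using N by (metis powr_add powr_diff powr_one less_imp_le)
    qed
    moreover have "remainder \<rho> n / N = 4 * M\<^sup>2 * (sqrt N / N)
        + c1 * ((N powr (\<delta> / 4 + \<kappa>)) ^ 4 * N powr (1 / \<alpha>) / N)
        + c5 * ((lk + 4 * ln N) ^ 4 * ((N powr \<kappa>) ^ 4 * N powr (5 / \<alpha>) / N))
        + c2 * ((lk + 4 * ln N) ^ 1 * (N powr \<kappa> * N powr (3 / 4) * N powr (2 / \<alpha>) / N))"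
      unfolding remainder_def exploration_rem_def k5_def k2_def lg_def c1_def c2_def c5_def lk_def
        N_def[symmetric] add_divide_distrib power_mult_distrib
      by (simp add: mult_ac)
    ultimately show ?case unfolding N_def by simp
  qed
  ultimately show ?thesis by (simp add: tendsto_cong)
qed

section \<open>The time-averaged queue length\<close>

lemma averaged_queue_bound:
  assumes pw: "piecewise_stabilizable \<A> \<S> C\<^sub>W \<epsilon> \<theta>"
  shows "\<forall>\<^sub>F T in sequentially. (\<Sum>t\<in>{1..T}. \<Sum>i\<in>UNIV. mQ t i)
    \<le> (2 * (real CARD('k) + 1) * M\<^sup>2 + 4 * C\<^sub>W * (real CARD('k) * M\<^sup>2 + \<epsilon> * real CARD('k) * M)) / \<epsilon> * real T"
proof -
  obtain W where W: "interval_partition W"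
    and CW: "\<And>T::nat. 1 \<le> T \<Longrightarrow> (\<Sum>i\<in>{i. Min (W i) < T}. (real (card (W i)) - 1)\<^sup>2) \<le> C\<^sub>W * real T"
    and avg: "\<And>i j. 1 / real (card (W i)) * (\<Sum>t\<in>W i. \<theta> t $ j * mean_vec (\<S> t) $ j)
           \<ge> \<epsilon> + 1 / real (card (W i)) * (\<Sum>t\<in>W i. mean_vec (\<A> t) $ j)"
    and C0: "0 \<le> C\<^sub>W" and e0: "0 < \<epsilon>"
    using pw by (auto simp: piecewise_stabilizable_def)
  define f where "f j t = \<theta> t $ j * mS t j - mA t j" for j t
  define Kr where "Kr = real CARD('k)"
  have f: "\<bar>f j t\<bar> \<le> M" if t: "1 \<le> t" for j t
  proof -
    have "\<theta> t $ j * mS t j \<le> 1 * M"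
      by (rule mult_mono) (use theta_bounds[OF t] mA_mS_bounds[OF t] in auto)
    moreover have "0 \<le> \<theta> t $ j * mS t j" using theta_bounds[OF t] mA_mS_bounds[OF t] by simp
    ultimately show ?thesis using mA_mS_bounds[OF t, of j] unfolding f_def by linarith
  qed
  have avgf: "\<epsilon> \<le> 1 / real (card (W i)) * (\<Sum>t\<in>W i. f j t)" for i j
  proof -
    have "1 \<le> t" if "t \<in> W i" for t using W that by (auto simp: interval_partition_def)
    then have "(\<Sum>t\<in>W i. f j t) = (\<Sum>t\<in>W i. \<theta> t $ j * mean_vec (\<S> t) $ j) - (\<Sum>t\<in>W i. mean_vec (\<A> t) $ j)"
      unfolding f_def sum_subtractf[symmetric] by (intro sum.cong) (auto simp: mean_vec_eq)
    then show ?thesis using avg[of i j] by (simp add: right_diff_distrib)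
  qed
  \<comment> \<open>The stated constant leaves a slack of M^2 per slot. A quarter of it is reserved
    for the remainder; the rest pays for the overshoot of \<open>n\<close> beyond \<open>T\<close>,
    whose ratio tends to 1 and is eventually below (K + 1) / (K + 1/4).\<close>
  have "\<forall>\<^sub>F n in sequentially. remainder (\<epsilon> / 4) n / real n < M\<^sup>2 / 4"
    using remainder_sublinear[of "\<epsilon> / 4"] e0 M_pos by (intro order_tendstoD(2)) auto
  then obtain N where N: "\<And>n. N \<le> n \<Longrightarrow> remainder (\<epsilon> / 4) n / real n < M\<^sup>2 / 4"
    by (auto simp: eventually_sequentially)
  have "(\<lambda>T::nat. 1 + 1 / real T + sqrt (C\<^sub>W * (1 / real T + 2 * (1 / real T * (1 / real T))))) \<longlonglongrightarrow> 1 + 0 + sqrt (C\<^sub>W * (0 + 2 * (0 * 0)))"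
    by (intro tendsto_intros lim_1_over_n)
  then have "(\<lambda>T::nat. 1 + 1 / real T + sqrt (C\<^sub>W * (1 / real T + 2 * (1 / real T * (1 / real T))))) \<longlonglongrightarrow> 1" by simp
  moreover have "1 < (Kr + 1) / (Kr + 1 / 4)" by (simp add: Kr_def field_simps)
  ultimately have "\<forall>\<^sub>F T::nat in sequentially.
      1 + 1 / real T + sqrt (C\<^sub>W * (1 / real T + 2 * (1 / real T * (1 / real T)))) < (Kr + 1) / (Kr + 1 / 4)"
    by (rule order_tendstoD(2))
  then show ?thesis
    using eventually_ge_at_top[of "max N 2"]
  proof eventually_elim
    case (elim T)
    have T: "2 \<le> T" "N \<le> T" using elim by auto
    \<comment> \<open>The windows are applied at \<open>T + 1\<close> because \<open>XE n\<close>
      sums the queues of the slots 0 to n - 1, and slot \<open>T\<close> must be included.\<close>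
    obtain n where n: "T + 1 \<le> n" "real n \<le> real (T + 1) + sqrt (C\<^sub>W * real (T + 1 + 1))"
      and drift: "\<And>j. \<epsilon> * (\<Sum>t\<in>{1..n}. mQ (t - 1) j)
      \<le> (\<Sum>t\<in>{1..n}. mQ (t - 1) j * f j t) + (M\<^sup>2 + \<epsilon> * M) * (C\<^sub>W * real (T + 1 + 1))"
      using windows_drift[where m = "\<lambda>j t. mQ t j" and f = f and T = "T + 1" and M = M and \<epsilon> = \<epsilon>,
          OF W CW less_imp_le[OF M_pos] less_imp_le[OF e0] mQ_nonneg mQ_increment f avgf le_add2]
      by blast
    have XE: "(\<Sum>j\<in>UNIV. \<Sum>t\<in>{1..n}. mQ (t - 1) j) = XE n"
      unfolding XE_def by (rule sum.swap)
    have fl: "(\<Sum>j\<in>UNIV. \<Sum>t\<in>{1..n}. mQ (t - 1) j * f j t)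
        = (\<Sum>t\<in>{1..n}. \<Sum>j\<in>UNIV. mQ (t - 1) j * (\<theta> t $ j * mS t j - mA t j))"
      unfolding f_def by (rule sum.swap)
    have "(\<Sum>j\<in>UNIV. \<epsilon> * (\<Sum>t\<in>{1..n}. mQ (t - 1) j)) \<le> (\<Sum>j\<in>UNIV. (\<Sum>t\<in>{1..n}. mQ (t - 1) j * f j t)
        + (M\<^sup>2 + \<epsilon> * M) * (C\<^sub>W * real (T + 1 + 1)))"
      by (intro sum_mono drift)
    also have "(\<Sum>j\<in>UNIV. \<epsilon> * (\<Sum>t\<in>{1..n}. mQ (t - 1) j)) = \<epsilon> * XE n"
      unfolding XE[symmetric] by (simp only: sum_distrib_left)
    also have "(\<Sum>j\<in>UNIV. (\<Sum>t\<in>{1..n}. mQ (t - 1) j * f j t) + (M\<^sup>2 + \<epsilon> * M) * (C\<^sub>W * real (T + 1 + 1)))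
       = (\<Sum>t\<in>{1..n}. \<Sum>j\<in>UNIV. mQ (t - 1) j * (\<theta> t $ j * mS t j - mA t j))
         + Kr * ((M\<^sup>2 + \<epsilon> * M) * (C\<^sub>W * real (T + 1 + 1)))"
      unfolding sum.distrib fl Kr_def by simp
    finally have 1: "\<epsilon> * XE n \<le> (\<Sum>t\<in>{1..n}. \<Sum>j\<in>UNIV. mQ (t - 1) j * (\<theta> t $ j * mS t j - mA t j))
         + Kr * ((M\<^sup>2 + \<epsilon> * M) * (C\<^sub>W * real (T + 1 + 1)))" .
    have 2: "(\<Sum>t\<in>{1..n}. \<Sum>j\<in>UNIV. mQ (t - 1) j * (\<theta> t $ j * mS t j - mA t j))
      \<le> Kr * M\<^sup>2 * real n + 2 * (\<epsilon> / 4) * XE n + remainder (\<epsilon> / 4) n"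
      unfolding Kr_def using n T e0 by (intro drift_inequality) auto
    have 3: "remainder (\<epsilon> / 4) n \<le> M\<^sup>2 / 4 * real n"
      using N[of n] n T by (simp add: divide_less_eq)
    have 4: "Kr * M\<^sup>2 * real n + M\<^sup>2 / 4 * real n \<le> (Kr + 1) * M\<^sup>2 * real T"
    proof -
      have "sqrt (C\<^sub>W * real (T + 1 + 1)) = real T * sqrt (C\<^sub>W * (1 / real T + 2 * (1 / real T * (1 / real T))))"
      proof -
        have "C\<^sub>W * real (T + 1 + 1) = (real T)\<^sup>2 * (C\<^sub>W * (1 / real T + 2 * (1 / real T * (1 / real T))))"
          using T by (simp add: field_simps power2_eq_square)
        then show ?thesis
          by (simp only: real_sqrt_mult[of "(real T)\<^sup>2"] real_sqrt_abs abs_of_nat)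
      qed
      then have "real n \<le> real T * (1 + 1 / real T + sqrt (C\<^sub>W * (1 / real T + 2 * (1 / real T * (1 / real T)))))"
        using n(2) T by (simp add: distrib_left)
      also have "\<dots> \<le> real T * ((Kr + 1) / (Kr + 1 / 4))"
        using elim by (intro mult_left_mono) auto
      finally have "real n * (Kr + 1 / 4) \<le> real T * (Kr + 1)"
        by (simp add: Kr_def pos_le_divide_eq add_pos_nonneg)
      then have "M\<^sup>2 * (real n * (Kr + 1 / 4)) \<le> M\<^sup>2 * (real T * (Kr + 1))" by (intro mult_left_mono) auto
      then show ?thesis by (simp add: algebra_simps)
    qed
    \<comment> \<open>\<open>2 \<le> T\<close> gives T + 2 at most 2 T. Together with the factor 2
      from moving half of \<open>\<epsilon> * XE n\<close> to the left, this produces the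
      coefficient 4 of \<open>C\<^sub>W\<close>.\<close>
    have 5: "Kr * ((M\<^sup>2 + \<epsilon> * M) * (C\<^sub>W * real (T + 1 + 1))) \<le> Kr * ((M\<^sup>2 + \<epsilon> * M) * (C\<^sub>W * (2 * real T)))"
      using T e0 M_pos C0 by (intro mult_left_mono) (auto simp: Kr_def)
    have "(\<Sum>t\<in>{1..T}. \<Sum>i\<in>UNIV. mQ t i) \<le> XE n"
    proof -
      have "(\<Sum>t\<in>{1..T}. \<Sum>i\<in>UNIV. mQ t i) = (\<Sum>t\<in>{2..T + 1}. \<Sum>i\<in>UNIV. mQ (t - 1) i)"
        by (rule sum.reindex_bij_witness[of _ "\<lambda>t. t - 1" Suc]) auto
      also have "\<dots> \<le> XE n"
        unfolding XE_def using n by (intro sum_mono2 sum_nonneg mQ_nonneg) auto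
      finally show ?thesis .
    qed
    moreover have "\<epsilon> * XE n \<le> (2 * (Kr + 1) * M\<^sup>2 + 4 * C\<^sub>W * (Kr * M\<^sup>2 + \<epsilon> * Kr * M)) * real T"
    proof -
      have "\<epsilon> * XE n \<le> 2 * ((Kr + 1) * M\<^sup>2 * real T + Kr * ((M\<^sup>2 + \<epsilon> * M) * (C\<^sub>W * (2 * real T))))"
      proof -
        have arith: "E \<le> 2 * (c + w')"
          if "E \<le> D + w" "D \<le> b + E / 2 + r" "r \<le> b'" "b + b' \<le> c" "w \<le> w'"
          for E D w w' b r b' c :: real using that by argo
        have "2 * (\<epsilon> / 4) * XE n = \<epsilon> * XE n / 2" by simp
        from arith[OF 1 2[unfolded this] 3 4 5] show ?thesis .
      qed
      then show ?thesis by (simp add: algebra_simps)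
    qed
    then have "XE n \<le> (2 * (Kr + 1) * M\<^sup>2 + 4 * C\<^sub>W * (Kr * M\<^sup>2 + \<epsilon> * Kr * M)) / \<epsilon> * real T"
      using e0 by (simp add: field_simps)
    ultimately show ?case unfolding Kr_def by linarith
  qed
qed

end

theorem theorem7p1:
  fixes P :: "'w measure"
    and \<A> \<S> :: "nat \<Rightarrow> (real ^ 'k) measure"
    and A S Q x p e :: "nat \<Rightarrow> 'w \<Rightarrow> real ^ 'k"
    and a :: "nat \<Rightarrow> 'w \<Rightarrow> 'k"
    and L :: "nat \<Rightarrow> 'w \<Rightarrow> real"
    and \<theta> :: "nat \<Rightarrow> real ^ 'k"
    and C\<^sub>W C\<^sub>V \<epsilon> \<delta> \<alpha> M K :: real
  assumes "softmw_plus P \<A> \<S> A S a Q M \<delta> x p e L"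
    and "piecewise_stabilizable \<A> \<S> C\<^sub>W \<epsilon> \<theta>"
    and "reference_stationary \<delta> C\<^sub>V \<theta>"
    and "bounded_moments P A S a Q \<alpha> M"
    and "\<alpha> > 14"
    and "0 < \<delta>" and "\<delta> \<le> 1 / 2"
    and "\<delta> * \<alpha> > 7"
    and "K = real CARD('k)"
  shows "(\<exists>r :: nat \<Rightarrow> real. r \<in> o(\<lambda>_. 1) \<and>
            (\<forall>T\<ge>1. 1 / real T * (\<integral>\<omega>. (\<Sum>t\<in>{1..T}. norm1 (Q t \<omega>)) \<partial>P)
               \<le> (2 * (K + 1) * M\<^sup>2 + 4 * C\<^sub>W * (K * M\<^sup>2 + \<epsilon> * K * M)) / \<epsilon> + r T))
         \<and> stable P Q"
proof -
  interpret softmw_plus P \<A> \<S> A S a Q M \<delta> x p e L by fact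
  interpret softmw_reference P \<A> \<S> A S a Q M \<delta> x p e L \<alpha> \<theta> C\<^sub>V
    by unfold_locales (use assms in \<open>auto simp: piecewise_stabilizable_def\<close>)
  define c where "c = (2 * (K + 1) * M\<^sup>2 + 4 * C\<^sub>W * (K * M\<^sup>2 + \<epsilon> * K * M)) / \<epsilon>"
  define avg where "avg T = 1 / real T * (\<integral>\<omega>. (\<Sum>t\<in>{1..T}. norm1 (Q t \<omega>)) \<partial>P)" for T
  have avg: "avg T = 1 / real T * (\<Sum>t\<in>{1..T}. \<Sum>i\<in>UNIV. mQ t i)" for T
  proof -
    have "(\<integral>\<omega>. (\<Sum>t\<in>{1..T}. norm1 (Q t \<omega>)) \<partial>P) = (\<integral>\<omega>. (\<Sum>t\<in>{1..T}. \<Sum>i\<in>UNIV. Q t \<omega> $ i) \<partial>P)"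
      by (intro Bochner_Integration.integral_cong) (simp_all add: norm1_Q)
    also have "\<dots> = (\<Sum>t\<in>{1..T}. \<Sum>i\<in>UNIV. mQ t i)"
      unfolding mQ_def
      by (simp add: Bochner_Integration.integral_sum Bochner_Integration.integrable_sum Q_integrable1)
    finally show ?thesis by (simp add: avg_def)
  qed
  have ev: "\<forall>\<^sub>F T in sequentially. (\<Sum>t\<in>{1..T}. \<Sum>i\<in>UNIV. mQ t i) \<le> c * real T"
    using averaged_queue_bound[OF assms(2)] by (simp add: c_def assms(9))
  \<comment> \<open>The bound holds without any error term from some \<open>T\<close> on, so the
    error is the excess over \<open>c\<close> and is nonzero at most finitely often.\<close>
  define r where "r T = max 0 (avg T - c)" for T
  have "\<forall>\<^sub>F T in sequentially. r T = 0"
    using ev eventually_gt_at_top[of 0]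
    by eventually_elim (simp add: r_def avg divide_le_eq)
  then have "r \<in> o(\<lambda>_. 1)" by (intro smalloI_tendsto) (simp_all add: tendsto_eventually)
  moreover have "avg T \<le> c + r T" for T by (simp add: r_def)
  moreover have "stable P Q"
    unfolding stable_def
  proof (intro conjI allI)
    show "integrable P (\<lambda>\<omega>. Q t \<omega> $ i)" for t i by (rule Q_integrable1)
    show "(\<lambda>T::nat. 1 / real T * (\<Sum>t<T. \<Sum>i\<in>UNIV. (\<integral>\<omega>. Q t \<omega> $ i \<partial>P))) \<in> O(\<lambda>_. 1)"
    proof (rule bigoI[where c = c])
      show "\<forall>\<^sub>F T in sequentially. norm (1 / real T * (\<Sum>t<T. \<Sum>i\<in>UNIV. (\<integral>\<omega>. Q t \<omega> $ i \<partial>P))) \<le> c * norm (1 :: real)"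
        using ev eventually_gt_at_top[of 0]
      proof eventually_elim
        case (elim T)
        \<comment> \<open>Stability averages over slots 0 to T - 1, the bound over 1 to T; slot 0
          contributes nothing because the queues start empty.\<close>
        have "mQ 0 i = 0" for i using mQ_le[of 0 i] mQ_nonneg[of 0 i] by simp
        then have "(\<Sum>t<T. \<Sum>i\<in>UNIV. mQ t i) = (\<Sum>t\<in>{1..<T}. \<Sum>i\<in>UNIV. mQ t i)"
          by (intro sum.mono_neutral_right) (auto simp: not_le)
        also have "\<dots> \<le> (\<Sum>t\<in>{1..T}. \<Sum>i\<in>UNIV. mQ t i)"
          by (intro sum_mono2 sum_nonneg mQ_nonneg) auto
        finally have "(\<Sum>t<T. \<Sum>i\<in>UNIV. mQ t i) \<le> c * real T" using elim by simp
        moreover have "0 \<le> (\<Sum>t<T. \<Sum>i\<in>UNIV. mQ t i)" by (intro sum_nonneg mQ_nonneg)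
        ultimately show ?case using elim by (simp add: mQ_def[symmetric] divide_le_eq)
      qed
    qed
  qed
  ultimately show ?thesis unfolding avg_def c_def by blast
qed

end
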